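(* Let $G$ be a finite, simple, undirected planar graph with minimum degree $\delta(G) \geq 3$. Then $b_i(G) \leq 8$.
   Context: An independent dominating set of a graph $G$ is a set $D \subseteq V(G)$ that is independent (no two vertices of $D$ are adjacent) and dominating (every vertex of $G$ is in $D$ or adjacent to a vertex of $D$). The independent domination number $\gamma_i(G)$ is the minimum cardinality of an independent dominating set of $G$. The independent bondage number $b_i(G)$ is the minimum cardinality of an edge set $B \subseteq E(G)$ such that $\gamma_i(G - B) > \gamma_i(G)$, where $G-B$ is the graph obtained from $G$ by deleting the edges of $B$. *)

theory Defs
  imports "HOL-Analysis.Analysis" "HOL-Library.Extended_Nat"
begin

text \<open>A graph is given by its vertex set \<open>V\<close> and its edge set \<open>E\<close>; an edge is the
  two-element set of its ends.\<close>

definition simple_graph :: "'a set \<Rightarrow> 'a set set \<Rightarrow> bool" where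
  "simple_graph V E \<longleftrightarrow> (\<forall>e\<in>E. e \<subseteq> V \<and> card e = 2)"

definition vertex_degree :: "'a set set \<Rightarrow> 'a \<Rightarrow> nat" where
  "vertex_degree E v = card {e \<in> E. v \<in> e}"

text \<open>Meaningful only for finite nonempty \<open>V\<close>.\<close>

definition min_degree :: "'a set \<Rightarrow> 'a set set \<Rightarrow> nat" where
  "min_degree V E = Min (vertex_degree E ` V)"

text \<open>Planarity is topological: \<open>p\<close> places the vertices at distinct points of the plane
  (taken to be \<open>complex\<close>) and \<open>\<gamma>\<close> draws every edge as a simple arc joining its ends, such
  that an edge meets the vertex points only in its ends and two distinct edges meet only in
  common ends.\<close>

definition plane_drawing ::
    "'a set \<Rightarrow> 'a set set \<Rightarrow> ('a \<Rightarrow> complex) \<Rightarrow> ('a set \<Rightarrow> real \<Rightarrow> complex) \<Rightarrow> bool" where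
  "plane_drawing V E p \<gamma> \<longleftrightarrow>
     inj_on p V \<and>
     (\<forall>e\<in>E. arc (\<gamma> e) \<and> {pathstart (\<gamma> e), pathfinish (\<gamma> e)} = p ` e \<and>
            path_image (\<gamma> e) \<inter> p ` V = p ` e) \<and>
     (\<forall>e\<in>E. \<forall>f\<in>E. e \<noteq> f \<longrightarrow> path_image (\<gamma> e) \<inter> path_image (\<gamma> f) = p ` (e \<inter> f))"

definition planar :: "'a set \<Rightarrow> 'a set set \<Rightarrow> bool" where
  "planar V E \<longleftrightarrow> (\<exists>p \<gamma>. plane_drawing V E p \<gamma>)"

definition independent_set :: "'a set set \<Rightarrow> 'a set \<Rightarrow> bool" where
  "independent_set E D \<longleftrightarrow> (\<forall>u\<in>D. \<forall>v\<in>D. {u, v} \<notin> E)"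

definition dominating_set :: "'a set \<Rightarrow> 'a set set \<Rightarrow> 'a set \<Rightarrow> bool" where
  "dominating_set V E D \<longleftrightarrow> (\<forall>v\<in>V. v \<in> D \<or> (\<exists>u\<in>D. {u, v} \<in> E))"

definition independent_dominating_set :: "'a set \<Rightarrow> 'a set set \<Rightarrow> 'a set \<Rightarrow> bool" where
  "independent_dominating_set V E D \<longleftrightarrow>
     D \<subseteq> V \<and> independent_set E D \<and> dominating_set V E D"

definition independent_domination_number :: "'a set \<Rightarrow> 'a set set \<Rightarrow> nat" where
  "independent_domination_number V E =
     (LEAST k. \<exists>D. independent_dominating_set V E D \<and> card D = k)"

text \<open>The minimum is taken in \<open>enat\<close>, so that it is \<open>\<infinity>\<close>, rather than \<open>0\<close>, when no
  edge set increases the independent domination number.\<close>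

definition independent_bondage_number :: "'a set \<Rightarrow> 'a set set \<Rightarrow> enat" where
  "independent_bondage_number V E =
     (INF B \<in> {B. B \<subseteq> E \<and>
        independent_domination_number V (E - B) > independent_domination_number V E}.
      enat (card B))"

text \<open>A maximal independent set is dominating, so the minimum defining the independent
  domination number of a finite simple graph is over a nonempty set.\<close>

lemma independent_dominating_set_exists:
  assumes "finite V" "simple_graph V E"
  shows "\<exists>D. independent_dominating_set V E D"
proof -
  let ?I = "{D. D \<subseteq> V \<and> independent_set E D}"
  have no_loop: "{v} \<notin> E" for v
  proof
    assume "{v} \<in> E"
    with assms(2) have "card {v} = 2"
      unfolding simple_graph_def by blast
    then show False by simp
  qed
  have "?I \<subseteq> Pow V" by blast
  then have fin: "finite ?I"
    using assms(1) by (meson finite_Pow_iff finite_subset)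
  have "{} \<in> ?I"
    by (simp add: independent_set_def)
  with fin obtain D where D: "D \<in> ?I" and max: "\<And>D'. D' \<in> ?I \<Longrightarrow> D \<subseteq> D' \<Longrightarrow> D = D'"
    by (metis (no_types, lifting) finite_has_maximal empty_iff)
  have dom: "\<exists>u\<in>D. {u, v} \<in> E" if v: "v \<in> V" "v \<notin> D" for v
  proof (rule ccontr)
    assume not_adj: "\<not> (\<exists>u\<in>D. {u, v} \<in> E)"
    have "{x, y} \<notin> E" if xy: "x \<in> insert v D" "y \<in> insert v D" for x y
    proof -
      consider "x = v" "y = v" | "x = v" "y \<in> D" | "x \<in> D" "y = v" | "x \<in> D" "y \<in> D"
        using xy by blast
      then show ?thesis
      proof cases
        case 1 then show ?thesis using no_loop by simp
      next
        case 2
        then have "{y, x} \<notin> E" using not_adj by blast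
        then show ?thesis by (metis insert_commute)
      next
        case 3 then show ?thesis using not_adj by blast
      next
        case 4 then show ?thesis using D unfolding independent_set_def by blast
      qed
    qed
    then have "insert v D \<in> ?I"
      using D v(1) unfolding independent_set_def by blast
    from max[OF this] have "D = insert v D" by blast
    with v(2) show False by blast
  qed
  have "independent_dominating_set V E D"
    unfolding independent_dominating_set_def dominating_set_def using D dom by blast
  then show ?thesis by blast
qed

end

theory Submission imports Defs
begin

text \<open>Suppose that no set of at most 8 edges increases the independent domination number. Deleting edges
  so that a vertex becomes isolated, or so that a set of neighbours of low degree of a vertex \<open>v\<close> becomes
  a set of leaves hanging from \<open>v\<close>, then excludes several configurations of low-degree vertices.
  Consider a leaf block of \<open>G\<close>, attached at \<open>z\<close>. It arises from a cycle by adding ears, so by the theorem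
  on theta curves its faces are bounded by cycles and Euler's formula holds. Let every vertex of degree
  at most 5 take charge from its long faces and from its neighbours of large degree. The total charge is
  negative and \<open>z\<close> gives away only little, so some \<open>v \<noteq> z\<close> of degree at least 6 gives away more than
  its initial charge. Counting the corners of the faces at \<open>v\<close> leaves a short list of possible
  neighbourhoods, each of which contains an excluded configuration.\<close>

section \<open>Upper bounds for the bondage number\<close>

text \<open>Restoring deleted edges may destroy independence, and dropping vertices may destroy
  domination, so no exclusion follows from monotonicity. Each one takes an arbitrary independent
  dominating set \<open>D\<close> of the thinned graph, discards the conflicting vertices, extends
  the rest to a maximal independent set of \<open>G\<close> and shows that fewer vertices come back
  than went. This is why neighbours of \<open>v\<close> whose outer neighbours form a clique matter:
  each of them lets at most one vertex come back. The budget 8 is reached exactly in the last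
  configurations, as \<open>2 + 2 + 3 + 1\<close>, and it yields the lower bounds 10, 11 and 12 for
  the degree sums of edges. A block is needed because the rules count corners, which presupposes
  that every face is a cycle and that the faces at a vertex form a single rotation. A leaf block has
  only one vertex \<open>z\<close> whose degree may differ from its degree in \<open>G\<close>, and
  the final charge of \<open>z\<close> is at least -60, half of the total -120.\<close>

abbreviation iid :: "'a set \<Rightarrow> 'a set set \<Rightarrow> 'a set \<Rightarrow> bool" where
  "iid \<equiv> independent_dominating_set"

definition nbrs :: "'a set set \<Rightarrow> 'a \<Rightarrow> 'a set" where
  "nbrs E v = {x. {v, x} \<in> E}"

lemma nbrs_sym: "x \<in> nbrs E v \<longleftrightarrow> v \<in> nbrs E x"
  by (simp add: nbrs_def insert_commute)

locale fgraph =
  fixes V :: "'a set" and E :: "'a set set"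
  assumes finV: "finite V" and simple: "simple_graph V E"
begin

lemma edgeD: "{x, y} \<in> E \<Longrightarrow> x \<in> V \<and> y \<in> V \<and> x \<noteq> y"
  using simple unfolding simple_graph_def by (force simp: card_insert_if)

lemma edgeE: assumes "e \<in> E" obtains x y where "e = {x, y}" "x \<noteq> y" "x \<in> V" "y \<in> V"
  using assms simple unfolding simple_graph_def by (metis card_2_iff insert_subset)

lemma nbrs_subset: "nbrs E v \<subseteq> V - {v}"
  using edgeD unfolding nbrs_def by auto

lemma finite_nbrs [simp]: "finite (nbrs E v)"
  using nbrs_subset finV finite_subset by blast

lemma finE: "finite E"
proof -
  have "E \<subseteq> Pow V" using simple unfolding simple_graph_def by auto
  then show ?thesis using finV finite_subset by blast
qed

lemma degree_eq_card_nbrs: "vertex_degree E v = card (nbrs E v)"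
proof -
  have "{e \<in> E. v \<in> e} = (\<lambda>x. {v, x}) ` nbrs E v"
  proof (intro equalityI subsetI)
    fix e assume e: "e \<in> {e \<in> E. v \<in> e}"
    then obtain x where "e = {v, x}" by (auto elim!: edgeE simp: insert_commute)
    then show "e \<in> (\<lambda>x. {v, x}) ` nbrs E v" using e by (auto simp: nbrs_def)
  qed (auto simp: nbrs_def)
  moreover have "inj_on (\<lambda>x. {v, x}) (nbrs E v)"
    by (auto simp: inj_on_def doubleton_eq_iff)
  ultimately show ?thesis unfolding vertex_degree_def by (simp add: card_image)
qed

lemma fgraph_diff: "fgraph V (E - B)"
  using finV simple by unfold_locales (auto simp: simple_graph_def)

lemma iid_iff: "iid V E D \<longleftrightarrow> D \<subseteq> V \<and> (\<forall>u\<in>D. nbrs E u \<inter> D = {}) \<and> (\<forall>v\<in>V - D. nbrs E v \<inter> D \<noteq> {})"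
  unfolding independent_dominating_set_def independent_set_def dominating_set_def nbrs_def
  by (auto simp: insert_commute)

text \<open>The \<open>LEAST\<close> for the thinned graph is attained because that graph still has
  an independent dominating set; \<open>smaller\<close> is applied to a minimum one.\<close>

lemma bondage_le:
  assumes B: "B \<subseteq> E" "card B \<le> 8"
    and smaller: "\<And>D. iid V (E - B) D \<Longrightarrow> \<exists>D'. iid V E D' \<and> card D' < card D"
  shows "independent_bondage_number V E \<le> 8"
proof -
  interpret GB: fgraph V "E - B" by (rule fgraph_diff)
  obtain D0 where "iid V (E - B) D0"
    using independent_dominating_set_exists[OF finV GB.simple] by blast
  then have "\<exists>D. iid V (E - B) D \<and> card D = independent_domination_number V (E - B)"
    unfolding independent_domination_number_def by (intro LeastI_ex[where P = "\<lambda>k. \<exists>D. iid V (E - B) D \<and> card D = k"]) auto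
  then obtain D where D: "iid V (E - B) D" "card D = independent_domination_number V (E - B)"
    by blast
  obtain D' where D': "iid V E D'" "card D' < card D" using smaller[OF D(1)] by blast
  have "independent_domination_number V E \<le> card D'"
    unfolding independent_domination_number_def using D'(1) by (intro Least_le) auto
  then have "independent_domination_number V E < independent_domination_number V (E - B)"
    using D'(2) D(2) by simp
  then have "independent_bondage_number V E \<le> enat (card B)"
    unfolding independent_bondage_number_def using B(1) by (intro INF_lower) auto
  also have "\<dots> \<le> 8" using B(2) by (simp add: numeral_eq_enat)
  finally show ?thesis .
qed

text \<open>A maximal independent superset dominates. This is the repair step of the exclusion
  arguments: after vertices have been thrown out of a set, \<open>I\<close> restores domination, and
  \<open>card I\<close> remains to be bounded.\<close>

lemma extend_independent:
  assumes "D \<subseteq> V" "\<forall>u\<in>D. nbrs E u \<inter> D = {}"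
  obtains I where "iid V E (D \<union> I)" "I \<inter> D = {}" "I \<subseteq> V" "\<forall>u\<in>I. nbrs E u \<inter> (D \<union> I) = {}"
proof -
  let ?S = "{S. D \<subseteq> S \<and> S \<subseteq> V \<and> (\<forall>u\<in>S. nbrs E u \<inter> S = {})}"
  have "finite ?S" using finV by (auto intro: finite_subset[of _ "Pow V"])
  moreover have "D \<in> ?S" using assms by auto
  ultimately obtain S where S: "S \<in> ?S" and max: "\<And>S'. S' \<in> ?S \<Longrightarrow> S \<subseteq> S' \<Longrightarrow> S = S'"
    by (metis (no_types, lifting) finite_has_maximal empty_iff)
  have "nbrs E v \<inter> S \<noteq> {}" if "v \<in> V - S" for v
  proof
    assume *: "nbrs E v \<inter> S = {}"
    then have "nbrs E u \<inter> insert v S = {}" if "u \<in> insert v S" for u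
      using that S nbrs_subset[of u] nbrs_sym[of v E u] by blast
    then have "insert v S \<in> ?S" using S that by blast
    with max[of "insert v S"] that show False by blast
  qed
  then have "iid V E S" using S by (auto simp: iid_iff)
  moreover have "S = D \<union> (S - D)" using S by auto
  ultimately show ?thesis using that[of "S - D"] S by auto
qed

text \<open>Deleting \<open>B\<close> isolates \<open>u\<close>, so \<open>u\<close> belongs to every independent dominating set of the
  remaining graph; the remaining neighbours \<open>S\<close> of \<open>v\<close> force a redundancy around \<open>u\<close> and \<open>v\<close>.\<close>

lemma pair_bound:
  assumes uv: "{u, v} \<in> E" and S: "S \<subseteq> nbrs E u \<inter> nbrs E v"
    and few: "\<And>y. y \<in> nbrs E u - {v} - S \<Longrightarrow> card (S - nbrs E y) \<le> 1"
    and deg: "vertex_degree E u + vertex_degree E v \<le> 9 + card S"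
  shows "independent_bondage_number V E \<le> 8"
proof -
  define B where "B = (\<lambda>x. {u, x}) ` nbrs E u \<union> (\<lambda>x. {v, x}) ` (nbrs E v - S - {u})"
  have uv': "u \<in> V" "v \<in> V" "u \<noteq> v" "v \<in> nbrs E u" "u \<in> nbrs E v"
    using edgeD[OF uv] uv by (auto simp: nbrs_def insert_commute)
  have "finite S" using S finite_nbrs finite_subset by blast
  have uS: "u \<notin> S" "v \<notin> S" using S nbrs_subset by blast+
  have "B \<subseteq> E" by (auto simp: B_def nbrs_def)
  moreover have "card B \<le> 8"
  proof -
    \<comment> \<open>The edge \<open>{u, v}\<close> is counted at \<open>u\<close> only, so the
      bound is the degree sum minus \<open>card S + 1\<close>, which is at most 8.\<close>
    have "card B \<le> card (nbrs E u) + card (nbrs E v - S - {u})"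
      unfolding B_def by (intro order_trans[OF card_Un_le] add_mono card_image_le) auto
    also have "card (nbrs E v - S - {u}) = card (nbrs E v) - card S - 1"
      using S uv' uS \<open>finite S\<close> by (simp add: card_Diff_subset)
    moreover have "card (insert u S) \<le> card (nbrs E v)"
      using S uv' by (intro card_mono) auto
    then have "card S + 1 \<le> card (nbrs E v)" using uS \<open>finite S\<close> by simp
    ultimately show ?thesis using deg unfolding degree_eq_card_nbrs by linarith
  qed
  moreover have "\<exists>D'. iid V E D' \<and> card D' < card D" if D: "iid V (E - B) D" for D
  proof -
    interpret GB: fgraph V "E - B" by (rule fgraph_diff)
    have nu: "nbrs (E - B) u = {}" by (auto simp: nbrs_def B_def)
    have nv: "nbrs (E - B) v = S"
    proof
      show "nbrs (E - B) v \<subseteq> S"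
        using uv' by (auto simp: nbrs_def B_def image_iff doubleton_eq_iff insert_commute)
      show "S \<subseteq> nbrs (E - B) v"
        using S uS uv' by (auto simp: nbrs_def B_def image_iff doubleton_eq_iff)
    qed
    have nother: "nbrs (E - B) y = nbrs E y - ((if y \<in> S then {} else {v}) \<union> {u})" if "y \<noteq> u" "y \<noteq> v" for y
      using that S uS unfolding nbrs_def B_def by (auto simp: image_iff doubleton_eq_iff insert_commute)
    have Dfacts: "D \<subseteq> V" "\<And>x. x \<in> D \<Longrightarrow> nbrs (E - B) x \<inter> D = {}"
      "\<And>x. x \<in> V - D \<Longrightarrow> nbrs (E - B) x \<inter> D \<noteq> {}"
      using D unfolding GB.iid_iff by auto
    have finD: "finite D" using Dfacts(1) finV finite_subset by blast
    have uD: "u \<in> D" using Dfacts(3)[of u] nu uv' by auto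
    have less: "card (D - {u}) < card D" by (rule card_Diff1_less[OF finD uD])
    have ind: "nbrs E x \<inter> (D - {u,v}) = {}" if "x \<in> D - {u,v}" for x
      using Dfacts(2)[of x] nother[of x] that by (auto split: if_splits)
    show ?thesis
    proof (cases "v \<in> D")
      case False
      \<comment> \<open>Only edges to \<open>S\<close> remain at \<open>v\<close>, so some
        \<open>c\<close> in \<open>S\<close> dominates it. In \<open>G\<close> this \<open>c\<close>
        dominates \<open>u\<close> as well, and \<open>u\<close> becomes redundant.\<close>
      then obtain c where c: "c \<in> S" "c \<in> D" using Dfacts(3)[of v] nv uv' by auto
      have "nbrs E x \<inter> (D - {u}) \<noteq> {}" if "x \<in> V - (D - {u})" for x
      proof (cases "x = u \<or> x = v")
        case True then show ?thesis using c S uS by auto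
      next
        case 2: False
        then have "nbrs (E - B) x \<inter> D \<noteq> {}" using Dfacts(3)[of x] that by auto
        then show ?thesis using 2 nother[of x] by auto
      qed
      then have "iid V E (D - {u})"
        using Dfacts(1) ind False unfolding iid_iff by auto
      then show ?thesis using less by blast
    next
      case vD: True
      have SD: "S \<inter> D = {}" using Dfacts(2)[OF vD] nv by auto
      have dom: "nbrs E x \<inter> (D - {u,v}) \<noteq> {}" if "x \<in> V - D - S" for x
      proof -
        have "x \<noteq> u" "x \<noteq> v" using that uD vD by auto
        then show ?thesis using Dfacts(3)[of x] that nother[of x] by auto
      qed
      show ?thesis
      proof (cases "nbrs E v \<inter> (D - {u,v}) = {}")
        case True
        have "iid V E (D - {u})"
        proof -
          have "nbrs E x \<inter> (D - {u}) = {}" if "x \<in> D - {u}" for x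
            using that ind[of x] True nbrs_sym[of v E x] nbrs_subset[of v] by (cases "x = v") auto
          moreover have "nbrs E x \<inter> (D - {u}) \<noteq> {}" if "x \<in> V - (D - {u})" for x
          proof (cases "x = u \<or> x \<in> S")
            case True
            then have "v \<in> nbrs E x" using S uv' nbrs_sym[of v E x] by auto
            then show ?thesis using vD uv' by auto
          next
            case False then show ?thesis using dom[of x] that by auto
          qed
          ultimately show ?thesis using Dfacts(1) unfolding iid_iff by auto
        qed
        then show ?thesis using less by blast
      next
        case vdom: False
        show ?thesis
        proof (cases "nbrs E u \<inter> (D - {u,v}) = {}")
          case True
          have "iid V E (D - {v})"
          proof -
            have "nbrs E x \<inter> (D - {v}) = {}" if "x \<in> D - {v}" for x
              using that ind[of x] True nbrs_sym[of u E x] nbrs_subset[of u] by (cases "x = u") auto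
            moreover have "nbrs E x \<inter> (D - {v}) \<noteq> {}" if "x \<in> V - (D - {v})" for x
            proof (cases "x = v \<or> x \<in> S")
              case True
              then have "u \<in> nbrs E x" using S uv' nbrs_sym[of u E x] by auto
              then show ?thesis using uD uv' by auto
            next
              case False then show ?thesis using dom[of x] that by auto
            qed
            ultimately show ?thesis using Dfacts(1) unfolding iid_iff by auto
          qed
          moreover have "card (D - {v}) < card D" by (rule card_Diff1_less[OF finD vD])
          ultimately show ?thesis by blast
        next
          case False
          \<comment> \<open>Both \<open>u\<close> and \<open>v\<close> are dominated by the rest of
            \<open>D\<close>, so both are dropped. Only vertices of \<open>S\<close> can lose their
            dominator, and \<open>y\<close> still dominates all but at most one of them: two
            vertices go and at most one comes back.\<close>
          then obtain y where y: "y \<in> nbrs E u" "y \<in> D" "y \<noteq> u" "y \<noteq> v" by auto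
          then have "card (S - nbrs E y) \<le> 1" using few SD by auto
          obtain I where I: "iid V E ((D - {u,v}) \<union> I)" "I \<inter> (D - {u,v}) = {}" "I \<subseteq> V"
            "\<forall>x\<in>I. nbrs E x \<inter> ((D - {u,v}) \<union> I) = {}"
            using extend_independent[of "D - {u,v}"] Dfacts(1) ind by blast
          have "I \<subseteq> S - nbrs E y"
          proof
            fix x assume x: "x \<in> I"
            then have nx: "nbrs E x \<inter> (D - {u,v}) = {}" using I(4) by auto
            have "x \<noteq> u" "x \<noteq> v" using nx vdom False by auto
            then have "x \<in> S" using dom[of x] nx x I by blast
            moreover have "x \<notin> nbrs E y" using nx y nbrs_sym[of x E y] by auto
            ultimately show "x \<in> S - nbrs E y" by simp
          qed
          then have "card I \<le> 1" using \<open>card (S - nbrs E y) \<le> 1\<close> \<open>finite S\<close>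
            by (meson card_mono finite_Diff order_trans)
          have "card (D - {u,v}) = card D - 2" using uD vD uv' finD by (simp add: card_Diff_subset)
          moreover have "card {u,v} \<le> card D" using uD vD finD by (intro card_mono) auto
          then have "2 \<le> card D" using uv' by simp
          ultimately have "card ((D - {u,v}) \<union> I) < card D"
            using \<open>card I \<le> 1\<close> card_Un_le[of "D - {u,v}" I] by linarith
          then show ?thesis using I(1) by blast
        qed
      qed
    qed
  qed
  ultimately show ?thesis by (rule bondage_le)
qed

end

context fgraph
begin

text \<open>\<open>L\<close> becomes a set of leaves hanging from \<open>v\<close> and \<open>u0\<close> is isolated, so that a minimum independent
  dominating set avoids \<open>v\<close> and the other neighbours of \<open>L\<close>. The optional vertex \<open>w \<in> W\<close> keeps
  only its edges to \<open>v\<close> and \<open>z\<close>, which excludes the common neighbours of \<open>w\<close>, \<open>v\<close> and \<open>z\<close> as well.\<close>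

lemma kill_bound:
  assumes L: "L \<subseteq> nbrs E v" "finite L" "card L \<ge> 2" "\<And>x. x \<in> L \<Longrightarrow> nbrs E x \<inter> L = {}"
    and W: "W = {} \<or> W = {w}"
    and Ww: "W \<noteq> {} \<Longrightarrow> w \<in> nbrs E v - L \<and> nbrs E w \<inter> L = {} \<and> z \<in> nbrs E w \<and> z \<noteq> v \<and>
       (\<forall>y \<in> nbrs E w - {v, z}. y \<in> nbrs E z \<or> (\<exists>x\<in>L. y \<in> nbrs E x))"
    and cost: "(\<Sum>x\<in>L. vertex_degree E x - 1) + 1 + (\<Sum>x\<in>W. vertex_degree E x - 2) \<le> 8"
    and fin: "\<And>D I. D \<subseteq> V \<Longrightarrow> (\<And>x. x \<in> D \<Longrightarrow> nbrs E x \<inter> D = {}) \<Longrightarrow>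
       (\<And>x. x \<in> V - D \<Longrightarrow> nbrs E x \<inter> D \<noteq> {}) \<Longrightarrow> L \<subseteq> D \<Longrightarrow>
       (W \<noteq> {} \<Longrightarrow> nbrs E w \<inter> nbrs E z \<inter> nbrs E v \<inter> D = {}) \<Longrightarrow>
       I \<subseteq> V \<Longrightarrow> (\<And>x. x \<in> I \<Longrightarrow> nbrs E x \<inter> I = {}) \<Longrightarrow>
       (\<And>x. x \<in> I \<Longrightarrow> x \<notin> nbrs E v \<and> x \<noteq> v \<and> nbrs E x \<inter> (D \<inter> nbrs E v - L) \<noteq> {}) \<Longrightarrow>
       card I + 2 \<le> card (D \<inter> nbrs E v)"
  shows "independent_bondage_number V E \<le> 8"
proof -
  obtain u0 where u0: "u0 \<in> L" using L(3) by fastforce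
  have "v \<in> nbrs E u0" using u0 L(1) nbrs_sym[of v E u0] by blast
  then have vV: "v \<in> V" using nbrs_subset by blast
  have vL: "v \<notin> L" "v \<notin> W"
  proof -
    show "v \<notin> L" using L(1) nbrs_subset[of v] by blast
    show "v \<notin> W" using W Ww nbrs_subset[of v] by (cases "W = {}") auto
  qed
  have Wv: "x \<in> nbrs E v - L \<and> nbrs E x \<inter> L = {} \<and> x = w" if "x \<in> W" for x
  proof -
    have "x = w" "W \<noteq> {}" using that W by auto
    then show ?thesis using Ww by simp
  qed
  \<comment> \<open>\<open>Z x\<close> holds the far ends of the edges deleted at \<open>x\<close>:
    \<open>u0\<close> keeps no edge, the other vertices of \<open>L\<close> keep \<open>v\<close>,
    and \<open>w\<close> keeps \<open>v\<close> and \<open>z\<close>.\<close>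
  define Z where "Z = (\<lambda>x. if x = u0 then nbrs E x else if x \<in> L then nbrs E x - {v}
     else if x \<in> W then nbrs E x - {v, z} else {})"
  define B where "B = (\<Union>x\<in>L \<union> W. (\<lambda>y. {x, y}) ` Z x)"
  have ZN: "Z x \<subseteq> nbrs E x" for x by (auto simp: Z_def)
  have LW: "finite (L \<union> W)" "L \<inter> W = {}" using L W Wv by auto
  have Zdisj: "Z x \<inter> (L \<union> W) = {}" for x
  proof (cases "x \<in> L \<union> W")
    case True
    then consider "x \<in> L" | "x \<in> W" by auto
    then show ?thesis
    proof cases
      case 1
      then have "y \<notin> W" if "y \<in> Z x" for y using Wv[of y] ZN[of x] that nbrs_sym[of x E y] by blast
      then show ?thesis using 1 L(4)[OF 1] ZN[of x] by blast
    next
      case 2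
      then have "Z x \<inter> W = {}" using Wv[OF 2] W ZN[of x] nbrs_subset[of x] by blast
      then show ?thesis using Wv[OF 2] ZN[of x] by blast
    qed
  next
    case False then show ?thesis using u0 by (auto simp: Z_def)
  qed
  have finZ: "finite (Z x)" for x using ZN finite_nbrs by (rule finite_subset)
  have "B \<subseteq> E" using ZN by (auto simp: B_def nbrs_def)
  moreover have "card B \<le> 8"
  proof -
    have "card B \<le> (\<Sum>x\<in>L \<union> W. card (Z x))"
      unfolding B_def using LW(1) finZ
      by (intro order_trans[OF card_UN_le] sum_mono card_image_le) auto
    also have "\<dots> = (\<Sum>x\<in>L. card (Z x)) + (\<Sum>x\<in>W. card (Z x))"
      using LW L(2) by (intro sum.union_disjoint) auto
    also have "(\<Sum>x\<in>L. card (Z x)) \<le> (\<Sum>x\<in>L. vertex_degree E x - 1) + 1"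
    proof -
      have "(\<Sum>x\<in>L - {u0}. card (Z x)) = (\<Sum>x\<in>L - {u0}. vertex_degree E x - 1)"
      proof (rule sum.cong)
        fix x assume "x \<in> L - {u0}"
        moreover from this have "v \<in> nbrs E x" using L(1) nbrs_sym[of v E x] by blast
        ultimately show "card (Z x) = vertex_degree E x - 1"
          by (simp add: Z_def degree_eq_card_nbrs)
      qed simp
      moreover have "card (Z u0) \<le> vertex_degree E u0 - 1 + 1"
        by (simp add: Z_def degree_eq_card_nbrs)
      ultimately show ?thesis using L(2) u0 by (simp add: sum.remove)
    qed
    also have "(\<Sum>x\<in>W. card (Z x)) \<le> (\<Sum>x\<in>W. vertex_degree E x - 2)"
    proof (rule sum_mono)
      fix x assume x: "x \<in> W"
      then have "x \<notin> L" "x \<noteq> u0" "x = w" "v \<in> nbrs E x" "z \<in> nbrs E x" "z \<noteq> v"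
        using Wv[OF x] Ww u0 nbrs_sym[of v E x] by auto
      then show "card (Z x) \<le> vertex_degree E x - 2"
        using x by (simp add: Z_def degree_eq_card_nbrs card_Diff_subset)
    qed
    finally show ?thesis using cost by linarith
  qed
  moreover have "\<exists>D'. iid V E D' \<and> card D' < card D" if D: "iid V (E - B) D" for D
  proof -
    interpret GB: fgraph V "E - B" by (rule fgraph_diff)
    have nB: "y \<in> nbrs (E - B) x \<longleftrightarrow> y \<in> nbrs E x \<and> y \<notin> Z x \<and> x \<notin> Z y" for x y
    proof -
      have "{x, y} \<in> B \<longleftrightarrow> y \<in> Z x \<or> x \<in> Z y"
      proof
        assume "{x, y} \<in> B"
        then obtain a b where "a \<in> L \<union> W" "b \<in> Z a" "{x,y} = {a,b}" unfolding B_def by blast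
        then show "y \<in> Z x \<or> x \<in> Z y" by (metis doubleton_eq_iff)
      next
        have in_B: "{a, b} \<in> B" if "b \<in> Z a" for a b
        proof -
          have "a \<in> L \<union> W" using that u0 by (auto simp: Z_def split: if_splits)
          then show ?thesis using that unfolding B_def by blast
        qed
        show "y \<in> Z x \<or> x \<in> Z y \<Longrightarrow> {x, y} \<in> B"
          using in_B[of y x] in_B[of x y] by (auto simp: insert_commute)
      qed
      then show ?thesis by (simp add: nbrs_def)
    qed
    have DV: "D \<subseteq> V" and Dind: "\<And>x y. x \<in> D \<Longrightarrow> y \<in> D \<Longrightarrow> y \<in> nbrs E x \<Longrightarrow> y \<in> Z x \<or> x \<in> Z y"
      and Ddom: "\<And>x. x \<in> V - D \<Longrightarrow> \<exists>y\<in>D. y \<in> nbrs E x \<and> y \<notin> Z x \<and> x \<notin> Z y"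
      using D nB unfolding GB.iid_iff by blast+
    have finD: "finite D" using DV finV finite_subset by blast
    \<comment> \<open>The vertices of \<open>D\<close> in conflict with \<open>D\<close> through a
      deleted edge. All of them lie in \<open>L \<union> W\<close>, and \<open>D - C\<close> is
      independent in \<open>G\<close>; it remains to see that the repair set \<open>I\<close> is
      smaller than \<open>C\<close>.\<close>
    define C where "C = {x \<in> D. Z x \<inter> D \<noteq> {}}"
    have CLW: "C \<subseteq> L \<union> W" using u0 by (auto simp: C_def Z_def split: if_splits)
    have finC: "finite C" using finD by (simp add: C_def)
    have ZC: "Z x \<inter> C = {}" for x using Zdisj[of x] CLW by blast
    have ind1: "nbrs E x \<inter> (D - C) = {}" if "x \<in> D - C" for x
      using Dind[of x] that unfolding C_def by blast
    have domC: "\<exists>y \<in> D - C. y \<in> nbrs E x" if "x \<in> C" for x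
      using that ZC[of x] ZN[of x] unfolding C_def by blast
    obtain I where I: "iid V E ((D - C) \<union> I)" "I \<inter> (D - C) = {}" "I \<subseteq> V"
      "\<forall>x\<in>I. nbrs E x \<inter> ((D - C) \<union> I) = {}"
      using extend_independent[of "D - C"] DV ind1 by blast
    have IC: "x \<notin> C" "x \<notin> D" if "x \<in> I" for x using that I domC by blast+
    have Iprop: "\<exists>y\<in>C. y \<in> nbrs E x \<and> y \<notin> Z x \<and> x \<notin> Z y" if "x \<in> I" for x
      using Ddom[of x] I(3,4) IC[OF that] that by blast
    \<comment> \<open>A vertex that needs repair had its dominator in \<open>C\<close> through a
      kept edge, and kept edges at \<open>L \<union> W\<close> lead to \<open>v\<close>, or from
      \<open>w\<close> to \<open>z\<close>.\<close>
    have Ivz: "x = v \<or> (W \<noteq> {} \<and> w \<in> C \<and> x = z)" if "x \<in> I" for x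
    proof -
      obtain y where y: "y \<in> C" "y \<in> nbrs E x" "x \<notin> Z y" using Iprop[OF \<open>x \<in> I\<close>] by blast
      then have "x \<in> nbrs E y" using nbrs_sym[of x E y] by blast
      then show ?thesis using y CLW Wv[of y] Ww by (auto simp: Z_def split: if_splits)
    qed
    have cardle: "card ((D - C) \<union> I) \<le> card D - card C + card I"
      using card_Un_le[of "D - C" I] finC by (simp add: card_Diff_subset C_def)
    have CD: "C \<subseteq> D" by (auto simp: C_def)
    then have "card C \<le> card D" using finD by (rule card_mono[rotated])
    have finish: ?thesis if "card I < card C"
    proof -
      have "card ((D - C) \<union> I) < card D" using cardle that \<open>card C \<le> card D\<close> by linarith
      then show ?thesis using I(1) by blast
    qed
    \<comment> \<open>If \<open>v\<close> enters, no neighbour of \<open>v\<close> survives in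
      \<open>D - C\<close>, so all of \<open>L\<close> must have been discarded.\<close>
    have vI_L: "L \<subseteq> C" if "v \<in> I" "L \<subseteq> D"
    proof
      fix x assume "x \<in> L"
      then have "x \<in> nbrs E v" "x \<in> D" using L that by auto
      then show "x \<in> C" using I(4) that(1) by blast
    qed
    show ?thesis
    proof (cases "v \<in> D")
      case True
      have "D \<inter> L \<subseteq> {u0}"
      proof
        fix x assume x: "x \<in> D \<inter> L"
        have "x \<notin> Z v" using Zdisj[of v] x by blast
        then have "v \<in> Z x" using Dind[of v x] x True L(1) by blast
        then show "x \<in> {u0}" by (auto simp: Z_def split: if_splits)
      qed
      moreover have "u0 \<in> D"
      proof (rule ccontr)
        assume "u0 \<notin> D"
        moreover have "u0 \<in> V" using u0 L nbrs_subset by blast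
        ultimately obtain y where "y \<in> nbrs E u0" "y \<notin> Z u0" using Ddom[of u0] by blast
        then show False by (simp add: Z_def)
      qed
      moreover have "v \<in> Z u0" using u0 L nbrs_sym[of v E u0] by (auto simp: Z_def)
      ultimately have "u0 \<in> C" using True by (auto simp: C_def)
      have "w \<notin> C" if "W \<noteq> {}"
      proof
        assume "w \<in> C"
        then have "w \<in> D" by (simp add: C_def)
        moreover have "w \<notin> Z v" using Zdisj[of v] W that by blast
        moreover have "v \<notin> Z w" using vL Wv[of w] W that u0 by (auto simp: Z_def split: if_splits)
        ultimately show False using Dind[of v w] True Wv[of w] W that by blast
      qed
      moreover have "v \<notin> I" using True IC by blast
      ultimately have "I = {}" using Ivz by blast
      then show ?thesis using \<open>u0 \<in> C\<close> finC by (intro finish) (auto simp: card_gt_0_iff)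
    next
      case vD: False
      have LD: "L \<subseteq> D"
      proof
        fix x assume x: "x \<in> L"
        show "x \<in> D"
        proof (rule ccontr)
          assume "x \<notin> D"
          then obtain y where "y \<in> D" "y \<in> nbrs E x" "y \<notin> Z x"
            using Ddom[of x] x L nbrs_subset by blast
          then show False using x vD by (auto simp: Z_def split: if_splits)
        qed
      qed
      show ?thesis
      proof (cases "W \<noteq> {} \<and> w \<in> C")
        case False
        show ?thesis
        proof (cases "C = {}")
          case False': False
          have "I \<subseteq> {v}" using Ivz False by blast
          show ?thesis
          proof (cases "I = {}")
            case True
            then show ?thesis using False' finC by (intro finish) (auto simp: card_gt_0_iff)
          next
            case False
            then have "I = {v}" using \<open>I \<subseteq> {v}\<close> by auto
            then have "card L \<le> card C" using vI_L LD finC by (intro card_mono) auto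
            then show ?thesis using L(3) \<open>I = {v}\<close> by (intro finish) simp
          qed
        next
          \<comment> \<open>Here \<open>D\<close> is independent and dominating in \<open>G\<close>
            itself. Its part \<open>A\<close> inside the neighbourhood of \<open>v\<close> is
            exchanged for \<open>v\<close> and a repair set \<open>J\<close>, and \<open>fin\<close>
            says that this is a gain.\<close>
          case C0: True
          have Dind': "\<And>x. x \<in> D \<Longrightarrow> nbrs E x \<inter> D = {}" using ind1 C0 by simp
          have Ddom': "\<And>x. x \<in> V - D \<Longrightarrow> nbrs E x \<inter> D \<noteq> {}" using Ddom by blast
          have Wn: "nbrs E w \<inter> nbrs E z \<inter> nbrs E v \<inter> D = {}" if Wne: "W \<noteq> {}"
          proof (rule ccontr)
            assume "\<not> ?thesis"
            then obtain n where n: "n \<in> nbrs E w" "n \<in> nbrs E z" "n \<in> nbrs E v" "n \<in> D" by blast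
            have wW: "w \<in> W" using W Wne by auto
            have "n \<noteq> v" "n \<noteq> z" using n nbrs_subset by blast+
            have Zw: "Z w = nbrs E w - {v, z}" using wW Wv[OF wW] u0 by (auto simp: Z_def)
            \<comment> \<open>Otherwise \<open>w\<close> would be dominated along one of its two
              kept edges. But \<open>v\<close> is not in \<open>D\<close>, and \<open>z\<close> is
              adjacent to \<open>n\<close>, which is in \<open>D\<close>.\<close>
            have "w \<in> D"
            proof (rule ccontr)
              assume "w \<notin> D"
              then obtain y where y: "y \<in> D" "y \<in> nbrs E w" "y \<notin> Z w"
                using Ddom[of w] Wv[OF wW] nbrs_subset by blast
              then have "y = z" using Zw vD by auto
              then show False using Dind'[OF y(1)] n by blast
            qed
            then have "w \<in> C" using n Zw \<open>n \<noteq> v\<close> \<open>n \<noteq> z\<close> by (auto simp: C_def)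
            then show False using C0 by simp
          qed
          define A where "A = D \<inter> nbrs E v"
          have LA: "L \<subseteq> A" using LD L by (auto simp: A_def)
          obtain J where J: "iid V E (insert v (D - A) \<union> J)" "J \<inter> insert v (D - A) = {}" "J \<subseteq> V"
            "\<forall>x\<in>J. nbrs E x \<inter> (insert v (D - A) \<union> J) = {}"
          proof (rule extend_independent[of "insert v (D - A)"])
            show "insert v (D - A) \<subseteq> V" using DV vV by auto
            show "\<forall>x\<in>insert v (D - A). nbrs E x \<inter> insert v (D - A) = {}"
            proof
              fix x assume "x \<in> insert v (D - A)"
              then show "nbrs E x \<inter> insert v (D - A) = {}"
                using Dind'[of x] nbrs_subset[of x] nbrs_sym[of v E x] by (auto simp: A_def)
            qed
          qed
          have "card J + 2 \<le> card (D \<inter> nbrs E v)"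
          proof (rule fin[OF DV Dind' Ddom' LD Wn J(3)])
            fix x assume x: "x \<in> J"
            show "nbrs E x \<inter> J = {}" using J(4) x by blast
            have "v \<notin> nbrs E x" "x \<noteq> v" using J(2,4) x by blast+
            then have xv: "x \<notin> nbrs E v" using nbrs_sym[of x E v] by blast
            have "x \<notin> D" using x J(2) xv by (auto simp: A_def)
            then obtain y where y: "y \<in> D" "y \<in> nbrs E x" "x \<notin> Z y" using Ddom[of x] x J(3) by blast
            then have "y \<in> A" using J(4) x by blast
            moreover have "y \<notin> L"
            proof
              assume "y \<in> L"
              then have "x \<in> Z y" using y \<open>x \<noteq> v\<close> nbrs_sym[of x E y] by (auto simp: Z_def split: if_splits)
              then show False using y by blast
            qed
            ultimately show "x \<notin> nbrs E v \<and> x \<noteq> v \<and> nbrs E x \<inter> (D \<inter> nbrs E v - L) \<noteq> {}"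
              using xv \<open>x \<noteq> v\<close> y(2) by (auto simp: A_def)
          qed auto
          moreover have "card (insert v (D - A) \<union> J) \<le> Suc (card D - card A) + card J"
            using card_Un_le[of "insert v (D - A)" J] finD vD
            by (simp add: A_def card_Diff_subset card_insert_if)
          moreover have "card A \<le> card D" using finD by (intro card_mono) (auto simp: A_def)
          ultimately have "card (insert v (D - A) \<union> J) < card D" unfolding A_def by linarith
          then show ?thesis using J(1) by blast
        qed
      next
        case True
        then have wW: "w \<in> W" using W by auto
        have Zw: "Z w = nbrs E w - {v, z}" using wW Wv[OF wW] u0 by (auto simp: Z_def)
        have I2: "I \<subseteq> {v, z}" using Ivz by blast
        have wL: "w \<notin> L" using Wv[OF wW] by blast
        \<comment> \<open>The vertex \<open>y\<close> with which \<open>w\<close> conflicts stays in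
          \<open>D\<close>, so it is not adjacent to \<open>z\<close>. By \<open>Ww\<close> it is
          then adjacent to a vertex of \<open>L\<close>, which is therefore in conflict too.\<close>
        have zC: "\<exists>x\<in>L. x \<in> C" if zI: "z \<in> I"
        proof -
          obtain y where y: "y \<in> D" "y \<in> Z w" using True by (auto simp: C_def)
          then have "y \<in> D - C" using ZC[of w] by blast
          then have "y \<notin> nbrs E z" using I(4) zI by blast
          then obtain x where x: "x \<in> L" "y \<in> nbrs E x" using Ww y Zw True by blast
          then have "y \<in> Z x" using y vD by (auto simp: Z_def)
          then have "x \<in> C" using x LD y by (auto simp: C_def)
          then show ?thesis using x by blast
        qed
        have vC: "card L + 1 \<le> card C" if "v \<in> I"
        proof -
          have "insert w L \<subseteq> C" using vI_L[OF that LD] True by blast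
          then have "card (insert w L) \<le> card C" using finC by (intro card_mono) auto
          then show ?thesis using wL L(2) by simp
        qed
        have "card C \<ge> 1" using True finC by (metis One_nat_def Suc_leI card_gt_0_iff empty_iff)
        have c2: "card C \<ge> 2" if "z \<in> I"
        proof -
          obtain x where "x \<in> L" "x \<in> C" using zC \<open>z \<in> I\<close> by blast
          then have "{w, x} \<subseteq> C" "w \<noteq> x" using True wL by auto
          then show ?thesis using card_mono[OF finC, of "{w,x}"] by simp
        qed
        consider "I = {}" | "I = {z}" | "v \<in> I" "card I \<le> 2"
        proof -
          have "card I \<le> card {v, z}" using I2 by (intro card_mono) auto
          also have "\<dots> \<le> 2" by (simp add: card_insert_if)
          finally show thesis using that I2 by blast
        qed
        then show ?thesis
        proof cases
          case 1 then show ?thesis using \<open>card C \<ge> 1\<close> by (intro finish) simp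
        next
          case 2 then show ?thesis using c2 by (intro finish) simp
        next
          case 3 then show ?thesis using vC L(3) by (intro finish) linarith
        qed
      qed
    qed
  qed
  ultimately show ?thesis by (rule bondage_le)
qed

end

section \<open>Faces of plane drawings\<close>

text \<open>A larger connected set avoiding \<open>J\<close> would have to meet the frontier of
  \<open>Q\<close>. This carries a face of a large drawing over to the complement of the few arcs
  around it, where the Jordan curve theorem applies.\<close>

lemma component_if_frontier_subset:
  fixes Q :: "complex set"
  assumes "J \<subseteq> T" "Q \<in> components (- T)" "frontier Q \<subseteq> J"
  shows "Q \<in> components (- J)"
proof -
  have Q: "connected Q" "Q \<noteq> {}" "Q \<subseteq> - T"
    using assms in_components_connected in_components_nonempty in_components_subset by metis+
  have "D = Q" if D: "Q \<subseteq> D" "D \<subseteq> - J" "connected D" for D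
  proof (rule ccontr)
    assume "D \<noteq> Q"
    then have "D \<inter> frontier Q \<noteq> {}"
      using D Q by (intro connected_Int_frontier) auto
    then show False using D assms(3) by blast
  qed
  then show ?thesis
    using Q assms(1) unfolding in_components_maximal by blast
qed

lemma Jordan_arcs:
  fixes c1 c2 :: "real \<Rightarrow> complex"
  assumes "arc c1" "arc c2" "pathstart c1 = a" "pathfinish c1 = b"
    "pathstart c2 = a" "pathfinish c2 = b" "path_image c1 \<inter> path_image c2 = {a,b}"
  defines "J \<equiv> path_image c1 \<union> path_image c2"
  shows "inside J \<noteq> {} \<and> open (inside J) \<and> connected (inside J) \<and>
    outside J \<noteq> {} \<and> open (outside J) \<and> connected (outside J) \<and>
    bounded (inside J) \<and> \<not> bounded (outside J) \<and> inside J \<inter> outside J = {} \<and>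
    inside J \<union> outside J = - J \<and> frontier (inside J) = J \<and> frontier (outside J) = J"
proof -
  have "simple_path (c1 +++ reversepath c2)"
    using assms by (simp add: simple_path_join_loop_eq arc_reversepath)
  moreover have "pathfinish (c1 +++ reversepath c2) = pathstart (c1 +++ reversepath c2)"
    using assms by simp
  moreover have "path_image (c1 +++ reversepath c2) = J"
    using assms by (simp add: path_image_join)
  ultimately show ?thesis
    using Jordan_inside_outside[of "c1 +++ reversepath c2"] by simp
qed

lemma Jordan_arcs_component_frontier:
  fixes c1 c2 :: "real \<Rightarrow> complex"
  assumes "arc c1" "arc c2" "pathstart c1 = a" "pathfinish c1 = b"
    "pathstart c2 = a" "pathfinish c2 = b" "path_image c1 \<inter> path_image c2 = {a,b}"
  defines "J \<equiv> path_image c1 \<union> path_image c2"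
  assumes "Q \<in> components (- J)"
  shows "frontier Q = J" "Q = inside J \<or> Q = outside J"
proof -
  note * = Jordan_arcs[OF assms(1-7), folded J_def]
  have "components (- J) = {inside J, outside J}"
  proof (rule components_open_unique)
    show "pairwise disjnt {inside J, outside J}"
      using * by (simp add: pairwise_insert disjnt_def inf_commute)
  qed (use * in auto)
  then show "frontier Q = J" "Q = inside J \<or> Q = outside J" using * assms by auto
qed

text \<open>The chord \<open>c\<close> divides the interior into the interiors of the curves that it
  forms with \<open>c1\<close> and with \<open>c2\<close>. The connected set \<open>Q\<close> lies
  in one of these, whose closure meets the remaining arc at most in its ends.\<close>

lemma theta_frontier_inside:
  fixes c1 c2 c :: "real \<Rightarrow> complex"
  assumes "arc c1" "arc c2" "arc c"
    "pathstart c1 = a" "pathfinish c1 = b" "pathstart c2 = a" "pathfinish c2 = b"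
    "pathstart c = a" "pathfinish c = b"
    "path_image c1 \<inter> path_image c2 = {a,b}" "path_image c1 \<inter> path_image c = {a,b}"
    "path_image c2 \<inter> path_image c = {a,b}"
    "path_image c \<inter> inside (path_image c1 \<union> path_image c2) \<noteq> {}"
    and Q: "connected Q" "Q \<subseteq> inside (path_image c1 \<union> path_image c2)" "Q \<inter> path_image c = {}"
  obtains "closure Q \<inter> path_image c2 \<subseteq> {a,b}" | "closure Q \<inter> path_image c1 \<subseteq> {a,b}"
proof -
  let ?I1 = "inside (path_image c1 \<union> path_image c)"
  let ?I2 = "inside (path_image c2 \<union> path_image c)"
  let ?I = "inside (path_image c1 \<union> path_image c2)"
  have "a \<noteq> b" using assms(1,4,5) arc_distinct_ends by blast
  then have *: "?I1 \<inter> ?I2 = {} \<and> ?I1 \<union> ?I2 \<union> (path_image c - {a,b}) = ?I"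
    using split_inside_simple_closed_curve[of c1 a b c2 c] assms arc_imp_simple_path by metis
  have J1: "open ?I1" "frontier ?I1 = path_image c1 \<union> path_image c"
    using Jordan_arcs[of c1 c a b] assms by auto
  have J2: "open ?I2" "frontier ?I2 = path_image c2 \<union> path_image c"
    using Jordan_arcs[of c2 c a b] assms by auto
  have disj: "?I \<inter> (path_image c1 \<union> path_image c2) = {}"
    using inside_no_overlap by blast
  have "Q \<subseteq> ?I1 \<or> Q \<subseteq> ?I2"
    using connectedD[OF Q(1) J1(1) J2(1)] * Q by blast
  then show ?thesis
  proof
    assume "Q \<subseteq> ?I1"
    then have "closure Q \<subseteq> ?I1 \<union> (path_image c1 \<union> path_image c)"
      using J1 by (metis closure_Un_frontier closure_mono)
    moreover have "?I1 \<inter> path_image c2 = {}" using * disj by blast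
    moreover have "path_image c1 \<inter> path_image c2 = {a,b}" "path_image c2 \<inter> path_image c = {a,b}"
      by fact+
    ultimately have "closure Q \<inter> path_image c2 \<subseteq> {a,b}" by blast
    then show ?thesis by (rule that(1))
  next
    assume "Q \<subseteq> ?I2"
    then have "closure Q \<subseteq> ?I2 \<union> (path_image c2 \<union> path_image c)"
      using J2 by (metis closure_Un_frontier closure_mono)
    moreover have "?I2 \<inter> path_image c1 = {}" using * disj by blast
    moreover have "path_image c1 \<inter> path_image c2 = {a,b}" "path_image c1 \<inter> path_image c = {a,b}"
      by fact+
    ultimately have "closure Q \<inter> path_image c1 \<subseteq> {a,b}" by blast
    then show ?thesis by (rule that(2))
  qed
qed

text \<open>The punctured interior contains points arbitrarily close to \<open>p\<close>, so its
  image is unbounded and lies outside the image curve. If the image of the exterior were outside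
  too, only the point 0 could be left for the interior of the image curve, which is open and
  nonempty.\<close>

lemma inside_inversion:
  fixes c1 c2 :: "real \<Rightarrow> complex" and p :: complex
  defines "\<phi> \<equiv> \<lambda>x. inverse (x - p)"
  assumes arcs: "arc c1" "arc c2" "pathstart c1 = a" "pathfinish c1 = b"
    "pathstart c2 = a" "pathfinish c2 = b" "path_image c1 \<inter> path_image c2 = {a,b}"
    and p: "p \<in> inside (path_image c1 \<union> path_image c2)"
    and arcs': "arc (\<phi> \<circ> c1)" "arc (\<phi> \<circ> c2)"
  shows "\<phi> ` outside (path_image c1 \<union> path_image c2)
    \<subseteq> inside (\<phi> ` (path_image c1 \<union> path_image c2))"
proof -
  let ?J = "path_image c1 \<union> path_image c2"
  have J: "connected (inside ?J)" "open (inside ?J)" "inside ?J \<inter> outside ?J = {}"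
    "connected (outside ?J)" "inside ?J \<union> outside ?J = - ?J"
    using Jordan_arcs[OF arcs] by auto
  have pJ: "p \<notin> ?J" "p \<notin> outside ?J" using p J(3) inside_no_overlap[of ?J] by blast+
  \<comment> \<open>With \<open>inverse 0 = 0\<close> the map is injective on the whole plane and
    sends \<open>p\<close> to 0; only continuity fails at \<open>p\<close>.\<close>
  have inj: "inj \<phi>" by (auto simp: inj_def \<phi>_def)
  have cont: "continuous_on (- {p}) \<phi>" unfolding \<phi>_def
    by (intro continuous_intros) auto
  have "path_image (\<phi> \<circ> c1) \<inter> path_image (\<phi> \<circ> c2) = {\<phi> a, \<phi> b}"
    using arcs(7) by (auto simp: path_image_compose simp flip: image_Int[OF inj])
  then have J': "inside (\<phi> ` ?J) \<noteq> {}" "open (inside (\<phi> ` ?J))"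
    "inside (\<phi> ` ?J) \<inter> outside (\<phi> ` ?J) = {}" "bounded (inside (\<phi> ` ?J))"
    "open (outside (\<phi> ` ?J))" "inside (\<phi> ` ?J) \<union> outside (\<phi> ` ?J) = - \<phi> ` ?J"
    using Jordan_arcs[OF arcs'] arcs
    by (simp_all add: path_image_compose image_Un pathstart_compose pathfinish_compose)
  have side: "\<phi> ` S \<subseteq> inside (\<phi> ` ?J) \<or> \<phi> ` S \<subseteq> outside (\<phi> ` ?J)"
    if "connected S" "S \<inter> ?J = {}" "p \<notin> S" for S
  proof -
    have "continuous_on S \<phi>" using cont by (rule continuous_on_subset) (use that in auto)
    then have "connected (\<phi> ` S)"
      using that by (intro connected_continuous_image)
    moreover have "\<phi> ` S \<subseteq> - \<phi> ` ?J"
      using that inj unfolding inj_def by blast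
    moreover from this have sub: "\<phi> ` S \<subseteq> inside (\<phi> ` ?J) \<union> outside (\<phi> ` ?J)"
      using J'(6) by simp
    ultimately have "inside (\<phi> ` ?J) \<inter> \<phi> ` S = {} \<or> outside (\<phi> ` ?J) \<inter> \<phi> ` S = {}"
      by (intro connectedD[OF _ J'(2,5)]) (simp_all add: J'(3))
    then show ?thesis
    proof
      assume "inside (\<phi> ` ?J) \<inter> \<phi> ` S = {}"
      with sub have "\<phi> ` S \<subseteq> outside (\<phi> ` ?J)" by blast
      then show ?thesis ..
    next
      assume "outside (\<phi> ` ?J) \<inter> \<phi> ` S = {}"
      with sub have "\<phi> ` S \<subseteq> inside (\<phi> ` ?J)" by blast
      then show ?thesis ..
    qed
  qed
  have "\<not> bounded (\<phi> ` (inside ?J - {p}))"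
  proof
    assume "bounded (\<phi> ` (inside ?J - {p}))"
    then obtain B where B: "B > 0" "\<And>x. x \<in> inside ?J - {p} \<Longrightarrow> norm (\<phi> x) \<le> B"
      unfolding bounded_pos by auto
    obtain e where e: "e > 0" "ball p e \<subseteq> inside ?J"
      using J(2) p open_contains_ball[of "inside ?J"] by blast
    define t where "t = min (e/2) (1 / (2*B))"
    have t: "0 < t" "t < e" "t < 1 / B" using B e by (auto simp: t_def min_def field_simps)
    have "p + of_real t \<in> inside ?J - {p}"
      using t e by (auto intro!: subsetD[OF e(2)] simp: dist_norm)
    then have "inverse t \<le> B" using B(2)[of "p + of_real t"] t
      by (simp add: \<phi>_def norm_inverse)
    then show False using t B by (auto simp: field_simps)
  qed
  moreover have "connected (inside ?J - {p})"
    using J by (intro connected_open_delete) auto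
  ultimately have out: "\<phi> ` (inside ?J - {p}) \<subseteq> outside (\<phi> ` ?J)"
    using side[of "inside ?J - {p}"] inside_no_overlap[of ?J] bounded_subset[OF J'(4)] by blast
  show ?thesis
  proof (rule ccontr)
    assume "\<not> ?thesis"
    then have "\<phi> ` outside ?J \<subseteq> outside (\<phi> ` ?J)"
      using side[of "outside ?J"] J(4) outside_no_overlap[of ?J] pJ by blast
    moreover have "y \<in> \<phi> ` (inside ?J - {p}) \<union> \<phi> ` outside ?J \<union> \<phi> ` ?J" if "y \<noteq> 0" for y
    proof -
      have "y = \<phi> (inverse y + p)" "inverse y + p \<noteq> p" using that by (auto simp: \<phi>_def)
      moreover have "inverse y + p \<in> inside ?J \<union> outside ?J \<union> ?J" using J(5) by blast
      ultimately show ?thesis by blast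
    qed
    ultimately have "inside (\<phi> ` ?J) \<subseteq> {0}"
      using out J'(3) inside_no_overlap[of "\<phi> ` ?J"] by blast
    then have "inside (\<phi> ` ?J) = {0}" using J'(1) by blast
    then show False using J'(2) not_open_singleton[of "0::complex"] by simp
  qed
qed

text \<open>It suffices that \<open>Q\<close> approaches one of the arcs only at its ends: the
  frontier of \<open>Q\<close> is then contained in, hence equal to, the Jordan curve of the other
  two. If \<open>Q\<close> and \<open>c\<close> are on different sides of the curve formed by
  \<open>c1\<close> and \<open>c2\<close>, that arc is \<open>c\<close>. If both are inside,
  \<open>c\<close> is a chord; if both are outside, an inversion turns \<open>c\<close> into a
  chord.\<close>

lemma theta_frontier:
  fixes c1 c2 c :: "real \<Rightarrow> complex"
  assumes arcs: "arc c1" "arc c2" "arc c"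
    "pathstart c1 = a" "pathfinish c1 = b" "pathstart c2 = a" "pathfinish c2 = b"
    "pathstart c = a" "pathfinish c = b"
    "path_image c1 \<inter> path_image c2 = {a,b}" "path_image c1 \<inter> path_image c = {a,b}"
    "path_image c2 \<inter> path_image c = {a,b}"
    and Q: "Q \<in> components (- (path_image c1 \<union> path_image c2 \<union> path_image c))"
  shows "frontier Q \<in> {path_image c1 \<union> path_image c2, path_image c1 \<union> path_image c,
    path_image c2 \<union> path_image c}"
proof -
  let ?J = "path_image c1 \<union> path_image c2"
  let ?T = "path_image c1 \<union> path_image c2 \<union> path_image c"
  have Qc: "connected Q" "Q \<noteq> {}" "Q \<subseteq> - ?T"
    using Q in_components_connected in_components_nonempty in_components_subset by metis+
  have closed: "closed ?T" using arcs by (simp add: closed_Un closed_arc_image)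
  have frT: "frontier Q \<subseteq> ?T"
    using frontier_of_components_subset[OF Q] closed frontier_subset_eq by (metis frontier_complement subset_trans)
  note J = Jordan_arcs[of c1 c2 a b, OF arcs(1,2,4-7,10)]
  have ends: "a \<in> path_image c1" "a \<in> path_image c2" "a \<in> path_image c"
    "b \<in> path_image c1" "b \<in> path_image c2" "b \<in> path_image c" using arcs by auto
  have fin: ?thesis if "closure Q \<inter> path_image c1 \<subseteq> {a,b} \<or> closure Q \<inter> path_image c2 \<subseteq> {a,b}
     \<or> closure Q \<inter> path_image c \<subseteq> {a,b}"
  proof -
    have fc: "frontier Q \<subseteq> closure Q" by (simp add: frontier_def)
    consider "frontier Q \<subseteq> path_image c1 \<union> path_image c2" | "frontier Q \<subseteq> path_image c1 \<union> path_image c"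
      | "frontier Q \<subseteq> path_image c2 \<union> path_image c"
    proof -
      have *: "frontier Q \<subseteq> X \<union> Y"
        if "closure Q \<inter> Z \<subseteq> {a,b}" "frontier Q \<subseteq> X \<union> Y \<union> Z" "a \<in> X" "b \<in> X" for X Y Z
      proof
        fix x assume x: "x \<in> frontier Q"
        then have xQ: "x \<in> closure Q" using fc by (rule subsetD[rotated])
        have "x \<in> X \<union> Y \<union> Z" using subsetD[OF that(2) x] .
        then consider "x \<in> X \<union> Y" | "x \<in> Z" by (elim UnE) simp_all
        then show "x \<in> X \<union> Y"
        proof cases
          case 2
          have "x \<in> {a,b}" by (rule subsetD[OF that(1)]) (rule IntI[OF xQ 2])
          then show ?thesis using that(3,4) by (elim insertE) simp_all
        qed
      qed
      show thesis
        using \<open>closure Q \<inter> path_image c1 \<subseteq> {a,b} \<or> closure Q \<inter> path_image c2 \<subseteq> {a,b} \<or> closure Q \<inter> path_image c \<subseteq> {a,b}\<close>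
      proof (elim disjE)
        assume "closure Q \<inter> path_image c1 \<subseteq> {a,b}"
        moreover have "frontier Q \<subseteq> path_image c2 \<union> path_image c \<union> path_image c1"
          using frT by (simp only: Un_ac)
        ultimately show thesis by (rule that(3)[OF *]) (fact ends)+
      next
        assume "closure Q \<inter> path_image c2 \<subseteq> {a,b}"
        moreover have "frontier Q \<subseteq> path_image c1 \<union> path_image c \<union> path_image c2"
          using frT by (simp only: Un_ac)
        ultimately show thesis by (rule that(2)[OF *]) (fact ends)+
      next
        assume "closure Q \<inter> path_image c \<subseteq> {a,b}"
        moreover have "frontier Q \<subseteq> path_image c1 \<union> path_image c2 \<union> path_image c"
          using frT by (simp only: Un_ac)
        ultimately show thesis by (rule that(1)[OF *]) (fact ends)+
      qed
    qed
    then show ?thesis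
    proof cases
      case 1
      then have "Q \<in> components (- (path_image c1 \<union> path_image c2))"
        using component_if_frontier_subset[OF _ Q] by blast
      then have "frontier Q = path_image c1 \<union> path_image c2"
        by (intro Jordan_arcs_component_frontier(1)[of c1 c2 a b]) (use arcs in auto)
      then show ?thesis by simp
    next
      case 2
      then have "Q \<in> components (- (path_image c1 \<union> path_image c))"
        using component_if_frontier_subset[OF _ Q] by blast
      then have "frontier Q = path_image c1 \<union> path_image c"
        by (intro Jordan_arcs_component_frontier(1)[of c1 c a b]) (use arcs in auto)
      then show ?thesis by simp
    next
      case 3
      then have "Q \<in> components (- (path_image c2 \<union> path_image c))"
        using component_if_frontier_subset[OF _ Q] by blast
      then have "frontier Q = path_image c2 \<union> path_image c"
        by (intro Jordan_arcs_component_frontier(1)[of c2 c a b]) (use arcs in auto)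
      then show ?thesis by simp
    qed
  qed
  have side: "S \<subseteq> inside ?J \<or> S \<subseteq> outside ?J" if "connected S" "S \<inter> ?J = {}" for S
  proof -
    have "open (inside ?J)" "open (outside ?J)" "inside ?J \<inter> outside ?J = {}"
      "inside ?J \<union> outside ?J = - ?J" using J by auto
    then show ?thesis using connectedD[of S "inside ?J" "outside ?J"] that by blast
  qed
  have Qside: "Q \<subseteq> inside ?J \<or> Q \<subseteq> outside ?J" by (rule side) (use Qc in auto)
  have "connected (path_image c - {a,b})"
    using connected_simple_path_endless[of c] arcs(3,8,9) by (metis arc_imp_simple_path)
  then have cside: "path_image c - {a,b} \<subseteq> inside ?J \<or> path_image c - {a,b} \<subseteq> outside ?J"
    by (rule side) (use arcs(11,12) in blast)
  have "path_image c - {a,b} \<noteq> {}"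
    using nonempty_simple_path_endless[of c] arcs(3,8,9) by (metis arc_imp_simple_path)
  then have ne: "path_image c \<inter> inside ?J \<noteq> {}" if "path_image c - {a,b} \<subseteq> inside ?J"
    using that by blast
  have cl: "closure (inside ?J) = inside ?J \<union> ?J" "closure (outside ?J) = outside ?J \<union> ?J"
    using J closure_Un_frontier by (metis)+
  have inout: "inside ?J \<inter> outside ?J = {}" using J by simp
  have Jab: "path_image c \<inter> ?J = {a,b}" using arcs(11,12) by blast
  consider "Q \<subseteq> inside ?J" "path_image c - {a,b} \<subseteq> inside ?J"
    | "Q \<subseteq> inside ?J" "path_image c - {a,b} \<subseteq> outside ?J"
    | "Q \<subseteq> outside ?J" "path_image c - {a,b} \<subseteq> inside ?J"
    | "Q \<subseteq> outside ?J" "path_image c - {a,b} \<subseteq> outside ?J" using Qside cside by blast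
  then show ?thesis
  proof cases
    case 1
    have "Q \<inter> path_image c = {}" using Qc by blast
    then show ?thesis
      by (rule theta_frontier_inside[OF arcs ne[OF 1(2)] Qc(1) 1(1)]) (intro fin disjI1 disjI2; assumption)+
  next
    case 2
    then have "closure Q \<subseteq> inside ?J \<union> ?J" using cl closure_mono by metis
    then have "closure Q \<inter> path_image c \<subseteq> {a,b}" using 2(2) inout Jab by blast
    then show ?thesis by (intro fin disjI2)
  next
    case 3
    then have "closure Q \<subseteq> outside ?J \<union> ?J" using cl closure_mono by metis
    then have "closure Q \<inter> path_image c \<subseteq> {a,b}" using 3(2) inout Jab by blast
    then show ?thesis by (intro fin disjI2)
  next
    case 4
    obtain p where p: "p \<in> inside ?J" using J by blast
    define \<phi> where "\<phi> \<equiv> \<lambda>x. inverse (x - p)"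
    have inj: "inj \<phi>" by (auto simp: inj_def \<phi>_def)
    have cont: "continuous_on (- {p}) \<phi>" unfolding \<phi>_def by (intro continuous_intros) auto
    have p': "p \<notin> ?J" "p \<notin> outside ?J" "p \<notin> path_image c" "p \<notin> Q"
    proof -
      show "p \<notin> ?J" "p \<notin> outside ?J" using p inout inside_no_overlap by blast+
      then show "p \<notin> path_image c" "p \<notin> Q" using 4 Jab by blast+
    qed
    have arc': "arc (\<phi> \<circ> g)" if "arc g" "p \<notin> path_image g" for g
    proof -
      have "continuous_on (path_image g) \<phi>" using cont by (rule continuous_on_subset) (use that in auto)
      then show ?thesis using that inj
        unfolding arc_def by (auto simp: path_continuous_image inj_on_def comp_inj_on inj_def)
    qed
    have arcs': "arc (\<phi> \<circ> c1)" "arc (\<phi> \<circ> c2)" "arc (\<phi> \<circ> c)"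
      "pathstart (\<phi> \<circ> c1) = \<phi> a" "pathfinish (\<phi> \<circ> c1) = \<phi> b" "pathstart (\<phi> \<circ> c2) = \<phi> a"
      "pathfinish (\<phi> \<circ> c2) = \<phi> b" "pathstart (\<phi> \<circ> c) = \<phi> a" "pathfinish (\<phi> \<circ> c) = \<phi> b"
      "path_image (\<phi> \<circ> c1) \<inter> path_image (\<phi> \<circ> c2) = {\<phi> a,\<phi> b}"
      "path_image (\<phi> \<circ> c1) \<inter> path_image (\<phi> \<circ> c) = {\<phi> a,\<phi> b}"
      "path_image (\<phi> \<circ> c2) \<inter> path_image (\<phi> \<circ> c) = {\<phi> a,\<phi> b}"
      using arcs p' by (auto intro!: arc' simp: path_image_compose pathstart_compose pathfinish_compose simp flip: image_Int[OF inj])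
    have im: "\<phi> ` outside ?J \<subseteq> inside (path_image (\<phi> \<circ> c1) \<union> path_image (\<phi> \<circ> c2))"
      using inside_inversion[OF arcs(1,2,4-7,10) p, folded \<phi>_def, OF arcs'(1,2)]
      by (simp add: path_image_compose image_Un)
    have contQ: "continuous_on Q \<phi>" using cont by (rule continuous_on_subset) (use p' in auto)
    have ne': "path_image (\<phi> \<circ> c) \<inter> inside (path_image (\<phi> \<circ> c1) \<union> path_image (\<phi> \<circ> c2)) \<noteq> {}"
      using im 4(2) \<open>path_image c - {a,b} \<noteq> {}\<close> by (force simp: path_image_compose)
    have Q': "connected (\<phi> ` Q)" "\<phi> ` Q \<subseteq> inside (path_image (\<phi> \<circ> c1) \<union> path_image (\<phi> \<circ> c2))"
      "\<phi> ` Q \<inter> path_image (\<phi> \<circ> c) = {}"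
    proof -
      show "connected (\<phi> ` Q)" by (rule connected_continuous_image[OF contQ Qc(1)])
      show "\<phi> ` Q \<subseteq> inside (path_image (\<phi> \<circ> c1) \<union> path_image (\<phi> \<circ> c2))"
        using im 4(1) by blast
      have "Q \<inter> path_image c = {}" using Qc(3) by blast
      then show "\<phi> ` Q \<inter> path_image (\<phi> \<circ> c) = {}"
        by (simp add: path_image_compose flip: image_Int[OF inj])
    qed
    have cl': "\<phi> x \<in> closure (\<phi> ` Q)" if xQ: "x \<in> closure Q" and xp: "x \<noteq> p" for x
    proof -
      have "isCont \<phi> x"
        unfolding \<phi>_def using xp by (intro continuous_intros) auto
      obtain s where s: "\<forall>n. s n \<in> Q" "s \<longlonglongrightarrow> x"
        using xQ unfolding closure_sequential by auto
      have "(\<lambda>n. \<phi> (s n)) \<longlonglongrightarrow> \<phi> x"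
        by (rule isCont_tendsto_compose[OF \<open>isCont \<phi> x\<close> s(2)])
      then show ?thesis unfolding closure_sequential using s(1)
        by (intro exI[of _ "\<lambda>n. \<phi> (s n)"]) simp
    qed
    have ends_only: "closure Q \<inter> path_image g \<subseteq> {a,b}"
      if "closure (\<phi> ` Q) \<inter> path_image (\<phi> \<circ> g) \<subseteq> {\<phi> a, \<phi> b}" "p \<notin> path_image g" for g
    proof
      fix x assume x: "x \<in> closure Q \<inter> path_image g"
      then have "\<phi> x \<in> closure (\<phi> ` Q) \<inter> path_image (\<phi> \<circ> g)"
        using cl'[of x] that(2) by (auto simp: path_image_compose)
      then have "\<phi> x \<in> {\<phi> a, \<phi> b}" using that(1) by blast
      then show "x \<in> {a,b}" using inj by (auto simp: inj_def)
    qed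
    show ?thesis
      using theta_frontier_inside[OF arcs' ne' Q']
    proof cases
      case 1
      then show ?thesis by (intro fin disjI2[OF disjI1] ends_only p'(1)[unfolded Un_iff de_Morgan_disj, THEN conjunct2])
    next
      case 2
      then show ?thesis by (intro fin disjI1 ends_only p'(1)[unfolded Un_iff de_Morgan_disj, THEN conjunct1])
    qed
  qed
qed

section \<open>Paths and cycles as sets of edges\<close>

fun path_edges :: "'a list \<Rightarrow> 'a set set" where
  "path_edges (x # y # xs) = insert {x, y} (path_edges (y # xs))"
| "path_edges _ = {}"

lemma path_edges_append: "path_edges (xs @ y # ys) = path_edges (xs @ [y]) \<union> path_edges (y # ys)"
proof (induction xs)
  case (Cons x xs)
  then show ?case by (cases xs) auto
qed simp

lemma path_edges_snoc: "path_edges (xs @ [x, y]) = insert {x, y} (path_edges (xs @ [x]))"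
  using path_edges_append[of xs x "[y]"] by auto

lemma path_edges_rev: "path_edges (rev xs) = path_edges xs"
proof (induction xs rule: path_edges.induct)
  case (1 x y xs)
  then show ?case by (simp add: path_edges_snoc insert_commute)
qed auto

lemma finite_path_edges [simp]: "finite (path_edges xs)"
  by (induction xs rule: path_edges.induct) auto

lemma Union_path_edges: "length xs \<ge> 2 \<Longrightarrow> \<Union>(path_edges xs) = set xs"
proof (induction xs rule: path_edges.induct)
  case (1 x y xs)
  then show ?case by (cases xs) auto
qed auto

lemma Union_path_edges_subset: "\<Union>(path_edges xs) \<subseteq> set xs"
  by (induction xs rule: path_edges.induct) auto

lemma card_path_edges: "distinct xs \<Longrightarrow> card (path_edges xs) = length xs - 1"
proof (induction xs rule: path_edges.induct)
  case (1 x y xs)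
  have "{x, y} \<notin> path_edges (y # xs)"
    using 1(2) Union_path_edges_subset[of "y # xs"] by auto
  then show ?case using 1 by simp
qed auto

definition cycle_edges :: "'a list \<Rightarrow> 'a set set" where
  "cycle_edges xs = path_edges (xs @ [hd xs])"

definition is_cycle :: "'a set set \<Rightarrow> bool" where
  "is_cycle C \<longleftrightarrow> (\<exists>xs. distinct xs \<and> length xs \<ge> 3 \<and> C = cycle_edges xs)"

lemma cycle_edges_rotate: "cycle_edges (us @ vs) = cycle_edges (vs @ us)"
proof (cases "us = [] \<or> vs = []")
  case False
  then obtain u us' v vs' where "us = u # us'" "vs = v # vs'" by (meson neq_Nil_conv)
  then show ?thesis
    using path_edges_append[of "u # us'" v "vs' @ [u]"] path_edges_append[of "v # vs'" u "us' @ [v]"]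
    by (auto simp: cycle_edges_def)
qed auto

text \<open>\<open>C1\<close> and \<open>C2\<close> are the two arcs into which the vertices \<open>a\<close> and \<open>b\<close> cut the cycle \<open>C\<close>.\<close>

definition cycle_split :: "'a set set \<Rightarrow> 'a \<Rightarrow> 'a \<Rightarrow> 'a list \<Rightarrow> 'a list \<Rightarrow> bool" where
  "cycle_split C a b p q \<longleftrightarrow> distinct (a # p @ b # q) \<and> (p \<noteq> [] \<or> q \<noteq> []) \<and>
     C = path_edges (a # p @ [b]) \<union> path_edges (a # q @ [b])"

lemma cycle_split_edges: "path_edges (a # p @ [b]) \<union> path_edges (a # q @ [b]) = cycle_edges (a # p @ b # rev q)"
proof -
  have "cycle_edges (a # p @ b # rev q) = path_edges ((a # p) @ b # (rev q @ [a]))"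
    by (simp add: cycle_edges_def)
  also have "\<dots> = path_edges (a # p @ [b]) \<union> path_edges (rev (a # q @ [b]))"
    by (subst path_edges_append) simp
  finally show ?thesis by (simp only: path_edges_rev)
qed

lemma is_cycle_if_split: "cycle_split C a b p q \<Longrightarrow> is_cycle C"
  unfolding is_cycle_def cycle_split_def
  by (intro exI[of _ "a # p @ b # rev q"]) (auto simp: cycle_split_edges Suc_le_eq)

lemma Union_cycle_edges: "length xs \<ge> 1 \<Longrightarrow> \<Union>(cycle_edges xs) = set xs"
  unfolding cycle_edges_def by (subst Union_path_edges) (cases xs; auto)+

lemma cycle_split_exists:
  assumes "is_cycle C" "a \<in> \<Union>C" "b \<in> \<Union>C" "a \<noteq> b"
  obtains p q where "cycle_split C a b p q"
proof -
  obtain xs where xs: "distinct xs" "length xs \<ge> 3" "C = cycle_edges xs"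
    using assms(1) by (auto simp: is_cycle_def)
  have "a \<in> set xs" "b \<in> set xs" using assms xs Union_cycle_edges[of xs] by auto
  then obtain us vs where ys: "xs = us @ a # vs" by (meson split_list)
  define zs where "zs = vs @ us"
  have C: "C = cycle_edges (a # zs)" using xs(3) ys cycle_edges_rotate[of us "a # vs"] by (simp add: zs_def)
  have "distinct (a # zs)" "b \<in> set zs" "length zs \<ge> 2" using xs ys \<open>b \<in> set xs\<close> assms(4) by (auto simp: zs_def)
  then obtain p r where pr: "zs = p @ b # r" by (meson split_list)
  have "C = path_edges (a # p @ [b]) \<union> path_edges (a # rev r @ [b])"
    using cycle_split_edges[of a p b "rev r"] C pr by simp
  then have "cycle_split C a b p (rev r)"
    using \<open>distinct (a # zs)\<close> \<open>length zs \<ge> 2\<close> pr unfolding cycle_split_def by (cases p; cases r; auto)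
  then show ?thesis by (rule that)
qed

lemma cycle_split_swap: "cycle_split C a b p q \<longleftrightarrow> cycle_split C a b q p"
  unfolding cycle_split_def by auto

text \<open>A common edge of the two arcs could only be \<open>{a, b}\<close>. An arc contains that
  edge only if it has no inner vertex, and at least one of the arcs has one.\<close>

lemma cycle_split_disjoint:
  assumes "cycle_split C a b p q"
  shows "path_edges (a # p @ [b]) \<inter> path_edges (a # q @ [b]) = {}"
    "\<Union>(path_edges (a # p @ [b])) \<inter> \<Union>(path_edges (a # q @ [b])) = {a, b}"
proof -
  have d: "distinct (a # p @ b # q)" "p \<noteq> [] \<or> q \<noteq> []" using assms by (auto simp: cycle_split_def)
  show U: "\<Union>(path_edges (a # p @ [b])) \<inter> \<Union>(path_edges (a # q @ [b])) = {a, b}"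
    using d by (subst (1 2) Union_path_edges) auto
  have no_ab: "{a, b} \<notin> path_edges (a # p @ [b])" if "p \<noteq> []" "distinct (a # p @ [b])" for p
  proof -
    obtain x p' where p: "p = x # p'" using \<open>p \<noteq> []\<close> by (cases p) auto
    have "{a, b} \<notin> path_edges (x # p' @ [b])"
      using that(2) p Union_path_edges_subset[of "x # p' @ [b]"] by auto
    moreover have "{a, b} \<noteq> {a, x}" using that(2) p by (auto simp: doubleton_eq_iff)
    ultimately show ?thesis using p by simp
  qed
  have two: "card e = 2" if "distinct xs" "e \<in> path_edges xs" for e and xs :: "'a list"
    using that by (induction xs rule: path_edges.induct) auto
  show "path_edges (a # p @ [b]) \<inter> path_edges (a # q @ [b]) = {}"
  proof (rule ccontr)
    assume "\<not> ?thesis"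
    then obtain e where e: "e \<in> path_edges (a # p @ [b])" "e \<in> path_edges (a # q @ [b])" by blast
    then have "e \<subseteq> {a, b}" using U by blast
    moreover have "card e = 2" using two[OF _ e(1)] d by auto
    ultimately have "e = {a, b}" using d by (intro card_subset_eq) auto
    then show False using e no_ab[of p] no_ab[of q] d by auto
  qed
qed

section \<open>Faces of subgraphs of a plane drawing\<close>

locale drawing = fgraph V E for V :: "'a set" and E :: "'a set set" +
  fixes p :: "'a \<Rightarrow> complex" and \<gamma> :: "'a set \<Rightarrow> real \<Rightarrow> complex"
  assumes drawing: "plane_drawing V E p \<gamma>"
begin

definition X :: "'a set set \<Rightarrow> complex set" where
  "X S = (\<Union>e\<in>S. path_image (\<gamma> e))"

lemma X_Un: "X (S \<union> T) = X S \<union> X T" and X_mono: "S \<subseteq> T \<Longrightarrow> X S \<subseteq> X T"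
  by (auto simp: X_def)

lemma inj_p: "inj_on p V" and arc_edge: "e \<in> E \<Longrightarrow> arc (\<gamma> e)"
  and ends_edge: "e \<in> E \<Longrightarrow> {pathstart (\<gamma> e), pathfinish (\<gamma> e)} = p ` e"
  and vertices_edge: "e \<in> E \<Longrightarrow> path_image (\<gamma> e) \<inter> p ` V = p ` e"
  and edges_meet: "e \<in> E \<Longrightarrow> f \<in> E \<Longrightarrow> e \<noteq> f \<Longrightarrow> path_image (\<gamma> e) \<inter> path_image (\<gamma> f) = p ` (e \<inter> f)"
  using drawing unfolding plane_drawing_def by auto

lemma edge_subset: "e \<in> E \<Longrightarrow> e \<subseteq> V"
  using simple unfolding simple_graph_def by auto

lemma closed_X: "S \<subseteq> E \<Longrightarrow> closed (X S)"
  unfolding X_def using arc_edge finE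
  by (intro closed_UN) (auto intro: finite_subset closed_arc_image)

lemma X_Int:
  assumes "S \<subseteq> E" "T \<subseteq> E" "S \<inter> T = {}"
  shows "X S \<inter> X T = p ` (\<Union>S \<inter> \<Union>T)"
proof
  show "X S \<inter> X T \<subseteq> p ` (\<Union>S \<inter> \<Union>T)"
  proof
    fix x assume "x \<in> X S \<inter> X T"
    then obtain e f where ef: "e \<in> S" "f \<in> T" "x \<in> path_image (\<gamma> e) \<inter> path_image (\<gamma> f)"
      by (auto simp: X_def)
    then have "x \<in> p ` (e \<inter> f)" using edges_meet[of e f] assms by blast
    then show "x \<in> p ` (\<Union>S \<inter> \<Union>T)" using ef by blast
  qed
  show "p ` (\<Union>S \<inter> \<Union>T) \<subseteq> X S \<inter> X T"
  proof
    fix x assume "x \<in> p ` (\<Union>S \<inter> \<Union>T)"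
    then obtain v e f where v: "x = p v" "v \<in> e" "e \<in> S" "v \<in> f" "f \<in> T" by blast
    then have "x \<in> path_image (\<gamma> e)" "x \<in> path_image (\<gamma> f)"
      using vertices_edge[of e] vertices_edge[of f] assms by blast+
    then show "x \<in> X S \<inter> X T" using v by (auto simp: X_def)
  qed
qed

lemma vertex_in_X:
  assumes "S \<subseteq> E" "v \<in> V"
  shows "p v \<in> X S \<longleftrightarrow> v \<in> \<Union>S"
proof
  assume "p v \<in> X S"
  then obtain e where e: "e \<in> S" "p v \<in> path_image (\<gamma> e)" by (auto simp: X_def)
  then have "p v \<in> p ` e" using vertices_edge[of e] assms by blast
  then have "v \<in> e" using inj_p edge_subset[of e] e assms by (auto simp: inj_on_def)
  then show "v \<in> \<Union>S" using e by blast
next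
  assume "v \<in> \<Union>S"
  then obtain e where e: "e \<in> S" "v \<in> e" by blast
  then have "p v \<in> path_image (\<gamma> e)" using vertices_edge[of e] assms by blast
  then show "p v \<in> X S" using e by (auto simp: X_def)
qed

text \<open>A point of an edge other than its ends is no vertex point and lies on no other edge, so
  the point set determines the edges.\<close>

lemma X_subsetD:
  assumes "S \<subseteq> E" "T \<subseteq> E" "X S \<subseteq> X T" shows "S \<subseteq> T"
proof
  fix e assume e: "e \<in> S"
  then have "e \<in> E" using assms by auto
  obtain x where x: "x \<in> path_image (\<gamma> e)" "x \<notin> {pathstart (\<gamma> e), pathfinish (\<gamma> e)}"
    using nonempty_simple_path_endless[of "\<gamma> e"] arc_edge[OF \<open>e \<in> E\<close>] arc_imp_simple_path by blast
  then have xV: "x \<notin> p ` V" using ends_edge[OF \<open>e \<in> E\<close>] vertices_edge[OF \<open>e \<in> E\<close>] by blast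
  obtain f where f: "f \<in> T" "x \<in> path_image (\<gamma> f)" using assms(3) e x(1) by (auto simp: X_def)
  have "f = e"
  proof (rule ccontr)
    assume "f \<noteq> e"
    then have "x \<in> p ` (e \<inter> f)" using edges_meet[of e f] f x \<open>e \<in> E\<close> assms by blast
    then show False using xV edge_subset[OF \<open>e \<in> E\<close>] by blast
  qed
  then show "e \<in> T" using f by simp
qed

lemma arc_of_path:
  assumes "distinct xs" "length xs \<ge> 2" "path_edges xs \<subseteq> E"
  shows "\<exists>g. arc g \<and> pathstart g = p (hd xs) \<and> pathfinish g = p (last xs) \<and> path_image g = X (path_edges xs)"
  using assms
proof (induction xs rule: path_edges.induct)
  case (1 x y zs)
  have e: "{x, y} \<in> E" and xy: "x \<noteq> y" using 1 by auto
  have "\<exists>g. arc g \<and> pathstart g = p x \<and> pathfinish g = p y \<and> path_image g = path_image (\<gamma> {x, y})"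
  proof -
    have "{pathstart (\<gamma> {x,y}), pathfinish (\<gamma> {x,y})} = {p x, p y}" using ends_edge[OF e] by simp
    then consider "pathstart (\<gamma> {x,y}) = p x" "pathfinish (\<gamma> {x,y}) = p y"
      | "pathstart (\<gamma> {x,y}) = p y" "pathfinish (\<gamma> {x,y}) = p x"
      by (auto simp: doubleton_eq_iff)
    then show ?thesis
    proof cases
      case 1 then show ?thesis using arc_edge[OF e] by blast
    next
      case 2 then show ?thesis using arc_edge[OF e]
        by (intro exI[of _ "reversepath (\<gamma> {x,y})"]) (simp add: arc_reversepath)
    qed
  qed
  then obtain g where g: "arc g" "pathstart g = p x" "pathfinish g = p y" "path_image g = path_image (\<gamma> {x, y})"
    by blast
  show ?case
  proof (cases zs)
    case Nil
    then show ?thesis using g by (auto simp: X_def)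
  next
    case (Cons z zs')
    then obtain h where h: "arc h" "pathstart h = p y" "pathfinish h = p (last (y # zs))" "path_image h = X (path_edges (y # zs))"
      using 1 by auto
    have x: "x \<notin> \<Union>(path_edges (y # zs))" using Union_path_edges_subset[of "y # zs"] 1(2) by auto
    have "path_image g \<inter> path_image h = X {{x,y}} \<inter> X (path_edges (y # zs))"
      using g h by (simp add: X_def)
    also have "\<dots> = p ` (\<Union>{{x,y}} \<inter> \<Union>(path_edges (y # zs)))"
      using x 1(4) by (intro X_Int) auto
    also have "\<dots> \<subseteq> {p y}" using x by auto
    finally have "arc (g +++ h)" using g h by (intro arc_join) auto
    moreover have "path_image (g +++ h) = X (path_edges (x # y # zs))"
      using g h by (simp add: path_image_join X_def)
    ultimately show ?thesis using g h by (intro exI[of _ "g +++ h"]) auto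
  qed
qed auto

lemma cycle_component_frontier:
  assumes "is_cycle C" "C \<subseteq> E" "W \<in> components (- X C)"
  shows "frontier W = X C" "W = inside (X C) \<or> W = outside (X C)"
proof -
  obtain xs where xs: "distinct xs" "length xs \<ge> 3" "C = cycle_edges xs"
    using assms(1) by (auto simp: is_cycle_def)
  obtain a b ys where "xs = a # b # ys" using xs(2) by (cases xs; cases "tl xs"; auto)
  then have ab: "a \<in> \<Union>C" "b \<in> \<Union>C" "a \<noteq> b" using xs Union_cycle_edges[of xs] by auto
  obtain u v where s: "cycle_split C a b u v" using cycle_split_exists[OF assms(1) ab] .
  define P1 P2 where "P1 = path_edges (a # u @ [b])" and "P2 = path_edges (a # v @ [b])"
  have C: "C = P1 \<union> P2" "P1 \<inter> P2 = {}" "\<Union>P1 \<inter> \<Union>P2 = {a, b}"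
    using s cycle_split_disjoint[OF s] by (auto simp: cycle_split_def P1_def P2_def)
  obtain c1 where c1: "arc c1" "pathstart c1 = p a" "pathfinish c1 = p b" "path_image c1 = X P1"
    using arc_of_path[of "a # u @ [b]"] s C(1) assms(2) by (auto simp: cycle_split_def P1_def)
  obtain c2 where c2: "arc c2" "pathstart c2 = p a" "pathfinish c2 = p b" "path_image c2 = X P2"
    using arc_of_path[of "a # v @ [b]"] s C(1) assms(2) by (auto simp: cycle_split_def P2_def)
  have "path_image c1 \<inter> path_image c2 = {p a, p b}"
    using X_Int[of P1 P2] C assms(2) c1 c2 by auto
  then show "frontier W = X C" "W = inside (X C) \<or> W = outside (X C)"
    using Jordan_arcs_component_frontier[OF c1(1) c2(1) c1(2,3) c2(2,3), of W] assms(3) C(1) c1(4) c2(4)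
    by (simp_all add: X_Un)
qed

text \<open>The ear without its ends is connected and lies in one face \<open>W0\<close>; its ends
  are in the closure of \<open>W0\<close>, hence on the boundary cycle \<open>C\<close>. The other
  faces survive, and the pieces of \<open>W0\<close> are faces of the theta curve made of
  \<open>C\<close> and the ear. The clause
  \<open>S \<noteq> C \<longrightarrow> f \<noteq> C\<close> records that, unless \<open>S\<close>
  is a mere cycle, \<open>C\<close> bounds no face but the one that the ear destroys.\<close>

lemma ear_faces:
  assumes S: "S \<subseteq> E" and F: "\<And>f. f \<in> F \<Longrightarrow> is_cycle f \<and> f \<subseteq> S"
    and faces: "\<And>W. W \<in> components (- X S) \<Longrightarrow> \<exists>f\<in>F. frontier W = X f"
    and ear: "distinct (a # r @ [b])" "path_edges (a # r @ [b]) \<subseteq> E - S"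
      "set r \<inter> \<Union>S = {}" "a \<in> \<Union>S" "b \<in> \<Union>S"
  obtains C where "C \<in> F" "a \<in> \<Union>C" "b \<in> \<Union>C"
    "\<And>u v W. cycle_split C a b u v \<Longrightarrow> W \<in> components (- X (S \<union> path_edges (a # r @ [b]))) \<Longrightarrow>
      \<exists>f. frontier W = X f \<and> (f \<in> F \<and> (S \<noteq> C \<longrightarrow> f \<noteq> C) \<or>
        f = path_edges (a # u @ [b]) \<union> path_edges (a # r @ [b]) \<or>
        f = path_edges (a # v @ [b]) \<union> path_edges (a # r @ [b]))"
proof -
  define P where "P = path_edges (a # r @ [b])"
  have P: "P \<subseteq> E" "P \<inter> S = {}" "\<Union>P \<inter> \<Union>S = {a, b}"
    using ear Union_path_edges[of "a # r @ [b]"] by (auto simp: P_def)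
  obtain g where g: "arc g" "pathstart g = p a" "pathfinish g = p b" "path_image g = X P"
    using arc_of_path[of "a # r @ [b]"] ear P(1) by (auto simp: P_def)
  define P0 where "P0 = X P - {p a, p b}"
  have XPS: "X P \<inter> X S = {p a, p b}" using X_Int[OF P(1) S P(2)] P(3) by simp
  have P0: "connected P0" "P0 \<noteq> {}" "P0 \<subseteq> - X S"
    using connected_simple_path_endless[of g] nonempty_simple_path_endless[of g] g XPS
    by (auto simp: P0_def arc_imp_simple_path)
  have abV: "a \<in> V" "b \<in> V" using ear(4,5) S edge_subset by blast+
  have openS: "open (- X S)" using closed_X[OF S] by (simp add: open_Compl)
  obtain W0 where W0: "W0 \<in> components (- X S)" "P0 \<subseteq> W0"
    using exists_component_superset[OF P0(3) _ P0(1)] P0 by blast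
  obtain C where C: "C \<in> F" "frontier W0 = X C" using faces[OF W0(1)] by blast
  have CS: "C \<subseteq> S" "is_cycle C" "C \<subseteq> E" using F[OF C(1)] S by auto
  have W0': "connected W0" "W0 \<subseteq> - X S" "open W0"
    using W0(1) openS in_components_connected in_components_subset open_components by blast+
  have clP0: "{p a, p b} \<subseteq> closure P0"
  proof -
    have P0g: "P0 = g ` {0<..<1}"
      using simple_path_endless[OF arc_imp_simple_path[OF g(1)]] g by (simp add: P0_def)
    have "continuous_on (closure {0<..<1}) g"
      using g(1) by (simp add: arc_def path_def)
    then have "g ` closure {0<..<1} \<subseteq> closure P0"
      by (rule image_closure_subset) (simp_all add: P0g closure_subset)
    then have "g 0 \<in> closure P0" "g 1 \<in> closure P0" by (auto simp: image_subset_iff)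
    then show ?thesis using g by (simp add: pathstart_def pathfinish_def)
  qed
  have inC: "x \<in> \<Union>C" if "x \<in> {a, b}" for x
  proof -
    have "p x \<in> closure W0" using clP0 closure_mono[OF W0(2)] that by auto
    moreover have "p x \<in> X S" using vertex_in_X[OF S] that ear abV by auto
    ultimately have "p x \<in> frontier W0" using W0' by (auto simp: frontier_def interior_open)
    then show ?thesis using C vertex_in_X[OF CS(3)] that abV by auto
  qed
  have W0C: "W0 \<in> components (- X C)"
    using component_if_frontier_subset[OF X_mono[OF CS(1)] W0(1)] C by auto
  have "\<exists>f. frontier Q = X f \<and> (f \<in> F \<and> (S \<noteq> C \<longrightarrow> f \<noteq> C) \<or>
        f = path_edges (a # u @ [b]) \<union> P \<or> f = path_edges (a # v @ [b]) \<union> P)"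
    if s: "cycle_split C a b u v" and Q: "Q \<in> components (- X (S \<union> P))" for u v Q
  proof -
    have Q': "connected Q" "Q \<noteq> {}" "Q \<subseteq> - X (S \<union> P)"
      using Q in_components_connected in_components_nonempty in_components_subset by metis+
    have frQ: "frontier Q \<subseteq> X (S \<union> P)"
      using frontier_of_components_subset[OF Q] closed_X[of "S \<union> P"] S P(1)
      by (metis Un_least frontier_complement frontier_subset_eq subset_trans)
    have QS: "Q \<subseteq> - X S" using Q'(3) by (auto simp: X_Un)
    show ?thesis
    proof (cases "Q \<inter> W0 = {}")
      case True
      obtain W where W: "W \<in> components (- X S)" "Q \<subseteq> W"
        using exists_component_superset[OF QS _ Q'(1)] Q'(2) QS by blast
      have "W \<noteq> W0" using W True Q'(2) by blast
      then have "W \<inter> W0 = {}" using W(1) W0(1) components_nonoverlap by blast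
      moreover have "W \<subseteq> - X S" using W(1) in_components_subset by blast
      moreover have "X P \<subseteq> P0 \<union> X S" using XPS by (auto simp: P0_def)
      ultimately have "W \<subseteq> - X (S \<union> P)" using W0(2) by (auto simp: X_Un)
      then have "W = Q" using Q W in_components_connected[OF W(1)] Q'(2)
        unfolding in_components_maximal by blast
      obtain f where f: "f \<in> F" "frontier W = X f" using faces[OF W(1)] by blast
      \<comment> \<open>Two different faces bounded by \<open>C\<close> are its inside and its
        outside, which leaves no room for further edges of \<open>S\<close>.\<close>
      have "S = C" if "f = C"
      proof -
        have "W \<in> components (- X C)"
          using component_if_frontier_subset[OF X_mono[OF CS(1)] W(1)] f that by auto
        then have "W = inside (X C) \<or> W = outside (X C)" "W0 = inside (X C) \<or> W0 = outside (X C)"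
          using cycle_component_frontier(2)[OF CS(2,3)] W0C by blast+
        then have "W \<union> W0 = inside (X C) \<union> outside (X C)" using \<open>W \<noteq> W0\<close> by blast
        then have "W \<union> W0 = - X C" by simp
        then have "X S \<subseteq> X C" using W0'(2) \<open>W \<subseteq> - X S\<close> by blast
        then show ?thesis using X_subsetD[OF S CS(3)] CS(1) by blast
      qed
      then show ?thesis using f \<open>W = Q\<close> by blast
    next
      case False
      then have "Q \<subseteq> W0" using components_maximal[OF W0(1) Q'(1) QS] by blast
      then have "closure Q \<subseteq> W0 \<union> X C"
        using closure_mono[of Q W0] C(2) closure_Un_frontier[of W0] by simp
      moreover have "frontier Q \<subseteq> closure Q" by (simp add: frontier_def)
      ultimately have "frontier Q \<subseteq> X C \<union> X P" using frQ W0'(2) by (auto simp: X_Un)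
      then have fr: "frontier Q \<subseteq> X (C \<union> P)" by (simp add: X_Un)
      have QC: "Q \<in> components (- X (C \<union> P))"
        by (rule component_if_frontier_subset[OF _ Q fr]) (use CS in \<open>auto simp: X_def\<close>)
      define P1 P2 where "P1 = path_edges (a # u @ [b])" and "P2 = path_edges (a # v @ [b])"
      have CP: "C = P1 \<union> P2" "P1 \<inter> P2 = {}" "\<Union>P1 \<inter> \<Union>P2 = {a, b}"
        using s cycle_split_disjoint[OF s] by (auto simp: cycle_split_def P1_def P2_def)
      obtain c1 where c1: "arc c1" "pathstart c1 = p a" "pathfinish c1 = p b" "path_image c1 = X P1"
        using arc_of_path[of "a # u @ [b]"] s CP(1) CS(3) by (auto simp: cycle_split_def P1_def)
      obtain c2 where c2: "arc c2" "pathstart c2 = p a" "pathfinish c2 = p b" "path_image c2 = X P2"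
        using arc_of_path[of "a # v @ [b]"] s CP(1) CS(3) by (auto simp: cycle_split_def P2_def)
      have ab12: "a \<in> \<Union>P1" "b \<in> \<Union>P1" "a \<in> \<Union>P2" "b \<in> \<Union>P2" using CP(3) by auto
      have i12: "path_image c1 \<inter> path_image c2 = {p a, p b}"
        using X_Int[of P1 P2] CP CS(3) c1 c2 by auto
      have "\<Union>P1 \<inter> \<Union>P = {a, b}" "\<Union>P2 \<inter> \<Union>P = {a, b}"
        using P(3) CP(1) CS(1) ab12 by blast+
      then have i13: "path_image c1 \<inter> path_image g = {p a, p b}" "path_image c2 \<inter> path_image g = {p a, p b}"
      proof -
        have "P1 \<inter> P = {}" "P2 \<inter> P = {}" "P1 \<subseteq> E" "P2 \<subseteq> E" using P(2) CP(1) CS by blast+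
        then show "path_image c1 \<inter> path_image g = {p a, p b}" "path_image c2 \<inter> path_image g = {p a, p b}"
          using X_Int[of P1 P] X_Int[of P2 P] P(1) c1(4) c2(4) g(4)
            \<open>\<Union>P1 \<inter> \<Union>P = {a, b}\<close> \<open>\<Union>P2 \<inter> \<Union>P = {a, b}\<close> by simp_all
      qed
      have "Q \<in> components (- (path_image c1 \<union> path_image c2 \<union> path_image g))"
        using QC CP(1) c1(4) c2(4) g(4) by (simp add: X_Un)
      from theta_frontier[OF c1(1) c2(1) g(1) c1(2,3) c2(2,3) g(2,3) i12 i13 this]
      consider "frontier Q = X C" | "frontier Q = X (P1 \<union> P)" | "frontier Q = X (P2 \<union> P)"
        using CP(1) c1(4) c2(4) g(4) by (auto simp: X_Un)
      then show ?thesis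
      proof cases
        case 1
        \<comment> \<open>A face with frontier \<open>X C\<close> would be all of \<open>W0\<close>,
          but \<open>W0\<close> contains the ear.\<close>
        then have "Q \<in> components (- X C)"
          using component_if_frontier_subset[OF _ QC, of "X C"] by (auto simp: X_Un)
        then have "Q = W0" using W0C False components_nonoverlap by blast
        then show ?thesis using W0(2) P0(2) Q'(3) by (auto simp: P0_def X_Un)
      next
        case 2 then show ?thesis unfolding P1_def by blast
      next
        case 3 then show ?thesis unfolding P2_def by blast
      qed
    qed
  qed
  then show ?thesis using that[OF C(1) inC inC, of] unfolding P_def by blast
qed

end

section \<open>Leaf blocks\<close>

text \<open>The faces of \<open>F\<close> are represented by their sets of boundary edges. The linking condition says that
  the corners at a vertex connect all its edges, so no vertex is a pinch point.\<close>

definition linked :: "'a set set \<Rightarrow> 'a set set set \<Rightarrow> bool" where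
  "linked S F \<longleftrightarrow> (\<forall>v A. A \<subseteq> {e \<in> S. v \<in> e} \<and> A \<noteq> {} \<and> A \<noteq> {e \<in> S. v \<in> e} \<longrightarrow>
     (\<exists>f\<in>F. \<exists>e\<in>f. \<exists>e'\<in>f. v \<in> e' \<and> e \<in> A \<and> e' \<notin> A))"

text \<open>All that the discharging needs to know about planarity: faces are cycles, Euler's
  formula holds, every edge has two sides, and no vertex is a pinch point.\<close>

definition sphere_complex :: "'a set set \<Rightarrow> 'a set set set \<Rightarrow> bool" where
  "sphere_complex S F \<longleftrightarrow> (\<forall>f\<in>F. is_cycle f \<and> f \<subseteq> S) \<and> card F + card (\<Union>S) = card S + 2 \<and>
     (\<forall>e\<in>S. card {f \<in> F. e \<in> f} = 2) \<and> linked S F"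

lemma linked_mono: "linked S F \<Longrightarrow> F \<subseteq> F' \<Longrightarrow> linked S F'"
  unfolding linked_def by (meson subsetD)

text \<open>If \<open>A\<close> separates the old edges at \<open>v\<close>, an old corner shows it.
  This corner is lost only if it belongs to \<open>C\<close> and its two edges lie on different
  arcs; then \<open>v\<close> is an end of the ear, and the ear edge at \<open>v\<close> forms a new
  corner with either of them. If \<open>A\<close> separates the old edges from the ear, a corner
  between \<open>P1\<close> and the ear crosses; at an inner vertex of the ear both edges are on the
  new faces.\<close>

lemma linked_ear:
  assumes link: "linked S F" and FS: "\<And>f. f \<in> F \<Longrightarrow> f \<subseteq> S"
    and C: "C \<subseteq> S" "C = P1 \<union> P2" "\<Union>P1 \<inter> \<Union>P2 = {a, b}"
    and P: "\<Union>P \<inter> \<Union>S = {a, b}" "P \<inter> S = {}"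
  shows "linked (S \<union> P) (F - {C} \<union> {P1 \<union> P, P2 \<union> P})"
  unfolding linked_def
proof (intro allI impI)
  let ?F = "F - {C} \<union> {P1 \<union> P, P2 \<union> P}"
  fix v A
  let ?A = "{e \<in> S \<union> P. v \<in> e}"
  assume "A \<subseteq> ?A \<and> A \<noteq> {} \<and> A \<noteq> ?A"
  then have A: "A \<subseteq> ?A" "A \<noteq> {}" "\<not> ?A \<subseteq> A" by auto
  have goal1: "\<exists>f\<in>?F. \<exists>e\<in>f. \<exists>e'\<in>f. v \<in> e' \<and> e \<in> A \<and> e' \<notin> A"
    if "e \<in> P1 \<union> P" "e' \<in> P1 \<union> P" "v \<in> e'" "e \<in> A" "e' \<notin> A" for e e'
    by (rule bexI[of _ "P1 \<union> P"], rule bexI[of _ e], rule bexI[of _ e']) (use that in auto)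
  have goal2: "\<exists>f\<in>?F. \<exists>e\<in>f. \<exists>e'\<in>f. v \<in> e' \<and> e \<in> A \<and> e' \<notin> A"
    if "e \<in> P2 \<union> P" "e' \<in> P2 \<union> P" "v \<in> e'" "e \<in> A" "e' \<notin> A" for e e'
    by (rule bexI[of _ "P2 \<union> P"], rule bexI[of _ e], rule bexI[of _ e']) (use that in auto)
  show "\<exists>f\<in>?F. \<exists>e\<in>f. \<exists>e'\<in>f. v \<in> e' \<and> e \<in> A \<and> e' \<notin> A"
  proof (cases "v \<in> \<Union>S")
    case False
    obtain e where e: "e \<in> A" using A(2) by auto
    obtain e' where e': "e' \<in> ?A" "e' \<notin> A" using A(3) by auto
    have "e \<in> P" "e' \<in> P" "v \<in> e'" using False e e' A(1) by auto
    then show ?thesis using e e' by (intro goal1[of e e']) auto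
  next
    case True
    have vab: "v \<in> {a, b}" if "e \<in> P" "v \<in> e" for e
      unfolding P(1)[symmetric] using True that by auto
    show ?thesis
    proof (cases "A \<inter> S = {} \<or> {e \<in> S. v \<in> e} \<subseteq> A")
      case False
      have "A \<inter> S \<subseteq> {e \<in> S. v \<in> e} \<and> A \<inter> S \<noteq> {} \<and> A \<inter> S \<noteq> {e \<in> S. v \<in> e}"
        using False A(1) by auto
      then obtain f e e' where f: "f \<in> F" "e \<in> f" "e' \<in> f" "v \<in> e'" "e \<in> A" "e' \<notin> A \<inter> S"
        using link[unfolded linked_def, rule_format, of "A \<inter> S" v] by auto
      have e': "e' \<notin> A" and ve: "v \<in> e" using f FS[of f] A(1) by auto
      show ?thesis
      proof (cases "f = C")
        case fC: True
        then have eP: "e \<in> P1 \<or> e \<in> P2" "e' \<in> P1 \<or> e' \<in> P2" using f C(2) by auto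
        show ?thesis
        proof (cases "(e \<in> P1 \<and> e' \<in> P1) \<or> (e \<in> P2 \<and> e' \<in> P2)")
          case True
          then show ?thesis using f e' goal1[of e e'] goal2[of e e'] by auto
        next
          case False
          then have "v \<in> \<Union>P1 \<inter> \<Union>P2" using eP ve f(4) by auto
          then have "v \<in> \<Union>P" using C(3) P(1) by auto
          then obtain q where q: "q \<in> P" "v \<in> q" by auto
          show ?thesis
          proof (cases "q \<in> A")
            case True
            then show ?thesis using q e' eP f(4) goal1[of q e'] goal2[of q e'] by auto
          next
            case False
            then show ?thesis using q eP f goal1[of e q] goal2[of e q] by auto
          qed
        qed
      next
        case False
        then show ?thesis using f e' by (intro bexI[of _ f] bexI[of _ e] bexI[of _ e']) auto
      qed
    next
      case AS: True
      have "\<exists>q\<in>P. v \<in> q \<and> (q \<in> A \<longleftrightarrow> A \<inter> S = {})"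
      proof (cases "A \<inter> S = {}")
        case True
        obtain e where e: "e \<in> A" using A(2) by auto
        then have "e \<in> P" "v \<in> e" using A(1) True by auto
        then show ?thesis using e True by auto
      next
        case False
        obtain e where e: "e \<in> ?A" "e \<notin> A" using A(3) by auto
        then have "e \<in> P" using AS False by auto
        then show ?thesis using e False by auto
      qed
      then obtain q where q: "q \<in> P" "v \<in> q" "q \<in> A \<longleftrightarrow> A \<inter> S = {}" by auto
      have "v \<in> \<Union>P1 \<inter> \<Union>P2" using vab[OF q(1,2)] C(3) by simp
      then obtain q1 where q1: "q1 \<in> P1" "v \<in> q1" by auto
      then have "q1 \<in> S" using C by auto
      then have "q1 \<in> A \<longleftrightarrow> A \<inter> S \<noteq> {}" using AS q1 by auto
      then show ?thesis using q q1 goal1[of q q1] goal1[of q1 q] by auto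
    qed
  qed
qed

lemma length_ear_edges:
  assumes "distinct (a # r @ [b])"
  shows "card (path_edges (a # r @ [b])) = Suc (length r)"
  using card_path_edges[OF assms] by simp

text \<open>One more edge than vertices is added, which pays for the one additional face in Euler's
  formula.\<close>

lemma ear_counts:
  assumes "finite S" "finite (\<Union>S)" and ear: "distinct (a # r @ [b])" "path_edges (a # r @ [b]) \<inter> S = {}"
    "set r \<inter> \<Union>S = {}" "a \<in> \<Union>S" "b \<in> \<Union>S"
  defines "P \<equiv> path_edges (a # r @ [b])"
  shows "card (S \<union> P) = card S + Suc (length r)" "card (\<Union>(S \<union> P)) = card (\<Union>S) + length r"
    "\<Union>P \<inter> \<Union>S = {a, b}" "P \<noteq> {}"
proof -
  have UP: "\<Union>P = insert a (insert b (set r))" unfolding P_def by (subst Union_path_edges) auto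
  show "card (S \<union> P) = card S + Suc (length r)"
    using assms length_ear_edges[OF ear(1)] by (subst card_Un_disjoint) auto
  have "\<Union>(S \<union> P) = \<Union>S \<union> set r" using UP ear by auto
  moreover have "card (\<Union>S \<union> set r) = card (\<Union>S) + card (set r)"
    using assms(2) ear(3) by (subst card_Un_disjoint) auto
  ultimately show "card (\<Union>(S \<union> P)) = card (\<Union>S) + length r"
    using ear(1) by (simp add: distinct_card)
  show "\<Union>P \<inter> \<Union>S = {a, b}" using UP ear by auto
  show "P \<noteq> {}" using length_ear_edges[OF ear(1)] unfolding P_def by force
qed

lemma ear_cycle:
  assumes s: "cycle_split C a b u v" and C: "C \<subseteq> S" and ear: "distinct (a # r @ [b])"
    "path_edges (a # r @ [b]) \<inter> S = {}" "set r \<inter> \<Union>S = {}"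
  shows "is_cycle (path_edges (a # u @ [b]) \<union> path_edges (a # r @ [b]))"
proof (rule is_cycle_if_split)
  have "set u \<subseteq> \<Union>(path_edges (a # u @ [b]))" by (subst Union_path_edges) auto
  also have "\<dots> \<subseteq> \<Union>S" using s C unfolding cycle_split_def by blast
  finally have "set u \<inter> set r = {}" using ear(3) by auto
  \<comment> \<open>Were both empty, the ear would be the edge \<open>{a, b}\<close> of
    \<open>C\<close>, but it has no edge in \<open>S\<close>.\<close>
  moreover have "u \<noteq> [] \<or> r \<noteq> []"
    using s C ear(2) unfolding cycle_split_def by auto
  ultimately show "cycle_split (path_edges (a # u @ [b]) \<union> path_edges (a # r @ [b])) a b u r"
    using s ear(1) unfolding cycle_split_def by auto
qed

text \<open>If \<open>S\<close> is the cycle \<open>C\<close> itself, both of its sides remain faces of the boundary \<open>C\<close> except that one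
  is divided, so \<open>C\<close> stays; otherwise it disappears.\<close>

lemma sphere_complex_ear:
  assumes S: "S = C \<and> F = {C} \<and> F0 = {C} \<or> sphere_complex S F \<and> C \<in> F \<and> F0 = F - {C}" and "finite S" "finite (\<Union>S)"
    and s: "cycle_split C a b u v"
    and ear: "distinct (a # r @ [b])" "path_edges (a # r @ [b]) \<inter> S = {}"
    "set r \<inter> \<Union>S = {}" "a \<in> \<Union>S" "b \<in> \<Union>S"
  defines "P \<equiv> path_edges (a # r @ [b])" and "P1 \<equiv> path_edges (a # u @ [b])" and "P2 \<equiv> path_edges (a # v @ [b])"
  shows "sphere_complex (S \<union> P) (F0 \<union> {P1 \<union> P, P2 \<union> P})"
proof -
  note counts = ear_counts[OF assms(2,3) ear, folded P_def]
  have PS: "P \<inter> S = {}" using ear by (simp add: P_def)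
  have CS: "C \<subseteq> S" "C \<in> F" "\<And>f. f \<in> F \<Longrightarrow> is_cycle f \<and> f \<subseteq> S"
    using S is_cycle_if_split[OF s] by (auto simp: sphere_complex_def)
  have C: "C = P1 \<union> P2" "P1 \<inter> P2 = {}" "\<Union>P1 \<inter> \<Union>P2 = {a, b}"
    using s cycle_split_disjoint[OF s] by (auto simp: cycle_split_def P1_def P2_def)
  have ne: "P1 \<noteq> {}" "P2 \<noteq> {}" using C(3) by auto
  have finF: "finite F" using CS(3) \<open>finite S\<close> by (meson Pow_iff finite_Pow_iff finite_subset subsetI)
  have F0: "F0 \<subseteq> F" "finite F0" using S finF finite_subset by auto
  have cyc: "is_cycle (P1 \<union> P)" "is_cycle (P2 \<union> P)"
    using ear_cycle[OF s CS(1) ear(1-3)] ear_cycle[OF cycle_split_swap[THEN iffD1, OF s] CS(1) ear(1-3)]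
    by (simp_all add: P_def P1_def P2_def)
  have new: "P1 \<union> P \<notin> F" "P2 \<union> P \<notin> F" using CS(3) counts(4) PS by blast+
  have "P1 \<union> P \<noteq> P2 \<union> P" using C ne PS CS(1) by blast
  then have diff: "card (F0 \<union> {P1 \<union> P, P2 \<union> P}) = card F0 + 2" using new F0 by (subst card_Un_disjoint) auto
  show ?thesis unfolding sphere_complex_def
  proof (intro conjI ballI)
    fix f assume "f \<in> F0 \<union> {P1 \<union> P, P2 \<union> P}"
    then show "is_cycle f" "f \<subseteq> S \<union> P" using CS cyc F0 C by auto
  next
    show "card (F0 \<union> {P1 \<union> P, P2 \<union> P}) + card (\<Union>(S \<union> P)) = card (S \<union> P) + 2"
      using S
    proof
      assume *: "S = C \<and> F = {C} \<and> F0 = {C}"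
      obtain xs where xs: "distinct xs" "length xs \<ge> 3" "C = cycle_edges xs"
        using is_cycle_if_split[OF s] by (auto simp: is_cycle_def)
      have "card (\<Union>C) = length xs" using xs Union_cycle_edges[of xs] by (simp add: distinct_card)
      moreover have "card C = length xs"
      proof -
        have "length (a # u @ [b]) + length (a # v @ [b]) = card (\<Union>P1 \<union> \<Union>P2) + 2"
        proof -
          have "\<Union>P1 \<union> \<Union>P2 = set (a # u @ b # v)"
            unfolding P1_def P2_def by (subst (1 2) Union_path_edges) auto
          moreover have "distinct (a # u @ b # v)" using s by (simp add: cycle_split_def)
          ultimately have "card (\<Union>P1 \<union> \<Union>P2) = length (a # u @ b # v)" by (metis distinct_card)
          then show ?thesis by simp
        qed
        moreover have "card P1 = Suc (length u)" "card P2 = Suc (length v)"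
          using s unfolding P1_def P2_def cycle_split_def by (intro length_ear_edges; auto)+
        moreover have "card C = card P1 + card P2"
          using C(1,2) by (simp add: card_Un_disjoint P1_def P2_def)
        moreover have "\<Union>P1 \<union> \<Union>P2 = \<Union>C" using C(1) by auto
        ultimately show ?thesis using \<open>card (\<Union>C) = length xs\<close> by simp
      qed
      ultimately show ?thesis using * counts(1,2) diff by simp
    next
      assume *: "sphere_complex S F \<and> C \<in> F \<and> F0 = F - {C}"
      then have "card F0 + 1 = card F" using finF by (metis Suc_eq_plus1 card_Suc_Diff1)
      then show ?thesis using * counts(1,2) diff by (simp add: sphere_complex_def)
    qed
  next
    fix e assume e: "e \<in> S \<union> P"
    let ?F = "F0 \<union> {P1 \<union> P, P2 \<union> P}"
    consider "e \<in> P" | "e \<in> S - C" "e \<notin> P" | "e \<in> P1" "e \<notin> P2 \<union> P" | "e \<in> P2" "e \<notin> P1 \<union> P"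
      using e PS C CS(1) by blast
    then show "card {f \<in> ?F. e \<in> f} = 2"
    proof cases
      case 1
      have "e \<notin> f" if "f \<in> F0" for f using CS(3)[of f] that F0(1) PS 1 by auto
      then have "{f \<in> ?F. e \<in> f} = {P1 \<union> P, P2 \<union> P}" using 1 by auto
      then show ?thesis using \<open>P1 \<union> P \<noteq> P2 \<union> P\<close> by simp
    next
      case 2
      then have "S \<noteq> C" by auto
      then have *: "sphere_complex S F" "C \<in> F" "F0 = F - {C}" using S by auto
      have "{f \<in> ?F. e \<in> f} = {f \<in> F. e \<in> f}" using 2 C(1) * by auto
      then show ?thesis using * 2 by (simp add: sphere_complex_def)
    next
      case 3
      have "{f \<in> ?F. e \<in> f} = insert (P1 \<union> P) {f \<in> F0. e \<in> f}" using 3 by auto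
      moreover have "card {f \<in> F0. e \<in> f} = 1"
        using S
      proof
        assume *: "sphere_complex S F \<and> C \<in> F \<and> F0 = F - {C}"
        then have "{f \<in> F0. e \<in> f} = {f \<in> F. e \<in> f} - {C}" by auto
        moreover have "C \<in> {f \<in> F. e \<in> f}" using * 3 C(1) by auto
        moreover have "e \<in> S" using 3 C(1) CS(1) by auto
        then have "card {f \<in> F. e \<in> f} = 2" using * by (simp add: sphere_complex_def)
        ultimately show ?thesis using finF by simp
      next
        assume *: "S = C \<and> F = {C} \<and> F0 = {C}"
        then have "{f \<in> F0. e \<in> f} = {C}" using 3 C(1) by auto
        then show ?thesis by simp
      qed
      moreover have "P1 \<union> P \<notin> F0" "P2 \<union> P \<notin> F0" using new F0(1) by auto
      ultimately show ?thesis using F0(2) by (simp add: card_insert_if)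
    next
      case 4
      have "{f \<in> ?F. e \<in> f} = insert (P2 \<union> P) {f \<in> F0. e \<in> f}" using 4 by auto
      moreover have "card {f \<in> F0. e \<in> f} = 1"
        using S
      proof
        assume *: "sphere_complex S F \<and> C \<in> F \<and> F0 = F - {C}"
        then have "{f \<in> F0. e \<in> f} = {f \<in> F. e \<in> f} - {C}" by auto
        moreover have "C \<in> {f \<in> F. e \<in> f}" using * 4 C(1) by auto
        moreover have "e \<in> S" using 4 C(1) CS(1) by auto
        then have "card {f \<in> F. e \<in> f} = 2" using * by (simp add: sphere_complex_def)
        ultimately show ?thesis using finF by simp
      next
        assume *: "S = C \<and> F = {C} \<and> F0 = {C}"
        then have "{f \<in> F0. e \<in> f} = {C}" using 4 C(1) by auto
        then show ?thesis by simp
      qed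
      moreover have "P1 \<union> P \<notin> F0" "P2 \<union> P \<notin> F0" using new F0(1) by auto
      ultimately show ?thesis using F0(2) by (simp add: card_insert_if)
    qed
  next
    have "linked S F"
      using S
    proof
      assume *: "S = C \<and> F = {C} \<and> F0 = {C}"
      show ?thesis unfolding linked_def
      proof (intro allI impI)
        fix w A assume A: "A \<subseteq> {e \<in> S. w \<in> e} \<and> A \<noteq> {} \<and> A \<noteq> {e \<in> S. w \<in> e}"
        then obtain e e' where "e \<in> A" "e \<in> C" "e' \<in> C" "w \<in> e'" "e' \<notin> A" using * by blast
        then show "\<exists>f\<in>F. \<exists>e\<in>f. \<exists>e'\<in>f. w \<in> e' \<and> e \<in> A \<and> e' \<notin> A" using * by blast
      qed
    qed (simp add: sphere_complex_def)
    then have "linked (S \<union> P) (F - {C} \<union> {P1 \<union> P, P2 \<union> P})"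
      using CS C counts(3) PS by (intro linked_ear[where a = a and b = b]) auto
    then show "linked (S \<union> P) (F0 \<union> {P1 \<union> P, P2 \<union> P})"
      by (rule linked_mono) (use S in auto)
  qed
qed

context drawing
begin

definition faces_drawn :: "'a set set \<Rightarrow> 'a set set set \<Rightarrow> bool" where
  "faces_drawn S F \<longleftrightarrow> (\<forall>W\<in>components (- X S). \<exists>f\<in>F. frontier W = X f)"

definition good :: "'a set set \<Rightarrow> bool" where
  "good S \<longleftrightarrow> S \<subseteq> E \<and> (is_cycle S \<or> (\<exists>F. sphere_complex S F \<and> faces_drawn S F))"

lemma good_ear:
  assumes S: "good S" and ear: "distinct (a # r @ [b])" "path_edges (a # r @ [b]) \<subseteq> E - S"
      "set r \<inter> \<Union>S = {}" "a \<in> \<Union>S" "b \<in> \<Union>S"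
  shows "good (S \<union> path_edges (a # r @ [b]))"
proof -
  have SE: "S \<subseteq> E" using S by (simp add: good_def)
  have ear2: "path_edges (a # r @ [b]) \<inter> S = {}" using ear(2) by blast
  have fin: "finite S" "finite (\<Union>S)"
  proof -
    show "finite S" using SE finE by (rule finite_subset)
    have "\<Union>S \<subseteq> V" using SE edge_subset by blast
    then show "finite (\<Union>S)" using finV by (rule finite_subset)
  qed
  obtain F where F: "faces_drawn S F" "\<And>f. f \<in> F \<Longrightarrow> is_cycle f \<and> f \<subseteq> S"
    "is_cycle S \<and> F = {S} \<or> \<not> is_cycle S \<and> sphere_complex S F"
  proof -
    consider "is_cycle S" | F where "\<not> is_cycle S" "sphere_complex S F" "faces_drawn S F"
      using S by (auto simp: good_def)
    then show ?thesis
    proof cases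
      case 1
      then show ?thesis using that[of "{S}"] cycle_component_frontier(1)[OF 1 SE] by (auto simp: faces_drawn_def)
    next
      case 2
      then show ?thesis using that[of F] by (auto simp: sphere_complex_def)
    qed
  qed
  obtain C where C: "C \<in> F" "a \<in> \<Union>C" "b \<in> \<Union>C" and
    fr: "\<And>u v W. cycle_split C a b u v \<Longrightarrow> W \<in> components (- X (S \<union> path_edges (a # r @ [b]))) \<Longrightarrow>
      \<exists>f. frontier W = X f \<and> (f \<in> F \<and> (S \<noteq> C \<longrightarrow> f \<noteq> C) \<or>
        f = path_edges (a # u @ [b]) \<union> path_edges (a # r @ [b]) \<or>
        f = path_edges (a # v @ [b]) \<union> path_edges (a # r @ [b]))"
    by (rule ear_faces[OF SE F(2) _ ear]) (use F(1) in \<open>auto simp: faces_drawn_def\<close>)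
  have "a \<noteq> b" using ear(1) by auto
  obtain u v where s: "cycle_split C a b u v"
    using cycle_split_exists[of C a b] C F(2)[OF C(1)] \<open>a \<noteq> b\<close> by blast
  define F0 where "F0 = (if S = C then F else F - {C})"
  have *: "S = C \<and> F = {C} \<and> F0 = {C} \<or> sphere_complex S F \<and> C \<in> F \<and> F0 = F - {C}"
  proof (cases "S = C")
    case False
    then show ?thesis using F(3) C(1) by (auto simp: F0_def)
  next
    case True
    then have "F = {C}" using F(3) F(2)[OF C(1)] by auto
    then show ?thesis using True by (simp add: F0_def)
  qed
  have "sphere_complex (S \<union> path_edges (a # r @ [b])) (F0 \<union> {path_edges (a # u @ [b]) \<union> path_edges (a # r @ [b]),
      path_edges (a # v @ [b]) \<union> path_edges (a # r @ [b])})" (is "sphere_complex ?S ?F")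
    by (rule sphere_complex_ear[OF * fin s ear(1) ear2 ear(3-5)])
  moreover have "faces_drawn ?S ?F"
    unfolding faces_drawn_def
  proof
    fix W assume "W \<in> components (- X ?S)"
    from fr[OF s this] show "\<exists>f\<in>?F. frontier W = X f"
      by (auto simp: F0_def)
  qed
  ultimately show ?thesis using SE ear(2) by (auto simp: good_def)
qed

end

lemma cycle_edges_at:
  assumes "is_cycle C" "v \<in> \<Union>C"
  obtains x y where "x \<noteq> y" "v \<noteq> x" "v \<noteq> y" "{e \<in> C. v \<in> e} = {{v, x}, {v, y}}"
proof -
  obtain xs where xs: "distinct xs" "length xs \<ge> 3" "C = cycle_edges xs"
    using assms(1) by (auto simp: is_cycle_def)
  have "v \<in> set xs" using assms xs Union_cycle_edges[of xs] by auto
  then obtain us vs where ys: "xs = us @ v # vs" by (meson split_list)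
  define zs where "zs = vs @ us"
  have C: "C = cycle_edges (v # zs)" using xs(3) ys cycle_edges_rotate[of us "v # vs"] by (simp add: zs_def)
  have d: "distinct (v # zs)" "length zs \<ge> 2" using xs ys by (auto simp: zs_def)
  obtain x ws' where x: "zs = x # ws'" "ws' \<noteq> []" using d by (cases zs; cases "tl zs"; auto)
  obtain ws y where y: "ws' = ws @ [y]" using x(2) by (meson rev_exhaust)
  have "C = path_edges (v # x # (ws @ [y, v]))" using C x y by (simp add: cycle_edges_def)
  also have "\<dots> = insert {v, x} (insert {y, v} (path_edges (x # ws @ [y])))"
    using path_edges_snoc[of "x # ws" y v] by simp
  finally have "{e \<in> C. v \<in> e} = {{v, x}, {v, y}} \<union> {e \<in> path_edges (x # ws @ [y]). v \<in> e}"
    by (auto simp: insert_commute)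
  moreover have "{e \<in> path_edges (x # ws @ [y]). v \<in> e} = {}"
    using Union_path_edges_subset[of "x # ws @ [y]"] d x y by auto
  ultimately show ?thesis using that[of x y] d x y by auto
qed

lemma cycle_card:
  assumes "is_cycle C"
  shows "card (\<Union>C) = card C" "card C \<ge> 3" "finite C"
proof -
  obtain xs where xs: "distinct xs" "length xs \<ge> 3" "C = cycle_edges xs"
    using assms by (auto simp: is_cycle_def)
  obtain x ws where "xs = x # ws" "ws \<noteq> []" using xs by (cases xs; cases "tl xs"; auto)
  moreover from this obtain us y where "ws = us @ [y]" by (meson rev_exhaust)
  ultimately have y: "xs = x # us @ [y]" "us \<noteq> []" using xs(2) by auto
  have "C = insert {y, x} (path_edges xs)"
    using xs(3) y path_edges_snoc[of "x # us" y x] by (simp add: cycle_edges_def)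
  moreover have "{y, x} \<notin> path_edges xs"
  proof -
    obtain w us' where w: "us = w # us'" using y(2) by (cases us) auto
    then have "x \<notin> \<Union>(path_edges (w # us' @ [y]))"
      using Union_path_edges_subset[of "w # us' @ [y]"] xs(1) y by auto
    then show ?thesis using y w xs(1) by (auto simp: doubleton_eq_iff)
  qed
  ultimately have c: "card C = length xs" using card_path_edges[OF xs(1)] xs(2) by simp
  then show "card C \<ge> 3" using xs(2) by simp
  then show "finite C" using card.infinite by fastforce
  show "card (\<Union>C) = card C" using c xs Union_cycle_edges[of xs] by (simp add: distinct_card)
qed

section \<open>A maximal ear complex in a minimal lobe\<close>

context fgraph
begin

text \<open>On a longest path in \<open>L\<close>, all neighbours in \<open>L\<close> of the first
  vertex lie on the path. One of them differs from the second vertex and closes a cycle.\<close>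

lemma cycle_in_dense_set:
  assumes "L \<noteq> {}" "L \<subseteq> V" "\<And>x. x \<in> L \<Longrightarrow> card (nbrs E x \<inter> L) \<ge> 2"
  obtains C where "is_cycle C" "C \<subseteq> E" "\<Union>C \<subseteq> L"
proof -
  define P where "P = (\<lambda>xs. xs \<noteq> [] \<and> distinct xs \<and> set xs \<subseteq> L \<and> path_edges xs \<subseteq> E)"
  have finL: "finite L" using assms(2) finV by (rule finite_subset)
  have "length xs < Suc (card L)" if "P xs" for xs
    using that card_mono[OF finL, of "set xs"] by (auto simp: P_def distinct_card less_Suc_eq_le)
  moreover obtain x0 where "x0 \<in> L" using assms(1) by blast
  then have "P [x0]" by (auto simp: P_def)
  ultimately obtain xs where xs: "P xs" and max: "\<And>ys. P ys \<Longrightarrow> length ys \<le> length xs"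
    using ex_has_greatest_nat[of P "[x0]" length "Suc (card L)"] by (metis less_imp_le_nat)
  obtain x ys where xy: "xs = x # ys" using xs by (cases xs) (auto simp: P_def)
  have "x \<in> L" using xs xy by (auto simp: P_def)
  have nb: "nbrs E x \<inter> L \<subseteq> set ys"
  proof
    fix y assume y: "y \<in> nbrs E x \<inter> L"
    show "y \<in> set ys"
    proof (rule ccontr)
      assume "y \<notin> set ys"
      moreover have "y \<noteq> x" using y nbrs_subset by blast
      ultimately have "P (y # xs)" using xs xy y by (auto simp: P_def nbrs_def insert_commute)
      then show False using max by fastforce
    qed
  qed
  have "\<exists>y \<in> nbrs E x \<inter> L. y \<noteq> hd ys"
  proof (rule ccontr)
    assume "\<not> ?thesis"
    then have "nbrs E x \<inter> L \<subseteq> {hd ys}" by auto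
    then have "card (nbrs E x \<inter> L) \<le> card {hd ys}" by (intro card_mono) auto
    then show False using assms(3)[OF \<open>x \<in> L\<close>] by simp
  qed
  then obtain y where y: "y \<in> nbrs E x" "y \<in> L" "y \<noteq> hd ys" by auto
  then have "y \<in> set ys" using nb by blast
  then obtain us vs where uv: "ys = us @ y # vs" by (meson split_list)
  have "us \<noteq> []" using uv y by (cases us) auto
  define zs where "zs = x # us @ [y]"
  have "path_edges zs \<subseteq> E"
    using xs xy uv path_edges_append[of "x # us" y vs] by (auto simp: P_def zs_def)
  moreover have "cycle_edges zs = insert {y, x} (path_edges zs)"
    using path_edges_snoc[of "x # us" y x] by (simp add: cycle_edges_def zs_def)
  ultimately have "cycle_edges zs \<subseteq> E" using y by (auto simp: nbrs_def insert_commute)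
  moreover have "is_cycle (cycle_edges zs)"
    unfolding is_cycle_def using xs xy uv \<open>us \<noteq> []\<close>
    by (intro exI[of _ zs]) (auto simp: zs_def P_def Suc_le_eq)
  moreover have "\<Union>(cycle_edges zs) \<subseteq> L"
    using Union_cycle_edges[of zs] xs xy uv by (auto simp: zs_def P_def)
  ultimately show ?thesis by (intro that[of "cycle_edges zs"])
qed

lemma path_from_rtrancl:
  assumes "(x, y) \<in> {(x, y). x \<in> M \<and> y \<in> M \<and> {x, y} \<in> E}\<^sup>*" "x \<in> M"
  shows "\<exists>r. r \<noteq> [] \<and> distinct r \<and> hd r = x \<and> last r = y \<and> set r \<subseteq> M \<and> path_edges r \<subseteq> E"
  using assms
proof (induction rule: rtrancl_induct)
  case base
  then show ?case by (intro exI[of _ "[x]"]) auto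
next
  case (step y w)
  then obtain r where r: "r \<noteq> []" "distinct r" "hd r = x" "last r = y" "set r \<subseteq> M" "path_edges r \<subseteq> E" by blast
  show ?case
  proof (cases "w \<in> set r")
    case True
    then obtain us vs where uv: "r = us @ w # vs" by (meson split_list)
    have "path_edges (us @ [w]) \<subseteq> E" using r(6) uv path_edges_append[of us w vs] by auto
    then show ?thesis using r uv by (intro exI[of _ "us @ [w]"]) (auto simp: hd_append)
  next
    case False
    obtain us where us: "r = us @ [y]" using r(1,4) by (metis append_butlast_last_id)
    then have "path_edges (r @ [w]) \<subseteq> E" using r(6) step path_edges_snoc[of us y w] by auto
    then show ?thesis using r False step by (intro exI[of _ "r @ [w]"]) auto
  qed
qed

text \<open>A set attached to the rest of the graph in at most one vertex \<open>z\<close>; a minimal one spans a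
  leaf block.\<close>

definition lobe :: "'a set \<Rightarrow> 'a \<Rightarrow> bool" where
  "lobe L z \<longleftrightarrow> L \<noteq> {} \<and> L \<subseteq> V \<and> (\<forall>x\<in>L. nbrs E x \<subseteq> insert z L)"

end

context drawing
begin

text \<open>Take a smallest lobe \<open>L\<close> and a maximal \<open>good\<close> set
  \<open>S\<close> on \<open>insert z L\<close>. Since no ear can be added, a connected piece of the
  uncovered vertices \<open>M\<close> is attached to \<open>S\<close> in at most one vertex. A piece
  avoiding \<open>z\<close> would be a smaller lobe. If \<open>z\<close> is uncovered, then all of
  \<open>M\<close> is one piece, and the covered vertices without the attachment vertex would be a
  smaller lobe. So everything is covered, and a missing edge would be an ear.\<close>

lemma leaf_block:
  assumes "V \<noteq> {}" and deg: "\<And>v. v \<in> V \<Longrightarrow> card (nbrs E v) \<ge> 3"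
  obtains S F z where "S \<subseteq> E" "sphere_complex S F" "z \<in> \<Union>S"
    "\<And>v x. v \<in> \<Union>S - {z} \<Longrightarrow> {v, x} \<in> E \<Longrightarrow> {v, x} \<in> S"
proof -
  obtain z0 where "z0 \<in> V" using assms(1) by blast
  then have "lobe V z0" using nbrs_subset by (auto simp: lobe_def)
  then have "\<exists>Lz. (\<lambda>(L, z). lobe L z) Lz" by auto
  from ex_has_least_nat[of "\<lambda>(L, z). lobe L z" _ "\<lambda>(L, z). card L"] this
  obtain L z where L: "lobe L z" and min: "\<And>L' z'. lobe L' z' \<Longrightarrow> card L \<le> card L'"
    by (metis (mono_tags, lifting) case_prodE case_prod_conv)
  have LV: "L \<subseteq> V" "L \<noteq> {}" and finL: "finite L" using L finV finite_subset by (auto simp: lobe_def)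
  have nbL: "nbrs E x \<subseteq> insert z L" if "x \<in> L" for x using L that by (auto simp: lobe_def)
  have "card (nbrs E x \<inter> L) \<ge> 2" if "x \<in> L" for x
  proof -
    have "nbrs E x \<subseteq> insert z (nbrs E x \<inter> L)" using nbL[OF that] by blast
    then have "card (nbrs E x) \<le> card (insert z (nbrs E x \<inter> L))" by (intro card_mono) auto
    also have "\<dots> \<le> Suc (card (nbrs E x \<inter> L))" by (simp add: card_insert_if)
    finally show ?thesis using deg[of x] that LV by auto
  qed
  then obtain C where C: "is_cycle C" "C \<subseteq> E" "\<Union>C \<subseteq> L" using cycle_in_dense_set LV by metis
  define G where "G = {S. good S \<and> \<Union>S \<subseteq> insert z L}"
  have "G \<subseteq> Pow E" by (auto simp: G_def good_def)
  then have "finite G" using finE by (meson finite_Pow_iff finite_subset)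
  moreover have "C \<in> G" using C by (auto simp: G_def good_def)
  ultimately obtain S where S: "S \<in> G" "C \<subseteq> S" and maxS: "\<And>T. T \<in> G \<Longrightarrow> S \<subseteq> T \<Longrightarrow> S = T"
    using finite_has_maximal2[of G C] by metis
  define U where "U = \<Union>S"
  define M where "M = insert z L - U"
  have SE: "S \<subseteq> E" "good S" "U \<subseteq> insert z L" using S by (auto simp: G_def good_def U_def)
  have no_ear: False if ear: "distinct (a # r @ [b])" "path_edges (a # r @ [b]) \<subseteq> E" "set r \<subseteq> M" "a \<in> U" "b \<in> U"
    "r = [] \<Longrightarrow> {a, b} \<notin> S" for a r b
  proof -
    have "path_edges (a # r @ [b]) \<inter> S = {}"
    proof (cases "r = []")
      case False
      then obtain x r' where r: "r = x # r'" by (cases r) auto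
      have "e \<inter> set r \<noteq> {}" if "e \<in> path_edges (a # r @ [b])" for e
      proof -
        have "e \<in> path_edges (a # xs @ [b]) \<Longrightarrow> xs \<noteq> [] \<Longrightarrow> e \<inter> set xs \<noteq> {}" for a xs
          by (induction xs arbitrary: a) (auto simp: neq_Nil_conv, metis insertI1 list.simps(15) path_edges.simps(1) insertE disjoint_iff append_Nil path_edges.simps(3) empty_iff neq_Nil_conv append_Cons)
        then show ?thesis using that False by blast
      qed
      then show ?thesis using ear(3) by (force simp: M_def U_def)
    qed (use ear(6) in auto)
    then have "good (S \<union> path_edges (a # r @ [b]))"
      using ear SE by (intro good_ear) (auto simp: U_def M_def)
    moreover have "\<Union>(path_edges (a # r @ [b])) \<subseteq> insert z L"
      using Union_path_edges_subset[of "a # r @ [b]"] ear(3-5) SE(3) by (auto simp: M_def)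
    ultimately have "S \<union> path_edges (a # r @ [b]) \<in> G" using SE by (auto simp: G_def U_def)
    then have "path_edges (a # r @ [b]) \<subseteq> S" using maxS[of "S \<union> path_edges (a # r @ [b])"] by auto
    with \<open>path_edges (a # r @ [b]) \<inter> S = {}\<close> have "path_edges (a # r @ [b]) = {}" by auto
    then show False using length_ear_edges[OF ear(1)] by simp
  qed
  define R where "R = {(x, y). x \<in> M \<and> y \<in> M \<and> {x, y} \<in> E}"
  have attach: "a = b" if att: "x \<in> M" "(x, y) \<in> R\<^sup>*" "{a, x} \<in> E" "{y, b} \<in> E" "a \<in> U" "b \<in> U" for a b x y
  proof (rule ccontr)
    assume "a \<noteq> b"
    obtain r where r: "r \<noteq> []" "distinct r" "hd r = x" "last r = y" "set r \<subseteq> M" "path_edges r \<subseteq> E"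
      using path_from_rtrancl[of x y M] att(1,2) by (auto simp: R_def)
    obtain us where us: "r = us @ [y]" using r(1,4) by (metis append_butlast_last_id)
    obtain vs where vs: "r = x # vs" using r(1,3) by (metis list.collapse)
    have "path_edges (r @ [b]) \<subseteq> E" using us r(6) that(4) path_edges_snoc[of us y b] by auto
    then have "path_edges (a # r @ [b]) \<subseteq> E" using vs that(3) by simp
    then show False using r that(5,6) \<open>a \<noteq> b\<close> by (intro no_ear[of a r b]) (auto simp: M_def)
  qed
  have symR: "(y, x) \<in> R\<^sup>*" if "(x, y) \<in> R\<^sup>*" for x y
  proof -
    have "sym R" by (auto simp: sym_def R_def insert_commute)
    then show ?thesis using that by (meson sym_rtrancl symD)
  qed
  have UC: "\<Union>C \<subseteq> U" using S(2) by (auto simp: U_def)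
  have "\<Union>C \<noteq> {}" using cycle_card[OF C(1)] by fastforce
  then obtain u0 where u0: "u0 \<in> U" "u0 \<in> L" using UC C(3) by blast
  have toz: "(y, z) \<in> R\<^sup>*" if y: "y \<in> M" for y
  proof (rule ccontr)
    assume nz: "(y, z) \<notin> R\<^sup>*"
    define K where "K = {x. (y, x) \<in> R\<^sup>*}"
    have KM: "K \<subseteq> M"
    proof
      fix x assume "x \<in> K"
      then have "(y, x) \<in> R\<^sup>*" by (simp add: K_def)
      then show "x \<in> M" by (induction rule: rtrancl_induct) (use y in \<open>auto simp: R_def\<close>)
    qed
    have KL: "K \<subseteq> L" using KM nz by (auto simp: K_def M_def)
    have "\<exists>a. \<forall>x\<in>K. nbrs E x \<subseteq> insert a K"
    proof -
      have step: "w \<in> U \<or> w \<in> K" if "x \<in> K" "w \<in> nbrs E x" for x w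
      proof (cases "w \<in> U")
        case False
        then have "w \<in> M" using nbL[of x] that KL by (auto simp: M_def)
        then have "(x, w) \<in> R" using that KM by (auto simp: R_def nbrs_def)
        then show ?thesis using that(1) by (auto simp: K_def intro: rtrancl_into_rtrancl)
      qed simp
      show ?thesis
      proof (cases "\<exists>x\<in>K. \<exists>a\<in>nbrs E x. a \<in> U")
        case True
        then obtain x a where xa: "x \<in> K" "a \<in> nbrs E x" "a \<in> U" by blast
        have "w = a" if "x' \<in> K" "w \<in> nbrs E x'" "w \<in> U" for x' w
        proof -
          have "(x', x) \<in> R\<^sup>*" using that(1) xa(1) symR by (auto simp: K_def intro: rtrancl_trans)
          then show ?thesis using attach[of x' x w a] that xa KM by (auto simp: nbrs_def insert_commute)
        qed
        then show ?thesis using step by blast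
      next
        case False
        then show ?thesis using step by blast
      qed
    qed
    then obtain a where "\<forall>x\<in>K. nbrs E x \<subseteq> insert a K" by blast
    moreover have "y \<in> K" by (simp add: K_def)
    ultimately have "lobe K a" using KL LV by (auto simp: lobe_def)
    then have "card L \<le> card K" by (rule min)
    moreover have "u0 \<notin> K" using KM u0 by (auto simp: M_def)
    then have "K \<subset> L" using KL u0 by blast
    then have "card K < card L" using finL by (rule psubset_card_mono[rotated])
    ultimately show False by simp
  qed
  have "M = {}"
  proof (rule ccontr)
    assume "M \<noteq> {}"
    have zM: "z \<in> M"
    proof -
      obtain y where y: "y \<in> M" using \<open>M \<noteq> {}\<close> by blast
      from toz[OF y] show ?thesis by (induction rule: rtrancl_induct) (use y in \<open>auto simp: R_def\<close>)
    qed
    then have UL: "U \<subseteq> L" using SE(3) by (auto simp: M_def)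
    have "\<exists>a\<in>U. \<forall>x\<in>U. \<forall>w\<in>nbrs E x. w \<in> M \<longrightarrow> x = a"
    proof (cases "\<exists>x\<in>U. \<exists>w\<in>nbrs E x. w \<in> M")
      case True
      then obtain a w where a: "a \<in> U" "w \<in> nbrs E a" "w \<in> M" by blast
      have "x = a" if "x \<in> U" "w' \<in> nbrs E x" "w' \<in> M" for x w'
      proof -
        have "(w', w) \<in> R\<^sup>*" using toz[OF that(3)] symR[OF toz[OF a(3)]] by (rule rtrancl_trans)
        then show ?thesis using attach[of w' w x a] that a by (auto simp: nbrs_def insert_commute)
      qed
      then show ?thesis using a(1) by blast
    qed (use u0 in blast)
    then obtain a where a: "a \<in> U" "\<forall>x\<in>U. \<forall>w\<in>nbrs E x. w \<in> M \<longrightarrow> x = a" by (elim bexE)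
    have "U - {a} \<noteq> {}"
    proof
      assume "U - {a} = {}"
      then have "\<Union>C \<subseteq> {a}" using UC by blast
      then have "card (\<Union>C) \<le> card {a}" by (intro card_mono) auto
      then show False using cycle_card[OF C(1)] by simp
    qed
    moreover have "nbrs E x \<subseteq> insert a (U - {a})" if "x \<in> U - {a}" for x
    proof
      fix w assume w: "w \<in> nbrs E x"
      have x: "x \<in> U" "x \<noteq> a" using that by simp_all
      have "w \<in> U"
      proof (rule ccontr)
        assume "w \<notin> U"
        then have "w \<in> M" using w nbL[of x] x(1) UL by (auto simp: M_def)
        then show False using a(2)[THEN bspec, OF x(1), THEN bspec, OF w] x(2) by simp
      qed
      then show "w \<in> insert a (U - {a})" by simp
    qed
    ultimately have "lobe (U - {a}) a" unfolding lobe_def using UL LV(1) by blast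
    then have "card L \<le> card (U - {a})" by (rule min)
    moreover have "U - {a} \<subset> L" using UL a by blast
    then have "card (U - {a}) < card L" using finL by (rule psubset_card_mono[rotated])
    ultimately show False by simp
  qed
  then have UzL: "U = insert z L" using SE(3) by (auto simp: M_def)
  have full: "{v, x} \<in> S" if "v \<in> U - {z}" "{v, x} \<in> E" for v x
  proof (rule ccontr)
    assume "{v, x} \<notin> S"
    moreover have "x \<in> U" using nbL[of v] that UzL by (auto simp: nbrs_def)
    moreover have "v \<noteq> x" using edgeD[OF that(2)] by simp
    ultimately show False using no_ear[of v "[]" x] that by auto
  qed
  \<comment> \<open>By \<open>full\<close>, a vertex other than \<open>z\<close> on a bare cycle
    would have degree at most 2 in the whole graph.\<close>
  have "\<not> is_cycle S"
  proof
    assume cyc: "is_cycle S"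
    have "u0 \<in> U" "u0 \<in> L" by fact+
    obtain v where v: "v \<in> U" "v \<noteq> z"
    proof -
      have "\<not> U \<subseteq> {z}"
      proof
        assume "U \<subseteq> {z}"
        then have "card U \<le> card {z}" by (intro card_mono) auto
        then show False using cycle_card[OF cyc] by (simp add: U_def)
      qed
      then show thesis using that by blast
    qed
    obtain x y where xy: "{e \<in> S. v \<in> e} = {{v, x}, {v, y}}"
      using cycle_edges_at[OF cyc] v by (metis U_def)
    have "nbrs E v \<subseteq> {x, y}"
    proof
      fix w assume "w \<in> nbrs E v"
      then have "{v, w} \<in> E" by (simp add: nbrs_def)
      then have "{v, w} \<in> {e \<in> S. v \<in> e}" using full[of v w] v by simp
      then have "{v, w} \<in> {{v, x}, {v, y}}" unfolding xy .
      then show "w \<in> {x, y}" by (auto simp: doubleton_eq_iff)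
    qed
    then have "card (nbrs E v) \<le> card {x, y}" by (intro card_mono) auto
    also have "\<dots> \<le> 2" by (simp add: card_insert_if)
    finally have "card (nbrs E v) \<le> 2" .
    moreover obtain e where "e \<in> S" "v \<in> e" using v(1) unfolding U_def by (elim UnionE)
    then have "v \<in> V" using SE(1) edge_subset by (meson subsetD)
    ultimately show False using deg[of v] by simp
  qed
  then obtain F where "sphere_complex S F" using SE(2) by (auto simp: good_def)
  moreover have "z \<in> \<Union>S" using UzL by (simp add: U_def)
  ultimately show ?thesis using full unfolding U_def by (intro that[OF SE(1)])
qed

end

text \<open>The block \<open>S\<close> is attached to the rest of the graph only at \<open>z\<close>, so its degrees \<open>d\<close> are the degrees
  in the whole graph except at \<open>z\<close>.\<close>

locale block = fgraph V E for V :: "'a set" and E :: "'a set set" +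
  fixes S :: "'a set set" and F :: "'a set set set" and z :: 'a
  assumes SE: "S \<subseteq> E" and cplx: "sphere_complex S F"
    and full: "v \<in> \<Union>S - {z} \<Longrightarrow> {v, x} \<in> E \<Longrightarrow> {v, x} \<in> S"
    and min3: "v \<in> \<Union>S - {z} \<Longrightarrow> card (nbrs E v) \<ge> 3"
    and large_bondage: "\<not> independent_bondage_number V E \<le> 8"
begin

definition d :: "'a \<Rightarrow> nat" where "d v = card (nbrs S v)"

lemma edgeS: "{x, y} \<in> S \<Longrightarrow> x \<noteq> y \<and> x \<in> \<Union>S \<and> y \<in> \<Union>S"
  using SE edgeD by blast

lemma nbrs_S: "v \<in> \<Union>S - {z} \<Longrightarrow> nbrs E v = nbrs S v"
  using SE full unfolding nbrs_def by blast

lemma degree_d: "v \<in> \<Union>S - {z} \<Longrightarrow> vertex_degree E v = d v"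
  by (simp add: degree_eq_card_nbrs nbrs_S d_def)

lemma finS [simp]: "finite S" using SE finE by (rule finite_subset)

lemma finU [simp]: "finite (\<Union>S)"
proof -
  have "\<Union>S \<subseteq> V" using SE simple unfolding simple_graph_def by blast
  then show ?thesis using finV by (rule finite_subset)
qed

lemma finF [simp]: "finite F"
proof -
  have "F \<subseteq> Pow S" using cplx by (auto simp: sphere_complex_def)
  then show ?thesis by (rule finite_subset) simp
qed

lemma fin_nbrs_S [simp]: "finite (nbrs S v)"
proof -
  have "nbrs S v \<subseteq> nbrs E v" using SE by (auto simp: nbrs_def)
  then show ?thesis by (rule finite_subset) simp
qed

lemma face_cycle: "f \<in> F \<Longrightarrow> is_cycle f" and face_sub: "f \<in> F \<Longrightarrow> f \<subseteq> S"
  using cplx by (auto simp: sphere_complex_def)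

lemma fin_face [simp]: "f \<in> F \<Longrightarrow> finite f"
  using face_cycle cycle_card(3) by blast

lemma face_nbrs:
  assumes "f \<in> F" "v \<in> \<Union>f"
  shows "card (nbrs f v) = 2"
proof -
  obtain x y where xy: "x \<noteq> y" "v \<noteq> x" "v \<noteq> y" "{e \<in> f. v \<in> e} = {{v, x}, {v, y}}"
    using cycle_edges_at[OF face_cycle[OF assms(1)] assms(2)] .
  have "w \<in> nbrs f v \<longleftrightarrow> w \<in> {x, y}" for w
  proof -
    have "w \<in> nbrs f v \<longleftrightarrow> {v, w} \<in> {e \<in> f. v \<in> e}" by (simp add: nbrs_def)
    then show ?thesis unfolding xy(4) by (auto simp: doubleton_eq_iff)
  qed
  then have "nbrs f v = {x, y}" by blast
  then show ?thesis using xy by simp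
qed

lemma face_nbrs_eq:
  assumes "f \<in> F" "{v, x} \<in> f" "{v, y} \<in> f" "x \<noteq> y"
  shows "nbrs f v = {x, y}"
proof -
  have "card (nbrs f v) = 2" using assms by (intro face_nbrs) auto
  moreover have "{x, y} \<subseteq> nbrs f v" using assms by (auto simp: nbrs_def)
  ultimately show ?thesis
    using assms(4) by (metis card_2_iff card_subset_eq card.infinite zero_neq_numeral)
qed

lemma partner:
  assumes "f \<in> F" "{v, x} \<in> f"
  obtains y where "y \<noteq> x" "{v, y} \<in> f" "nbrs f v = {x, y}"
proof -
  have "card (nbrs f v) = 2" using assms by (intro face_nbrs) auto
  then obtain a b where "nbrs f v = {a, b}" "a \<noteq> b" by (meson card_2_iff)
  moreover have "x \<in> nbrs f v" using assms by (simp add: nbrs_def)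
  ultimately have "\<exists>y. y \<noteq> x \<and> y \<in> nbrs f v" by auto
  then obtain y where y: "y \<noteq> x" "y \<in> nbrs f v" by blast
  then have "{v, y} \<in> f" by (simp add: nbrs_def)
  then show ?thesis using face_nbrs_eq[OF assms, of y] y by (intro that[of y]) auto
qed

lemma edge_faces:
  assumes "e \<in> S"
  obtains f g where "f \<noteq> g" "f \<in> F" "g \<in> F" "{h \<in> F. e \<in> h} = {f, g}"
proof -
  have "card {h \<in> F. e \<in> h} = 2" using assms cplx by (simp add: sphere_complex_def)
  then obtain f g where "{h \<in> F. e \<in> h} = {f, g}" "f \<noteq> g" by (meson card_2_iff)
  moreover from this have "f \<in> F" "g \<in> F" by blast+
  ultimately show ?thesis by (intro that)
qed

lemma card_edge_faces: "e \<in> S \<Longrightarrow> card {h \<in> F. e \<in> h} = 2"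
  using cplx by (simp add: sphere_complex_def)

lemma edge_face: "e \<in> S \<Longrightarrow> \<exists>f\<in>F. e \<in> f"
  using card_edge_faces[of e] by (cases "{h \<in> F. e \<in> h} = {}") auto

definition tri :: "'a set set \<Rightarrow> bool" where "tri f \<longleftrightarrow> card f = 3"

lemma tri_third:
  assumes "f \<in> F" "tri f" "{v, x} \<in> f" "{v, y} \<in> f" "x \<noteq> y"
  shows "f = {{v, x}, {v, y}, {x, y}}" "\<Union>f = {v, x, y}"
proof -
  have vx: "v \<noteq> x" "v \<noteq> y" using assms face_sub edgeS by blast+
  have cyc: "is_cycle f" using face_cycle[OF assms(1)] .
  have "card (\<Union>f) = 3" "finite f" using cycle_card[OF cyc] assms(2) by (auto simp: tri_def)
  moreover have "{v, x, y} \<subseteq> \<Union>f" using assms by auto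
  moreover have "card {v, x, y} = 3" using vx assms(5) by simp
  ultimately show U: "\<Union>f = {v, x, y}" by (metis card_subset_eq card.infinite zero_neq_numeral)
  obtain w where w: "w \<noteq> v" "{x, w} \<in> f" using partner[of f x v] assms by (metis insert_commute)
  moreover have "w \<noteq> x" using w assms(1) face_sub edgeS by blast
  ultimately have "w = y" using U by blast
  then have "{{v, x}, {v, y}, {x, y}} \<subseteq> f" using assms w by auto
  moreover have "card {{v, x}, {v, y}, {x, y}} = 3" using vx assms(5) by (auto simp: doubleton_eq_iff)
  ultimately show "f = {{v, x}, {v, y}, {x, y}}"
    using assms(2) \<open>finite f\<close> by (metis card_subset_eq tri_def)
qed

lemma quad_fourth:
  assumes "f \<in> F" "card f = 4" "{v, x} \<in> f" "{v, y} \<in> f" "x \<noteq> y"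
  obtains p where "\<Union>f = {v, x, y, p}" "p \<notin> {v, x, y}" "nbrs f p = {x, y}" "nbrs f x = {v, p}" "nbrs f y = {v, p}"
proof -
  have vx: "v \<noteq> x" "v \<noteq> y" using assms face_sub edgeS by blast+
  have "card (\<Union>f) = 4" using cycle_card[OF face_cycle[OF assms(1)]] assms(2) by simp
  moreover have "{v, x, y} \<subseteq> \<Union>f" using assms by auto
  moreover have "card {v, x, y} = 3" using vx assms(5) by simp
  ultimately have "card (\<Union>f - {v, x, y}) = 1" by (simp add: card_Diff_subset)
  then obtain p where p: "\<Union>f - {v, x, y} = {p}" by (meson card_1_singletonE)
  have "\<Union>f = {p} \<union> {v, x, y}"
    unfolding p[symmetric] using \<open>{v, x, y} \<subseteq> \<Union>f\<close> by (simp only: Un_Diff_cancel2 Un_absorb2)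
  then have U: "\<Union>f = {v, x, y, p}" by (simp add: insert_commute)
  have "p \<in> \<Union>f - {v, x, y}" unfolding p by simp
  then have U2: "p \<notin> {v, x, y}" by simp
  have c2: "card (nbrs f p) = 2" by (rule face_nbrs[OF assms(1)]) (simp add: U)
  have "nbrs f p \<subseteq> {x, y}"
  proof
    fix w assume w: "w \<in> nbrs f p"
    then have "{p, w} \<in> f" by (simp add: nbrs_def)
    then have "w \<in> {v, x, y, p}" unfolding U[symmetric] by (intro UnionI) auto
    moreover have "{p, w} \<in> S" using \<open>{p, w} \<in> f\<close> face_sub[OF assms(1)] by (rule subsetD[rotated])
    then have "p \<noteq> w" using edgeS by simp
    moreover have "w \<noteq> v"
    proof
      assume "w = v"
      then have "p \<in> nbrs f v" using w nbrs_sym[of p f v] by simp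
      then show False using face_nbrs_eq[OF assms(1,3-5)] U2 by simp
    qed
    ultimately show "w \<in> {x, y}" by auto
  qed
  then have np: "nbrs f p = {x, y}" using c2 assms(5) by (intro card_subset_eq) auto
  then have "{p, x} \<in> f" "{p, y} \<in> f" by (auto simp: nbrs_def)
  then have "nbrs f x = {v, p}" "nbrs f y = {v, p}"
    using U2 assms(1,3,4) by (intro face_nbrs_eq; auto simp: insert_commute)+
  with U U2 np show ?thesis by (intro that[of p])
qed

lemma tri_distinct:
  assumes "f \<in> F" "g \<in> F" "tri f" "tri g" "{v, x} \<in> f" "{v, y} \<in> f" "{v, x} \<in> g" "{v, y} \<in> g" "x \<noteq> y"
  shows "f = g"
  using tri_third(1)[OF assms(1,3,5,6,9)] tri_third(1)[OF assms(2,4,7,8,9)] by simp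

text \<open>This and the next two lemmas are \<open>pair_bound\<close> with 0, 1 and 2 common
  neighbours kept; every kept neighbour saves a deletion and raises the bound by one. The vertex
  \<open>z\<close> is left out because its degree in the graph may exceed
  \<open>d z\<close>.\<close>

lemma light_edge:
  assumes "{u, v} \<in> S" "u \<noteq> z" "v \<noteq> z" shows "d u + d v \<ge> 10"
proof (rule ccontr)
  assume "\<not> ?thesis"
  moreover have "u \<in> \<Union>S - {z}" "v \<in> \<Union>S - {z}" using assms edgeS by blast+
  ultimately show False
    using pair_bound[of u v "{}"] assms SE large_bondage by (auto simp: degree_d)
qed

lemma light_edge_tri:
  assumes "f \<in> F" "tri f" "{u, v} \<in> f" "u \<noteq> z" "v \<noteq> z" shows "d u + d v \<ge> 11"
proof (rule ccontr)
  assume "\<not> ?thesis"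
  moreover have uvS: "{u, v} \<in> S" using assms face_sub by blast
  then have "u \<in> \<Union>S - {z}" "v \<in> \<Union>S - {z}" using assms edgeS by blast+
  moreover obtain c where c: "c \<noteq> v" "{u, c} \<in> f" using partner[OF assms(1,3)] by blast
  then have "{v, c} \<in> f" using tri_third(1)[OF assms(1,2,3) c(2)] by blast
  then have "c \<in> nbrs E u \<inter> nbrs E v" using c assms(1) face_sub SE by (auto simp: nbrs_def)
  ultimately show False
    using pair_bound[of u v "{c}"] SE uvS large_bondage card_mono[of "{c}" "{c} - _"]
    by (auto simp: degree_d card_insert_if intro: le_trans[OF card_mono[of "{c}"]])
qed

text \<open>The last assumption ensures that any further neighbour of \<open>u\<close> dominates
  \<open>c1\<close> or \<open>c2\<close>, so that at most one of the two has to come back in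
  \<open>pair_bound\<close>.\<close>

lemma light_edge_double:
  assumes "{u, v} \<in> S" "u \<noteq> z" "v \<noteq> z" "c1 \<noteq> c2" "{u, c1} \<in> S" "{v, c1} \<in> S" "{u, c2} \<in> S" "{v, c2} \<in> S"
    and "\<And>y. y \<in> nbrs S u - {v, c1, c2} \<Longrightarrow> {y, c1} \<in> S \<or> {y, c2} \<in> S"
  shows "d u + d v \<ge> 12"
proof (rule ccontr)
  assume "\<not> ?thesis"
  moreover have U: "u \<in> \<Union>S - {z}" "v \<in> \<Union>S - {z}" using assms edgeS by blast+
  moreover have "{c1, c2} \<subseteq> nbrs E u \<inter> nbrs E v" using assms SE by (auto simp: nbrs_def)
  moreover have "card ({c1, c2} - nbrs E y) \<le> 1" if "y \<in> nbrs E u - {v} - {c1, c2}" for y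
  proof -
    have "y \<in> nbrs S u - {v, c1, c2}" using that nbrs_S[OF U(1)] by auto
    then have "{c1, c2} - nbrs E y \<subseteq> {c1} \<or> {c1, c2} - nbrs E y \<subseteq> {c2}"
      using assms(9)[of y] SE by (auto simp: nbrs_def)
    then show ?thesis using card_mono[of "{c1}"] card_mono[of "{c2}"] by fastforce
  qed
  ultimately show False
    using pair_bound[of u v "{c1, c2}"] SE assms(1,4) large_bondage by (auto simp: degree_d)
qed

section \<open>Discharging\<close>

definition small :: "'a \<Rightarrow> bool" where
  "small x \<longleftrightarrow> x \<in> \<Union>S \<and> x \<noteq> z \<and> d x \<le> 5"

definition isolated :: "'a set set \<Rightarrow> 'a \<Rightarrow> bool" where
  "isolated f x \<longleftrightarrow> (\<forall>y\<in>nbrs f x. \<not> small y)"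

text \<open>Such a face can afford 20 for \<open>x\<close>: a pentagon has 40 and room for at most
  two isolated small vertices, and a quadrangle with a single small vertex gives all its 20 to
  it.\<close>

definition rich :: "'a set set \<Rightarrow> 'a \<Rightarrow> bool" where
  "rich f x \<longleftrightarrow> \<not> tri f \<and> isolated f x \<and> (card f \<ge> 5 \<or> (\<forall>y\<in>\<Union>f. small y \<longrightarrow> y = x))"

text \<open>A content vertex of degree 5 needs nothing from a quadrangle it shares with an opposite
  small vertex.\<close>

definition content :: "'a \<Rightarrow> bool" where
  "content x \<longleftrightarrow> d x = 5 \<and> ((\<exists>y\<in>nbrs S x. small y) \<or> (\<exists>f\<in>F. x \<in> \<Union>f \<and> rich f x))"

text \<open>All charges are scaled by 10: initially a vertex \<open>v\<close> has \<open>10 d v - 60\<close> and a face \<open>f\<close> has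
  \<open>20 |f| - 60\<close>, hence \<open>-120\<close> altogether by Euler's formula.\<close>

definition face_gift :: "'a set set \<Rightarrow> 'a \<Rightarrow> int" where
  "face_gift f x = (if tri f \<or> x \<notin> \<Union>f \<or> \<not> small x then 0 else if \<not> isolated f x then 5
     else if rich f x then 20 else if content x then 0
     else if \<exists>y\<in>\<Union>f. small y \<and> y \<noteq> x \<and> content y then 20 else 10)"

definition tris_edge :: "'a \<Rightarrow> 'a \<Rightarrow> nat" where
  "tris_edge x v = card {f \<in> F. tri f \<and> {x, v} \<in> f}"

definition tris_at :: "'a \<Rightarrow> nat" where
  "tris_at x = card {f \<in> F. tri f \<and> x \<in> \<Union>f}"

text \<open>The deficits to be covered are 30, 20 and 10 for the degrees 3, 4 and 5. A vertex of
  degree 3 or 4 gets at least 10 from each of its non-triangular faces, and the amounts here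
  complete this: 10 or 5 for an edge between two triangles, 5 for an edge with one triangle,
  \<open>5 * 2\<close> if a vertex of degree 5 has only triangles. A gift of 20 at a vertex of
  degree 3 replaces its takings over edges with one triangle.\<close>

definition take_from :: "'a \<Rightarrow> 'a \<Rightarrow> int" where
  "take_from x v = (if d x = 3 then
       (if tris_edge x v = 2 then 10 else if tris_edge x v = 1 \<and> (\<forall>f\<in>F. face_gift f x \<noteq> 20) then 5 else 0)
     else if d x = 4 then (if tris_edge x v = 2 \<and> tris_at x \<ge> 3 then 5 else 0)
     else if d x = 5 \<and> tris_at x = 5 then 2 else 0)"

definition loss :: "'a \<Rightarrow> int" where
  "loss v = (\<Sum>x\<in>{x \<in> nbrs S v. small x}. take_from x v)"

lemma d_ge3: "v \<in> \<Union>S \<Longrightarrow> v \<noteq> z \<Longrightarrow> d v \<ge> 3"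
  using min3[of v] nbrs_S[of v] by (simp add: d_def)

lemma small_d: "small x \<Longrightarrow> d x = 3 \<or> d x = 4 \<or> d x = 5"
  using d_ge3[of x] by (auto simp: small_def)

text \<open>The sum \<open>5 + 5\<close> just reaches the 10 of \<open>light_edge\<close> and misses
  the 11 of \<open>light_edge_tri\<close>.\<close>

lemma small_adj:
  assumes "{x, y} \<in> S" "small x" "small y"
  shows "d x = 5" "d y = 5" "f \<in> F \<Longrightarrow> {x, y} \<in> f \<Longrightarrow> \<not> tri f"
  using assms light_edge[OF assms(1)] light_edge_tri[of f x y] by (auto simp: small_def)

lemma card_faces_at:
  assumes "v \<in> \<Union>S"
  shows "card {f \<in> F. v \<in> \<Union>f} = d v"
proof -
  have "(\<Sum>f\<in>F. card {x \<in> nbrs S v. {v, x} \<in> f}) = (\<Sum>x\<in>nbrs S v. 2)"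
  proof (rule sum_multicount_gen)
    show "\<forall>x\<in>nbrs S v. card {f \<in> F. {v, x} \<in> f} = 2"
      using card_edge_faces by (simp add: nbrs_def)
  qed simp_all
  moreover have "card {x \<in> nbrs S v. {v, x} \<in> f} = (if v \<in> \<Union>f then 2 else 0)" if f: "f \<in> F" for f
  proof -
    have *: "{x \<in> nbrs S v. {v, x} \<in> f} = nbrs f v" using face_sub[OF f] by (auto simp: nbrs_def)
    show ?thesis
    proof (cases "v \<in> \<Union>f")
      case True
      then show ?thesis using face_nbrs[OF f True] * by simp
    next
      case False
      then have "nbrs f v = {}" by (auto simp: nbrs_def)
      then show ?thesis using * False by simp
    qed
  qed
  ultimately have "(\<Sum>f\<in>F. if v \<in> \<Union>f then 2 else 0) = 2 * d v" by (simp add: d_def)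
  moreover have "(\<Sum>f\<in>F. if v \<in> \<Union>f then 2 else (0::nat)) = 2 * card {f \<in> F. v \<in> \<Union>f}"
    by (simp add: sum.If_cases Int_def)
  ultimately show ?thesis by simp
qed

lemma card_edges_at:
  assumes "f \<in> F" "x \<in> \<Union>f" shows "card {e \<in> f. x \<in> e} = 2"
proof -
  obtain a b where "a \<noteq> b" "{e \<in> f. x \<in> e} = {{x, a}, {x, b}}"
    using cycle_edges_at[OF face_cycle[OF assms(1)] assms(2)] .
  then show ?thesis by (auto simp: doubleton_eq_iff)
qed

lemma sum_d: "(\<Sum>v\<in>\<Union>S. d v) = 2 * card S"
proof -
  interpret FS: fgraph V S using finV simple SE by unfold_locales (auto simp: simple_graph_def)
  have "(\<Sum>v\<in>\<Union>S. card {e \<in> S. v \<in> e}) = (\<Sum>e\<in>S. 2)"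
  proof (rule sum_multicount_gen)
    show "\<forall>e\<in>S. card {v \<in> \<Union>S. v \<in> e} = 2"
    proof
      fix e assume "e \<in> S"
      then have "{v \<in> \<Union>S. v \<in> e} = e" "card e = 2" using FS.simple by (auto simp: simple_graph_def)
      then show "card {v \<in> \<Union>S. v \<in> e} = 2" by simp
    qed
  qed auto
  moreover have "card {e \<in> S. v \<in> e} = d v" for v
    using FS.degree_eq_card_nbrs[of v] by (simp add: d_def vertex_degree_def)
  ultimately show ?thesis by simp
qed

lemma sum_faces: "(\<Sum>f\<in>F. card f) = 2 * card S"
proof -
  have "(\<Sum>f\<in>F. card {e \<in> S. e \<in> f}) = (\<Sum>e\<in>S. 2)"
    by (rule sum_multicount_gen) (auto simp: card_edge_faces)
  moreover have "{e \<in> S. e \<in> f} = f" if "f \<in> F" for f using face_sub[OF that] by auto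
  ultimately show ?thesis by simp
qed

lemma total_charge:
  "(\<Sum>v\<in>\<Union>S. 10 * int (d v) - 60) + (\<Sum>f\<in>F. 20 * int (card f) - 60) = -120"
proof -
  have "(\<Sum>v\<in>\<Union>S. 10 * int (d v) - 60) = 10 * int (2 * card S) - 60 * int (card (\<Union>S))"
    unfolding sum_d[symmetric] by (simp add: sum_subtractf sum_distrib_left)
  moreover have "(\<Sum>f\<in>F. 20 * int (card f) - 60) = 20 * int (2 * card S) - 60 * int (card F)"
    unfolding sum_faces[symmetric] by (simp add: sum_subtractf sum_distrib_left)
  moreover have "card F + card (\<Union>S) = card S + 2" using cplx by (simp add: sphere_complex_def)
  ultimately show ?thesis by linarith
qed

text \<open>Summing over the edges of the cycle counts every vertex twice.\<close>

lemma sum_weights_le: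
  fixes h :: "'a \<Rightarrow> int"
  assumes f: "f \<in> F" and h: "\<And>x y. {x, y} \<in> f \<Longrightarrow> h x + h y \<le> 2"
  shows "(\<Sum>x\<in>\<Union>f. h x) \<le> int (card f)"
proof -
  have "\<Union>f \<subseteq> \<Union>S" using face_sub[OF f] by blast
  then have fin: "finite (\<Union>f)" by (rule finite_subset) simp
  have "(\<Sum>x\<in>\<Union>f. \<Sum>e\<in>{e \<in> f. x \<in> e}. h x) = (\<Sum>e\<in>f. \<Sum>x\<in>{x \<in> \<Union>f. x \<in> e}. h x)"
    using f fin by (intro sum.swap_restrict) auto
  also have "\<dots> \<le> (\<Sum>e\<in>f. 2)"
  proof (rule sum_mono)
    fix e assume e: "e \<in> f"
    then have "e \<in> E" using face_sub[OF f] SE by blast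
    then obtain x y where xy: "e = {x, y}" "x \<noteq> y" by (rule edgeE)
    moreover have "{x \<in> \<Union>f. x \<in> e} = e" using e by auto
    ultimately show "(\<Sum>x\<in>{x \<in> \<Union>f. x \<in> e}. h x) \<le> 2" using h[of x y] e by simp
  qed
  finally have "(\<Sum>x\<in>\<Union>f. \<Sum>e\<in>{e \<in> f. x \<in> e}. h x) \<le> 2 * int (card f)" by simp
  moreover have "(\<Sum>x\<in>\<Union>f. \<Sum>e\<in>{e \<in> f. x \<in> e}. h x) = (\<Sum>x\<in>\<Union>f. 2 * h x)"
    by (intro sum.cong) (simp_all add: card_edges_at[OF f])
  ultimately show ?thesis by (simp add: sum_distrib_left[symmetric])
qed

lemma isolated_no_small: "isolated f x \<Longrightarrow> {x, y} \<in> f \<Longrightarrow> \<not> small y"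
  by (simp add: isolated_def nbrs_def)

text \<open>With weight 2 for isolated and 1 for other small vertices, no edge of \<open>f\<close>
  has weight above 2, so the gifts are at most \<open>10 * card f - 5 * card J\<close>. This
  suffices from length 6 on. For a pentagon either \<open>J\<close> has at least two elements, or at
  most two vertices receive anything. Quadrangles are treated directly.\<close>

lemma face_bound:
  assumes f: "f \<in> F"
  shows "(\<Sum>x\<in>\<Union>f. face_gift f x) \<le> 20 * int (card f) - 60"
proof (cases "tri f")
  case True
  then show ?thesis by (simp add: face_gift_def tri_def)
next
  case nt: False
  have "\<Union>f \<subseteq> \<Union>S" using face_sub[OF f] by blast
  then have fin: "finite (\<Union>f)" by (rule finite_subset) simp
  have k4: "card f \<ge> 4" using nt cycle_card(2)[OF face_cycle[OF f]] by (simp add: tri_def)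
  define h :: "'a \<Rightarrow> int" where "h = (\<lambda>x. if small x then if isolated f x then 2 else 1 else 0)"
  have hsum: "(\<Sum>x\<in>\<Union>f. h x) \<le> int (card f)"
  proof (rule sum_weights_le[OF f])
    fix x y assume xy: "{x, y} \<in> f"
    then show "h x + h y \<le> 2"
      using isolated_no_small[of f x y] isolated_no_small[of f y x] by (auto simp: h_def insert_commute)
  qed
  define J where "J = {x \<in> \<Union>f. small x \<and> \<not> isolated f x}"
  have finJ: "finite J" by (rule finite_subset[OF _ fin]) (auto simp: J_def)
  have gift_J: "face_gift f x = 5" if "x \<in> J" for x using that nt by (simp add: J_def face_gift_def)
  have gift0: "face_gift f x = 0" if "\<not> small x" for x using that by (simp add: face_gift_def)
  have gift20: "face_gift f x \<le> 20" for x by (simp add: face_gift_def)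
  have J2: "card J \<ge> 2" if "J \<noteq> {}"
  proof -
    obtain x where x: "x \<in> J" using \<open>J \<noteq> {}\<close> by blast
    then obtain y where y: "{x, y} \<in> f" "small y" by (auto simp: J_def isolated_def nbrs_def)
    then have "{y, x} \<in> f" by (simp add: insert_commute)
    then have "y \<in> J" using y x unfolding J_def by (auto dest: isolated_no_small)
    moreover have "x \<noteq> y" using y(1) face_sub[OF f] edgeS by blast
    ultimately have "card {x, y} \<le> card J" using x finJ by (intro card_mono) auto
    then show ?thesis using \<open>x \<noteq> y\<close> by simp
  qed
  have sum10: "(\<Sum>x\<in>\<Union>f. face_gift f x) \<le> 10 * (\<Sum>x\<in>\<Union>f. h x) - 5 * int (card J)"
  proof -
    have "(\<Sum>x\<in>\<Union>f. face_gift f x) \<le> (\<Sum>x\<in>\<Union>f. 10 * h x - (if x \<in> J then 5 else 0))"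
    proof (rule sum_mono)
      fix x assume "x \<in> \<Union>f"
      then show "face_gift f x \<le> 10 * h x - (if x \<in> J then 5 else 0)"
        using gift_J[of x] gift0[of x] gift20[of x] by (auto simp: h_def J_def)
    qed
    also have "\<dots> = 10 * (\<Sum>x\<in>\<Union>f. h x) - (\<Sum>x\<in>\<Union>f. if x \<in> J then 5 else 0)"
      by (simp add: sum_subtractf sum_distrib_left)
    also have "(\<Sum>x\<in>\<Union>f. if x \<in> J then 5 else (0::int)) = 5 * int (card J)"
    proof -
      have "\<Union>f \<inter> {x. x \<in> J} = J" by (auto simp: J_def)
      then show ?thesis using fin by (simp add: sum.If_cases)
    qed
    finally show ?thesis .
  qed
  consider "card f \<ge> 6" | "card f = 5" "J \<noteq> {}" | "card f = 5" "J = {}" | "card f = 4" using k4 by linarith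
  then show ?thesis
  proof cases
    case 1 then show ?thesis using sum10 hsum by linarith
  next
    case 2 then show ?thesis using sum10 hsum J2 by linarith
  next
    case 3
    have "(\<Sum>x\<in>\<Union>f. h x) = 2 * int (card {x \<in> \<Union>f. small x})"
    proof -
      have "(\<Sum>x\<in>\<Union>f. h x) = (\<Sum>x\<in>\<Union>f. if small x then 2 else 0)"
        using 3(2) by (intro sum.cong) (auto simp: h_def J_def)
      then show ?thesis using fin by (simp add: sum.If_cases Int_def)
    qed
    moreover define c where "c = int (card {x \<in> \<Union>f. small x})"
    ultimately have "2 * c \<le> 5" "(\<Sum>x\<in>\<Union>f. face_gift f x) \<le> 20 * c" using sum10 hsum 3 by simp_all
    then show ?thesis using 3(1) by presburger
  next
    case 4
    have "(\<Sum>x\<in>\<Union>f. face_gift f x) \<le> 20"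
    proof (cases "\<exists>x\<in>\<Union>f. small x \<and> isolated f x")
      case False
      then have "face_gift f x \<le> 5" if "x \<in> \<Union>f" for x using that by (auto simp: face_gift_def)
      then have "(\<Sum>x\<in>\<Union>f. face_gift f x) \<le> (\<Sum>x\<in>\<Union>f. 5)" by (intro sum_mono)
      also have "\<dots> = 20" using cycle_card(1)[OF face_cycle[OF f]] 4 by simp
      finally show ?thesis .
    next
      case True
      then obtain x where x: "x \<in> \<Union>f" "small x" "isolated f x" by blast
      then obtain a where a: "{x, a} \<in> f"
      proof -
        have "nbrs f x \<noteq> {}" using face_nbrs[OF f x(1)] by auto
        then show thesis using that by (auto simp: nbrs_def)
      qed
      obtain b where b: "b \<noteq> a" "{x, b} \<in> f" using partner[OF f a] by blast
      obtain p where p: "\<Union>f = {x, a, b, p}" "p \<notin> {x, a, b}" "nbrs f p = {a, b}"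
        using quad_fourth[OF f 4 a b(2)] b(1) by metis
      have ab: "\<not> small a" "\<not> small b" using isolated_no_small[OF x(3)] a b by auto
      have "x \<noteq> a" "x \<noteq> b" using a b face_sub[OF f] edgeS by blast+
      then have "(\<Sum>x\<in>\<Union>f. face_gift f x) = face_gift f x + face_gift f p"
        unfolding p(1) using p(2) b(1) gift0[OF ab(1)] gift0[OF ab(2)] by (auto simp: eq_commute[of x p])
      also have "\<dots> \<le> 20"
      proof (cases "small p")
        case False then show ?thesis using gift0[OF False] gift20[of x] by simp
      next
        \<comment> \<open>Only the opposite vertices \<open>x\<close> and \<open>p\<close> receive
          anything. According to which of them are content, the gifts are 0 and 0, 0 and 20, or 10
          and 10.\<close>
        case True
        have "\<not> rich f x" "\<not> rich f p" "isolated f p"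
          using True x p ab 4 by (auto simp: rich_def isolated_def)
        moreover have "(\<exists>y\<in>\<Union>f. small y \<and> y \<noteq> x \<and> content y) \<longleftrightarrow> content p"
          "(\<exists>y\<in>\<Union>f. small y \<and> y \<noteq> p \<and> content y) \<longleftrightarrow> content x"
          using True x p(1,2) ab by auto
        moreover have "p \<in> \<Union>f" unfolding p(1) by simp
        ultimately show ?thesis unfolding face_gift_def using x nt True by (simp only: if_False if_True simp_thms) simp
      qed
      finally show ?thesis .
    qed
    then show ?thesis using 4 by simp
  qed
qed

lemma tris_edge_cases:
  assumes "{x, y} \<in> S"
  obtains f g where "f \<noteq> g" "f \<in> F" "g \<in> F" "{x, y} \<in> f" "{x, y} \<in> g"
    "\<And>h. h \<in> F \<Longrightarrow> {x, y} \<in> h \<Longrightarrow> h = f \<or> h = g"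
    "tris_edge x y = (if tri f then 1 else 0) + (if tri g then 1 else 0)"
proof -
  obtain f g where fg: "f \<noteq> g" "f \<in> F" "g \<in> F" "{h \<in> F. {x, y} \<in> h} = {f, g}"
    using edge_faces[OF assms] .
  have "{h \<in> F. tri h \<and> {x, y} \<in> h} = {h \<in> {h \<in> F. {x, y} \<in> h}. tri h}" by auto
  also have "\<dots> = {h \<in> {f, g}. tri h}" unfolding fg(4) ..
  also have "\<dots> = (if tri f then {f} else {}) \<union> (if tri g then {g} else {})" by auto
  finally have "tris_edge x y = (if tri f then 1 else 0) + (if tri g then 1 else 0)"
    using fg(1) by (simp add: tris_edge_def)
  moreover have "{x, y} \<in> f" "{x, y} \<in> g" using fg(4) by auto
  moreover have "h = f \<or> h = g" if "h \<in> F" "{x, y} \<in> h" for h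
  proof -
    have "h \<in> {h \<in> F. {x, y} \<in> h}" using that by simp
    then show ?thesis unfolding fg(4) by simp
  qed
  ultimately show ?thesis using fg(1-3) by (intro that[of f g])
qed

lemma tris_edge_2:
  assumes "{x, y} \<in> S"
  shows "tris_edge x y = 2 \<longleftrightarrow> (\<forall>f\<in>F. {x, y} \<in> f \<longrightarrow> tri f)"
  using assms by (rule tris_edge_cases) (auto split: if_splits)

lemma tris_edge_pos:
  assumes "{x, y} \<in> S"
  shows "f \<in> F \<Longrightarrow> tri f \<Longrightarrow> {x, y} \<in> f \<Longrightarrow> tris_edge x y = 1 \<or> tris_edge x y = 2"
  using assms by (rule tris_edge_cases) (auto split: if_splits)

lemma take_nonneg: "take_from x v \<ge> 0" and take_le: "take_from x v \<le> 10"
  by (auto simp: take_from_def)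

text \<open>No face at an edge between small vertices is a triangle and both ends have degree 5,
  where only vertices surrounded by triangles take anything.\<close>

lemma take_small:
  assumes "{x, v} \<in> S" "small x" "small v" shows "take_from x v = 0"
proof -
  have dx: "d x = 5" using small_adj[OF assms] by simp
  obtain f where f: "f \<in> F" "{x, v} \<in> f" using edge_face[OF assms(1)] by (elim bexE)
  have "\<not> tri f" by (rule small_adj(3)[OF assms f])
  have "{f \<in> F. tri f \<and> x \<in> \<Union>f} \<subset> {f \<in> F. x \<in> \<Union>f}"
  proof (rule psubsetI)
    have "f \<in> {f \<in> F. x \<in> \<Union>f}" using f by auto
    moreover have "f \<notin> {f \<in> F. tri f \<and> x \<in> \<Union>f}" using \<open>\<not> tri f\<close> by simp
    ultimately show "{f \<in> F. tri f \<and> x \<in> \<Union>f} \<noteq> {f \<in> F. x \<in> \<Union>f}" by metis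
  qed auto
  then have "tris_at x < card {f \<in> F. x \<in> \<Union>f}"
    unfolding tris_at_def by (intro psubset_card_mono) simp_all
  then have "tris_at x < 5" using card_faces_at[of x] assms(2) dx by (simp add: small_def)
  then show ?thesis using dx by (simp add: take_from_def)
qed

lemma gift_nonneg: "face_gift f x \<ge> 0"
  by (simp add: face_gift_def)

lemma gift_ge10:
  assumes "small x" "d x \<le> 4" "f \<in> F" "x \<in> \<Union>f" "\<not> tri f"
  shows "face_gift f x \<ge> 10" "isolated f x"
proof -
  show iso: "isolated f x"
    unfolding isolated_def
  proof
    fix y assume "y \<in> nbrs f x"
    then have "{x, y} \<in> S" using face_sub[OF assms(3)] by (auto simp: nbrs_def)
    then show "\<not> small y" using small_adj(1)[of x y] assms by auto
  qed
  have "\<not> content x" using assms(2) by (simp add: content_def)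
  then show "face_gift f x \<ge> 10" using assms iso by (simp add: face_gift_def)
qed

lemma nontri_count:
  assumes "x \<in> \<Union>S"
  defines "Q \<equiv> {f \<in> F. x \<in> \<Union>f \<and> \<not> tri f}"
  shows "tris_at x + card Q = d x" "finite Q"
proof -
  show "finite Q" by (simp add: Q_def)
  have "{f \<in> F. x \<in> \<Union>f} = {f \<in> F. tri f \<and> x \<in> \<Union>f} \<union> Q" by (auto simp: Q_def)
  moreover have "card ({f \<in> F. tri f \<and> x \<in> \<Union>f} \<union> Q) = tris_at x + card Q"
    unfolding tris_at_def by (rule card_Un_disjoint) (auto simp: Q_def)
  ultimately show "tris_at x + card Q = d x" using card_faces_at[OF assms(1)] by simp
qed

lemma sum_gift_ge:
  assumes "A \<subseteq> F" "\<And>f. f \<in> A \<Longrightarrow> face_gift f x \<ge> c"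
  shows "(\<Sum>f\<in>F. face_gift f x) \<ge> c * int (card A)"
proof -
  have "c * int (card A) = (\<Sum>f\<in>A. c)" by simp
  also have "\<dots> \<le> (\<Sum>f\<in>A. face_gift f x)" by (intro sum_mono assms)
  also have "\<dots> \<le> (\<Sum>f\<in>F. face_gift f x)" using assms by (intro sum_mono2) (auto simp: gift_nonneg)
  finally show ?thesis .
qed

lemma sum_take_ge:
  assumes "A \<subseteq> nbrs S x" "\<And>v. v \<in> A \<Longrightarrow> take_from x v \<ge> c"
  shows "(\<Sum>v\<in>nbrs S x. take_from x v) \<ge> c * int (card A)"
proof -
  have "c * int (card A) = (\<Sum>v\<in>A. c)" by simp
  also have "\<dots> \<le> (\<Sum>v\<in>A. take_from x v)" by (intro sum_mono assms)
  also have "\<dots> \<le> (\<Sum>v\<in>nbrs S x. take_from x v)" using assms by (intro sum_mono2) (auto simp: take_nonneg)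
  finally show ?thesis .
qed

text \<open>Let \<open>Q\<close> be the set of non-triangular faces at \<open>x\<close>. In degree 3
  without a gift of 20, the income for \<open>card Q\<close> = 0, 1, 2, 3 is at least
  \<open>3 * 10\<close>, \<open>10 + 10 + 2 * 5\<close>, \<open>2 * 10 + 2 * 5\<close>,
  \<open>3 * 10\<close>; a gift of 20 is completed by one edge between two triangles or by another
  face. In degree 4, for \<open>card Q\<close> = 0, 1, 2 or more, it is at least
  \<open>4 * 5\<close>, \<open>10 + 2 * 5\<close>, \<open>2 * 10\<close>.\<close>

lemma small_charge:
  assumes x: "small x"
  shows "10 * int (d x) - 60 + (\<Sum>f\<in>F. face_gift f x) + (\<Sum>v\<in>nbrs S x. take_from x v) \<ge> 0"
proof -
  have xU: "x \<in> \<Union>S" using x by (simp add: small_def)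
  define Q where "Q = {f \<in> F. x \<in> \<Union>f \<and> \<not> tri f}"
  have Q: "tris_at x + card Q = d x" "finite Q" using nontri_count[OF xU] by (simp_all add: Q_def)
  have QF: "Q \<subseteq> F" by (auto simp: Q_def)
  define N where "N = nbrs S x"
  have N: "card N = d x" "finite N" by (simp_all add: N_def d_def)
  have fN: "nbrs f x \<subseteq> N" if "f \<in> F" for f using face_sub[OF that] by (auto simp: N_def nbrs_def)
  have xS: "{x, y} \<in> S" if "y \<in> N" for y using that by (simp add: N_def nbrs_def)
  have tr2: "tris_edge x y = 2" if "y \<in> N" "\<forall>f\<in>Q. y \<notin> nbrs f x" for y
    unfolding tris_edge_2[OF xS[OF that(1)]]
  proof (intro ballI impI)
    fix f assume f: "f \<in> F" "{x, y} \<in> f"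
    then have "x \<in> \<Union>f" "y \<in> nbrs f x" by (auto simp: nbrs_def)
    then show "tri f" using that(2) f(1) by (auto simp: Q_def)
  qed
  have takes0: "(\<Sum>v\<in>N. take_from x v) \<ge> 0" by (intro sum_nonneg take_nonneg)
  have gifts0: "(\<Sum>f\<in>F. face_gift f x) \<ge> 0" by (intro sum_nonneg gift_nonneg)
  have f2: "card (nbrs f x) = 2" if "f \<in> Q" for f using that face_nbrs by (simp add: Q_def)
  have one: "card (N - nbrs f x) = d x - 2" "\<And>y. y \<in> N - nbrs f x \<Longrightarrow> tris_edge x y = 2"
    if "Q = {f}" for f
  proof -
    have "f \<in> Q" using that by simp
    then show "card (N - nbrs f x) = d x - 2"
      using f2 fN QF N by (subst card_Diff_subset) (auto intro: finite_subset)
    show "tris_edge x y = 2" if "y \<in> N - nbrs f x" for y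
      using that \<open>Q = {f}\<close> by (intro tr2) auto
  qed
  consider "d x = 3" | "d x = 4" | "d x = 5" using small_d[OF x] by blast
  then show ?thesis
  proof cases
    case 1
    have gQ: "face_gift f x \<ge> 10" if "f \<in> Q" for f using gift_ge10[OF x] 1 that by (auto simp: Q_def)
    have dbl: "take_from x y = 10" if "tris_edge x y = 2" for y using that 1 by (simp add: take_from_def)
    show ?thesis
    proof (cases "\<exists>f\<in>F. face_gift f x = 20")
      case True
      then obtain f where f: "f \<in> F" "face_gift f x = 20" by blast
      then have fQ: "f \<in> Q" by (auto simp: Q_def face_gift_def split: if_splits)
      have "(\<Sum>g\<in>F. face_gift g x) = 20 + (\<Sum>g\<in>F - {f}. face_gift g x)"
        using f by (simp add: sum.remove)
      moreover have "(\<Sum>g\<in>F - {f}. face_gift g x) \<ge> (\<Sum>g\<in>Q - {f}. face_gift g x)"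
        using QF by (intro sum_mono2) (auto simp: gift_nonneg)
      moreover have "(\<Sum>g\<in>Q - {f}. face_gift g x) \<ge> (\<Sum>g\<in>Q - {f}. 10)" using gQ by (intro sum_mono) auto
      ultimately have g: "(\<Sum>g\<in>F. face_gift g x) \<ge> 20 + 10 * int (card (Q - {f}))" by simp
      show ?thesis
      proof (cases "Q = {f}")
        case True
        have "(\<Sum>v\<in>nbrs S x. take_from x v) \<ge> 10 * int (card (N - nbrs f x))"
          using one(2)[OF True] dbl by (intro sum_take_ge) (auto simp: N_def)
        then show ?thesis using one(1)[OF True] g 1 by simp
      next
        case False
        then have "Q - {f} \<noteq> {}" using fQ by blast
        then have "card (Q - {f}) \<ge> 1" using Q(2) by (simp add: Suc_le_eq card_gt_0_iff)
        then show ?thesis using g 1 takes0 by (simp add: N_def)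
      qed
    next
      case no20: False
      have sgl: "take_from x y \<ge> 5" if "f \<in> F" "tri f" "{x, y} \<in> f" for f y
      proof -
        have "{x, y} \<in> S" using that face_sub by blast
        then show ?thesis using tris_edge_pos[OF _ that] no20 1 by (auto simp: take_from_def)
      qed
      have gifts: "(\<Sum>f\<in>F. face_gift f x) \<ge> 10 * int (card Q)"
        using gQ QF by (intro sum_gift_ge) auto
      consider "card Q = 0" | "card Q = 1" | "card Q = 2" | "card Q \<ge> 3" by linarith
      then show ?thesis
      proof cases
        case c0: 1
        then have "Q = {}" using Q(2) by simp
        then have "(\<Sum>v\<in>nbrs S x. take_from x v) \<ge> 10 * int (card N)"
          using tr2 dbl by (intro sum_take_ge) (auto simp: N_def)
        then show ?thesis using N 1 gifts0 by simp
      next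
        case c1: 2
        then obtain f where f: "Q = {f}" by (meson card_1_singletonE)
        have ge5: "take_from x y \<ge> 5" if y: "y \<in> nbrs f x" for y
        proof -
          have "{x, y} \<in> S" using y fN[of f] QF f xS by auto
          then obtain g h where gh: "g \<noteq> h" "g \<in> F" "h \<in> F" "{x, y} \<in> g" "{x, y} \<in> h"
            by (rule tris_edge_cases)
          have tri_g: "tri g'" if "g' \<in> F" "{x, y} \<in> g'" "g' \<noteq> f" for g'
          proof (rule ccontr)
            assume "\<not> tri g'"
            then have "g' \<in> Q" using that(1,2) unfolding Q_def by blast
            then show False using f that(3) by simp
          qed
          show ?thesis
          proof (cases "g = f")
            case True
            then have "h \<noteq> f" using gh(1) by simp
            then show ?thesis using sgl[OF gh(3) tri_g[OF gh(3,5)] gh(5)] by simp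
          next
            case False
            then show ?thesis using sgl[OF gh(2) tri_g[OF gh(2,4)] gh(4)] by simp
          qed
        qed
        have "(\<Sum>v\<in>N. take_from x v) = (\<Sum>v\<in>nbrs f x. take_from x v) + (\<Sum>v\<in>N - nbrs f x. take_from x v)"
          using fN[of f] QF f N(2) by (simp add: sum.subset_diff add.commute)
        moreover have "(\<Sum>v\<in>nbrs f x. take_from x v) \<ge> (\<Sum>v\<in>nbrs f x. 5)" by (intro sum_mono ge5)
        moreover have "(\<Sum>v\<in>N - nbrs f x. take_from x v) \<ge> (\<Sum>v\<in>N - nbrs f x. 10)"
          using one(2)[OF f] dbl by (intro sum_mono) auto
        ultimately show ?thesis using one(1)[OF f] f2[of f] f 1 gifts c1 by (simp add: N_def)
      next
        case c2: 3
        then have "tris_at x = 1" using Q 1 by simp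
        then obtain f where "{f \<in> F. tri f \<and> x \<in> \<Union>f} = {f}" unfolding tris_at_def by (meson card_1_singletonE)
        then have f: "f \<in> F" "tri f" "x \<in> \<Union>f" by blast+
        have "(\<Sum>v\<in>nbrs S x. take_from x v) \<ge> 5 * int (card (nbrs f x))"
          using fN[OF f(1)] sgl[OF f(1,2)] by (intro sum_take_ge) (auto simp: N_def nbrs_def)
        then show ?thesis using face_nbrs[OF f(1,3)] gifts c2 1 by simp
      next
        case 4
        then show ?thesis using gifts 1 takes0 by (simp add: N_def)
      qed
    qed
  next
    case 2
    have gQ: "face_gift f x \<ge> 10" if "f \<in> Q" for f using gift_ge10[OF x] 2 that by (auto simp: Q_def)
    have gifts: "(\<Sum>f\<in>F. face_gift f x) \<ge> 10 * int (card Q)"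
      using gQ QF by (intro sum_gift_ge) auto
    have dbl: "take_from x y = 5" if "tris_edge x y = 2" "card Q \<le> 1" for y
      using that 2 Q by (simp add: take_from_def)
    consider "card Q = 0" | "card Q = 1" | "card Q \<ge> 2" by linarith
    then show ?thesis
    proof cases
      case c0: 1
      then have "Q = {}" using Q(2) by simp
      then have "(\<Sum>v\<in>nbrs S x. take_from x v) \<ge> 5 * int (card N)"
        using tr2 dbl c0 by (intro sum_take_ge) (auto simp: N_def)
      then show ?thesis using N 2 gifts0 by simp
    next
      case c1: 2
      then obtain f where f: "Q = {f}" by (meson card_1_singletonE)
      have "(\<Sum>v\<in>nbrs S x. take_from x v) \<ge> 5 * int (card (N - nbrs f x))"
        using one(2)[OF f] dbl c1 by (intro sum_take_ge) (auto simp: N_def)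
      then show ?thesis using one(1)[OF f] gifts c1 2 by simp
    next
      case 3
      then show ?thesis using gifts 2 takes0 by (simp add: N_def)
    qed
  next
    case 3
    show ?thesis
    proof (cases "card Q = 0")
      case True
      then have "tris_at x = 5" using Q 3 by simp
      then have "(\<Sum>v\<in>nbrs S x. take_from x v) \<ge> 2 * int (card N)"
        using 3 by (intro sum_take_ge) (auto simp: N_def take_from_def)
      then show ?thesis using N 3 gifts0 by simp
    next
      case False
      then obtain f where f: "f \<in> Q" by (metis card.empty ex_in_conv)
      \<comment> \<open>A small neighbour makes both faces on the edge to it give 5. Otherwise a
        rich face gives 20, or \<open>x\<close> is not content and \<open>f\<close> gives at least
        10.\<close>
      have "(\<Sum>f\<in>F. face_gift f x) \<ge> 10"
      proof (cases "\<exists>y\<in>N. small y")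
        case True
        then obtain y where y: "y \<in> N" "small y" by blast
        obtain g h where gh: "g \<noteq> h" "g \<in> F" "h \<in> F" "{x, y} \<in> g" "{x, y} \<in> h"
          using xS[OF y(1)] by (rule tris_edge_cases)
        have g5: "face_gift g' x \<ge> 5" if "g' \<in> F" "{x, y} \<in> g'" for g'
        proof -
          have "\<not> tri g'" using small_adj(3)[OF xS[OF y(1)] x y(2) that] .
          moreover have "\<not> isolated g' x" using isolated_no_small[of g' x y] that y by blast
          moreover have "x \<in> \<Union>g'" using that by blast
          ultimately show ?thesis using x by (simp add: face_gift_def)
        qed
        have "(\<Sum>f\<in>F. face_gift f x) \<ge> 5 * int (card {g, h})"
          using gh g5 by (intro sum_gift_ge) auto
        then show ?thesis using gh(1) by simp
      next
        case False
        then have iso: "isolated f x" if "f \<in> F" for f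
          using fN[OF that] by (auto simp: isolated_def)
        show ?thesis
        proof (cases "\<exists>f\<in>F. x \<in> \<Union>f \<and> rich f x")
          case True
          then obtain g where g: "g \<in> F" "x \<in> \<Union>g" "rich g x" by blast
          then have "face_gift g x = 20" using x by (auto simp: face_gift_def rich_def)
          then show ?thesis using sum_gift_ge[of "{g}" 20 x] g by simp
        next
          case nr: False
          have "\<not> content x" using nr False by (auto simp: content_def N_def)
          then have "face_gift f x \<ge> 10"
            using f x iso[of f] by (simp add: face_gift_def Q_def)
          then show ?thesis using sum_gift_ge[of "{f}" 10 x] f QF by auto
        qed
      qed
      then show ?thesis using 3 takes0 by (simp add: N_def)
    qed
  qed
qed

text \<open>The final charges sum to at most -120. What \<open>z\<close> gives away is at most 10
  per neighbour and is covered by its \<open>10 * d z\<close>, so \<open>z\<close> ends with at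
  least -60 and cannot account for the total. Small vertices end nonnegative, hence a large one must
  be negative.\<close>

lemma excessive_loss:
  obtains v where "v \<in> \<Union>S" "v \<noteq> z" "d v \<ge> 6" "loss v > 10 * int (d v) - 60"
proof (rule ccontr)
  note found = that
  assume no: "\<not> thesis"
  have ok: "loss v \<le> 10 * int (d v) - 60" if v: "v \<in> \<Union>S" "v \<noteq> z" "d v \<ge> 6" for v
  proof (rule ccontr)
    assume "\<not> ?thesis"
    then have thesis by (intro found[OF v]) simp
    then show False using no by simp
  qed
  define G where "G = (\<lambda>v. if small v then (\<Sum>w\<in>nbrs S v. take_from v w) else 0)"
  define T where "T = (\<lambda>v. 10 * int (d v) - 60 + (\<Sum>f\<in>F. face_gift f v) + G v - loss v)"
  have sumG: "(\<Sum>v\<in>\<Union>S. G v) = (\<Sum>v\<in>\<Union>S. loss v)"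
  proof -
    have "(\<Sum>v\<in>\<Union>S. loss v) = (\<Sum>v\<in>\<Union>S. \<Sum>x\<in>{x \<in> \<Union>S. small x \<and> {v, x} \<in> S}. take_from x v)"
      unfolding loss_def
    proof (rule sum.cong[OF refl])
      fix v
      have "{x \<in> nbrs S v. small x} = {x \<in> \<Union>S. small x \<and> {v, x} \<in> S}"
        by (auto simp: nbrs_def small_def)
      then show "(\<Sum>x\<in>{x \<in> nbrs S v. small x}. take_from x v) = (\<Sum>x\<in>{x \<in> \<Union>S. small x \<and> {v, x} \<in> S}. take_from x v)"
        by simp
    qed
    also have "\<dots> = (\<Sum>x\<in>\<Union>S. \<Sum>v\<in>{v \<in> \<Union>S. small x \<and> {v, x} \<in> S}. take_from x v)"
      by (rule sum.swap_restrict) simp_all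
    also have "\<dots> = (\<Sum>x\<in>\<Union>S. G x)"
    proof (rule sum.cong[OF refl])
      fix x assume "x \<in> \<Union>S"
      have "{v \<in> \<Union>S. {v, x} \<in> S} = nbrs S x" using edgeS by (auto simp: nbrs_def insert_commute)
      then show "(\<Sum>v\<in>{v \<in> \<Union>S. small x \<and> {v, x} \<in> S}. take_from x v) = G x"
        by (cases "small x") (simp_all add: G_def)
    qed
    finally show ?thesis by simp
  qed
  have sumF: "(\<Sum>v\<in>\<Union>S. \<Sum>f\<in>F. face_gift f v) = (\<Sum>f\<in>F. \<Sum>x\<in>\<Union>f. face_gift f x)"
  proof -
    have "(\<Sum>v\<in>\<Union>S. \<Sum>f\<in>F. face_gift f v) = (\<Sum>f\<in>F. \<Sum>v\<in>\<Union>S. face_gift f v)" by (rule sum.swap)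
    also have "\<dots> = (\<Sum>f\<in>F. \<Sum>x\<in>\<Union>f. face_gift f x)"
    proof (rule sum.cong[OF refl])
      fix f assume "f \<in> F"
      then have "\<Union>f \<subseteq> \<Union>S" using face_sub by blast
      then show "(\<Sum>v\<in>\<Union>S. face_gift f v) = (\<Sum>x\<in>\<Union>f. face_gift f x)"
        by (intro sum.mono_neutral_right) (auto simp: face_gift_def)
    qed
    finally show ?thesis .
  qed
  have "(\<Sum>v\<in>\<Union>S. T v) = (\<Sum>v\<in>\<Union>S. 10 * int (d v) - 60) + (\<Sum>f\<in>F. \<Sum>x\<in>\<Union>f. face_gift f x)"
    unfolding T_def sum_subtractf sum.distrib sumG sumF by simp
  also have "\<dots> \<le> (\<Sum>v\<in>\<Union>S. 10 * int (d v) - 60) + (\<Sum>f\<in>F. 20 * int (card f) - 60)"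
    using face_bound by (intro add_left_mono sum_mono)
  also have "\<dots> = -120" by (rule total_charge)
  finally have neg: "(\<Sum>v\<in>\<Union>S. T v) \<le> -120" .
  have gifts0: "(\<Sum>f\<in>F. face_gift f v) \<ge> 0" for v by (intro sum_nonneg gift_nonneg)
  have T0: "T v \<ge> 0" if v: "v \<in> \<Union>S" "v \<noteq> z" for v
  proof (cases "small v")
    case True
    have "loss v = 0"
      unfolding loss_def using take_small True by (intro sum.neutral) (auto simp: nbrs_def insert_commute)
    then show ?thesis using small_charge[OF True] True by (simp add: T_def G_def)
  next
    case False
    then have "\<not> d v \<le> 5" using v unfolding small_def by blast
    then have "d v \<ge> 6" by simp
    then show ?thesis using ok[OF v] gifts0[of v] False by (simp add: T_def G_def)
  qed
  have Tz: "T z \<ge> -60"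
  proof -
    have "loss z \<le> (\<Sum>x\<in>{x \<in> nbrs S z. small x}. 10)"
      unfolding loss_def by (intro sum_mono take_le)
    also have "\<dots> = 10 * int (card {x \<in> nbrs S z. small x})" by simp
    also have "\<dots> \<le> 10 * int (d z)" unfolding d_def
      by (intro mult_left_mono) (auto intro!: card_mono)
    finally show ?thesis using gifts0[of z] by (simp add: T_def G_def small_def)
  qed
  have "(\<Sum>v\<in>\<Union>S. T v) \<ge> -60"
  proof (cases "z \<in> \<Union>S")
    case True
    then have "(\<Sum>v\<in>\<Union>S. T v) = T z + (\<Sum>v\<in>\<Union>S - {z}. T v)" by (simp add: sum.remove)
    moreover have "(\<Sum>v\<in>\<Union>S - {z}. T v) \<ge> 0" using T0 by (intro sum_nonneg) auto
    ultimately show ?thesis using Tz by linarith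
  next
    case False
    then have "(\<Sum>v\<in>\<Union>S. T v) \<ge> 0" using T0 by (intro sum_nonneg) auto
    then show ?thesis by linarith
  qed
  then show False using neg by linarith
qed

end

section \<open>The rotation around a vertex of low degree\<close>

context block
begin

text \<open>\<open>a\<close> and \<open>b\<close> are consecutive neighbours of \<open>x\<close>.\<close>

definition link :: "'a \<Rightarrow> 'a \<Rightarrow> 'a \<Rightarrow> bool" where
  "link x a b \<longleftrightarrow> a \<noteq> b \<and> (\<exists>f\<in>F. {x, a} \<in> f \<and> {x, b} \<in> f)"

lemma link_sym: "link x a b \<Longrightarrow> link x b a"
  by (auto simp: link_def)

lemma link_nbrs: "link x a b \<Longrightarrow> {x, a} \<in> S \<and> {x, b} \<in> S"
  unfolding link_def using face_sub by blast

text \<open>Distinct triangular faces on an edge have distinct third vertices, so the link of an edge in two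
  triangular faces has no double edge.\<close>

lemma link_double:
  assumes xa: "{x, a} \<in> S" and tri2: "\<And>f. f \<in> F \<Longrightarrow> {x, a} \<in> f \<Longrightarrow> tri f"
  obtains p q where "p \<noteq> q" "\<forall>b. link x a b \<longleftrightarrow> b = p \<or> b = q" "{a, p} \<in> S" "{a, q} \<in> S"
proof -
  obtain f g where fg: "f \<noteq> g" "f \<in> F" "g \<in> F" "{x, a} \<in> f" "{x, a} \<in> g"
    "\<And>h. h \<in> F \<Longrightarrow> {x, a} \<in> h \<Longrightarrow> h = f \<or> h = g"
    using xa by (rule tris_edge_cases) blast
  obtain p where p: "p \<noteq> a" "{x, p} \<in> f" "nbrs f x = {a, p}" using partner[OF fg(2,4)] by blast
  obtain q where q: "q \<noteq> a" "{x, q} \<in> g" "nbrs g x = {a, q}" using partner[OF fg(3,5)] by blast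
  have "p \<noteq> q"
  proof
    assume "p = q"
    then have "f = g"
      using tri_distinct[OF fg(2,3) tri2[OF fg(2,4)] tri2[OF fg(3,5)] fg(4) p(2) fg(5)] p q by metis
    then show False using fg(1) by simp
  qed
  moreover have "link x a b \<longleftrightarrow> b = p \<or> b = q" for b
  proof
    assume "link x a b"
    then obtain h where h: "h \<in> F" "{x, a} \<in> h" "{x, b} \<in> h" "a \<noteq> b" by (auto simp: link_def)
    have "b \<in> nbrs h x" using h by (simp add: nbrs_def)
    moreover have "h = f \<or> h = g" by (rule fg(6)[OF h(1,2)])
    ultimately show "b = p \<or> b = q" using p q h(4) by auto
  next
    assume "b = p \<or> b = q"
    then show "link x a b" using p q fg unfolding link_def by metis
  qed
  moreover have "{a, p} \<in> f" "{a, q} \<in> g"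
    using tri_third(1)[OF fg(2) tri2[OF fg(2,4)] fg(4) p(2)] tri_third(1)[OF fg(3) tri2[OF fg(3,5)] fg(5) q(2)] p q
    by blast+
  then have "{a, p} \<in> S" "{a, q} \<in> S" using fg face_sub by blast+
  ultimately show ?thesis by (intro that[of p q]) auto
qed

lemma link_edge:
  assumes "link x a b" "\<And>f. f \<in> F \<Longrightarrow> {x, a} \<in> f \<Longrightarrow> tri f"
  shows "{a, b} \<in> S"
proof -
  have xa: "{x, a} \<in> S" using link_nbrs[OF assms(1)] by simp
  obtain p q where "p \<noteq> q" "\<forall>b. link x a b \<longleftrightarrow> b = p \<or> b = q" "{a, p} \<in> S" "{a, q} \<in> S"
    using link_double[OF xa assms(2)] .
  then show ?thesis using assms(1) by auto
qed

lemma all_tri_if: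
  assumes "x \<in> \<Union>S" "tris_at x = d x" "f \<in> F" "{x, y} \<in> f"
  shows "tri f"
proof (rule ccontr)
  assume "\<not> tri f"
  define Q where "Q = {f \<in> F. x \<in> \<Union>f \<and> \<not> tri f}"
  have "f \<in> Q" using assms(3,4) \<open>\<not> tri f\<close> by (auto simp: Q_def)
  moreover have "card Q = 0" "finite Q" using nontri_count[OF assms(1)] assms(2) by (simp_all add: Q_def)
  ultimately show False by auto
qed

lemma nbrs_three:
  assumes "d x = 3" "{x, v} \<in> S" "{x, c1} \<in> S" "{x, c2} \<in> S" "v \<noteq> c1" "v \<noteq> c2" "c1 \<noteq> c2"
  shows "nbrs S x = {v, c1, c2}"
proof -
  have "{v, c1, c2} \<subseteq> nbrs S x" using assms by (simp add: nbrs_def)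
  moreover have "card {v, c1, c2} = card (nbrs S x)" using assms by (simp add: d_def)
  ultimately show ?thesis by (metis card_subset_eq fin_nbrs_S)
qed

lemma double_three:
  assumes "d x = 3" "{x, v} \<in> S" "tris_edge x v = 2"
  obtains c1 c2 where "c1 \<noteq> c2" "v \<noteq> c1" "v \<noteq> c2" "\<forall>b. link x v b \<longleftrightarrow> b = c1 \<or> b = c2"
    "{v, c1} \<in> S" "{v, c2} \<in> S" "nbrs S x = {v, c1, c2}"
proof -
  have t: "tri f" if "f \<in> F" "{x, v} \<in> f" for f using tris_edge_2[OF assms(2)] assms(3) that by blast
  obtain p q where pq: "p \<noteq> q" "\<forall>b. link x v b \<longleftrightarrow> b = p \<or> b = q" "{v, p} \<in> S" "{v, q} \<in> S"
    using link_double[OF assms(2) t] .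
  have "{x, p} \<in> S" "{x, q} \<in> S" using pq(2) link_nbrs by blast+
  moreover have "v \<noteq> p" "v \<noteq> q" using pq(3,4) edgeS by blast+
  ultimately show ?thesis using pq nbrs_three[OF assms(1,2)] by (intro that[of p q]) auto
qed

text \<open>At most one face at \<open>x\<close> is not a triangle, so the fourth neighbour
  \<open>y\<close> lies on a triangle at \<open>x\<close>. Its third vertex is not \<open>v\<close>,
  because next to \<open>v\<close> around \<open>x\<close> come only \<open>c1\<close> and
  \<open>c2\<close>.\<close>

lemma double_four:
  assumes "d x = 4" "{x, v} \<in> S" "tris_edge x v = 2" "tris_at x \<ge> 3" "x \<in> \<Union>S"
  obtains c1 c2 y where "c1 \<noteq> c2" "v \<noteq> c1" "v \<noteq> c2" "y \<notin> {v, c1, c2}" "\<forall>b. link x v b \<longleftrightarrow> b = c1 \<or> b = c2"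
    "{v, c1} \<in> S" "{v, c2} \<in> S" "nbrs S x = {v, c1, c2, y}" "{y, c1} \<in> S \<or> {y, c2} \<in> S"
proof -
  have t: "tri f" if "f \<in> F" "{x, v} \<in> f" for f using tris_edge_2[OF assms(2)] assms(3) that by blast
  obtain c1 c2 where c: "c1 \<noteq> c2" "\<forall>b. link x v b \<longleftrightarrow> b = c1 \<or> b = c2" "{v, c1} \<in> S" "{v, c2} \<in> S"
    using link_double[OF assms(2) t] .
  have xc: "{x, c1} \<in> S" "{x, c2} \<in> S" using c(2) link_nbrs by blast+
  have vc: "v \<noteq> c1" "v \<noteq> c2" using c(3,4) edgeS by blast+
  have sub: "{v, c1, c2} \<subseteq> nbrs S x" using assms xc by (simp add: nbrs_def)
  then have "card (nbrs S x - {v, c1, c2}) = 1" using assms(1) c(1) vc by (simp add: card_Diff_subset d_def)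
  then obtain y where y: "nbrs S x - {v, c1, c2} = {y}" by (meson card_1_singletonE)
  have nx: "nbrs S x = {v, c1, c2, y}" "y \<notin> {v, c1, c2}"
  proof -
    have "nbrs S x = {y} \<union> {v, c1, c2}" unfolding y[symmetric] using sub by (simp only: Un_Diff_cancel2 Un_absorb2)
    then show "nbrs S x = {v, c1, c2, y}" by (simp add: insert_commute)
    have "y \<in> nbrs S x - {v, c1, c2}" unfolding y by simp
    then show "y \<notin> {v, c1, c2}" by simp
  qed
  have xy: "{x, y} \<in> S" using nx(1) by (auto simp: nbrs_def)
  obtain g h where gh: "g \<noteq> h" "g \<in> F" "h \<in> F" "{x, y} \<in> g" "{x, y} \<in> h"
    using xy by (rule tris_edge_cases)
  define Q where "Q = {f \<in> F. x \<in> \<Union>f \<and> \<not> tri f}"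
  have Q: "card Q \<le> 1" "finite Q" using nontri_count[OF assms(5)] assms(1,4) by (auto simp: Q_def)
  have "\<exists>k\<in>F. tri k \<and> {x, y} \<in> k"
  proof (rule ccontr)
    assume "\<not> ?thesis"
    then have "{g, h} \<subseteq> Q" using gh by (auto simp: Q_def)
    then have "card {g, h} \<le> card Q" using Q(2) by (rule card_mono[rotated])
    then show False using gh(1) Q(1) by simp
  qed
  then obtain k where k: "k \<in> F" "tri k" "{x, y} \<in> k" by blast
  obtain w where w: "w \<noteq> y" "{x, w} \<in> k" using partner[OF k(1,3)] by blast
  have yw: "{y, w} \<in> S" using tri_third(1)[OF k(1,2,3) w(2)] w(1) k(1) face_sub by blast
  have "w \<noteq> v"
  proof
    assume "w = v"
    then have "link x v y" using k w unfolding link_def by blast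
    then show False using c(2) nx(2) by blast
  qed
  moreover have "w \<in> nbrs S x" using w(2) k(1) face_sub by (auto simp: nbrs_def)
  ultimately have "w = c1 \<or> w = c2" using nx(1) w(1) by auto
  then have "{y, c1} \<in> S \<or> {y, c2} \<in> S" using yw by auto
  then show ?thesis using c vc nx by (intro that[of c1 c2 y]) auto
qed

text \<open>Being consecutive is a 2-regular relation on the five neighbours, hence a 5-cycle: a
  closed triangle would leave two neighbours with at most one partner each.\<close>

lemma all_tri_five:
  assumes "d x = 5" "{x, v} \<in> S" "tris_at x = 5" "x \<in> \<Union>S" "link x v c1"
  obtains y1 y2 c2 where "distinct [v, c1, y1, y2, c2]" "nbrs S x = {v, c1, y1, y2, c2}"
    "\<forall>b. link x v b \<longleftrightarrow> b = c1 \<or> b = c2"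
    "{v, c1} \<in> S" "{c1, y1} \<in> S" "{y1, y2} \<in> S" "{y2, c2} \<in> S" "{v, c2} \<in> S"
proof -
  have t: "tri f" if "f \<in> F" "{x, a} \<in> f" for f a using all_tri_if[OF assms(4)] that assms by simp
  have l2: "\<exists>p q. p \<noteq> q \<and> (\<forall>b. link x a b \<longleftrightarrow> b = p \<or> b = q)" if "a \<in> nbrs S x" for a
  proof -
    have xa: "{x, a} \<in> S" using that by (simp add: nbrs_def)
    obtain p q where "p \<noteq> q" "\<forall>b. link x a b \<longleftrightarrow> b = p \<or> b = q" "{a, p} \<in> S" "{a, q} \<in> S"
      using link_double[OF xa t] .
    then show ?thesis by auto
  qed
  have lS: "{a, b} \<in> S" if "link x a b" for a b using link_edge[OF that t] .
  have lN: "a \<in> nbrs S x" "b \<in> nbrs S x" "a \<noteq> b" if "link x a b" for a b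
    using link_nbrs[OF that] that by (auto simp: nbrs_def link_def)
  have vN: "v \<in> nbrs S x" using assms(2) by (simp add: nbrs_def)
  obtain c2 where c2: "c1 \<noteq> c2" "\<forall>b. link x v b \<longleftrightarrow> b = c1 \<or> b = c2" using l2[OF vN] assms(5) by metis
  have v1: "link x c1 v" "link x c2 v" "v \<noteq> c1" "v \<noteq> c2" using c2(2) link_sym lN by blast+
  have c1N: "c1 \<in> nbrs S x" "c2 \<in> nbrs S x" using v1 lN by blast+
  obtain y1 where y1: "v \<noteq> y1" "\<And>b. link x c1 b \<longleftrightarrow> b = v \<or> b = y1" using l2[OF c1N(1)] v1(1) by metis
  have y1N: "y1 \<in> nbrs S x" "y1 \<noteq> c1" "link x y1 c1" using y1(2) lN link_sym by blast+
  have y1c2: "y1 \<noteq> c2"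
  proof
    assume eq: "y1 = c2"
    then have c2b: "link x c2 b \<longleftrightarrow> b = v \<or> b = c1" for b
      using l2[OF c1N(2)] v1(2,3) y1N(3) by metis
    have sub: "{v, c1, c2} \<subseteq> nbrs S x" using vN c1N by blast
    have "card (nbrs S x - {v, c1, c2}) = 2" using sub assms(1) c2(1) v1 by (simp add: card_Diff_subset d_def)
    then obtain a b where ab: "nbrs S x - {v, c1, c2} = {a, b}" "a \<noteq> b" by (meson card_2_iff)
    then have aN: "a \<in> nbrs S x - {v, c1, c2}" by blast
    have only: "w = b" if "link x a w" for w
    proof -
      have "w \<noteq> v" "w \<noteq> c1" "w \<noteq> c2" using that link_sym[OF that] c2(2) y1(2) c2b eq aN by auto
      then have "w \<in> {a, b}" unfolding ab(1)[symmetric] using lN(2)[OF that] by simp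
      then show ?thesis using lN(3)[OF that] by auto
    qed
    obtain p q where pq: "p \<noteq> q" "\<forall>b. link x a b \<longleftrightarrow> b = p \<or> b = q" using l2[of a] aN by blast
    then show False using only[of p] only[of q] by auto
  qed
  have sub: "{v, c1, c2, y1} \<subseteq> nbrs S x" using vN c1N y1N by blast
  have dist4: "distinct [v, c1, c2, y1]" using v1 c2(1) y1(1) y1N(2) y1c2 by auto
  then have "card (nbrs S x - {v, c1, c2, y1}) = 1" using sub assms(1) by (simp add: card_Diff_subset d_def)
  then obtain y2 where y2: "nbrs S x - {v, c1, c2, y1} = {y2}" by (meson card_1_singletonE)
  have nx: "nbrs S x = {v, c1, y1, y2, c2}"
  proof -
    have "nbrs S x = {y2} \<union> {v, c1, c2, y1}" unfolding y2[symmetric] using sub by (simp only: Un_Diff_cancel2 Un_absorb2)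
    then show ?thesis by auto
  qed
  have "y2 \<in> nbrs S x - {v, c1, c2, y1}" unfolding y2 by simp
  then have y2': "y2 \<notin> {v, c1, c2, y1}" "y2 \<in> nbrs S x" by simp_all
  have y2l: "w = y1 \<or> w = c2" if "link x y2 w" for w
  proof -
    have "w \<noteq> v" "w \<noteq> c1" using link_sym[OF that] c2(2) y1(2) y2' by auto
    then show ?thesis using lN(2,3)[OF that] nx by auto
  qed
  obtain p q where pq: "p \<noteq> q" "\<forall>b. link x y2 b \<longleftrightarrow> b = p \<or> b = q" using l2[OF y2'(2)] by blast
  then have "link x y2 y1" "link x y2 c2" using y2l[of p] y2l[of q] by auto
  then show ?thesis
    using lS c2(2) y1(2) link_sym dist4 y2' nx by (intro that[of y1 y2 c2]) auto
qed

end

section \<open>A vertex that gives away too much\<close>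

locale hub = block +
  fixes v :: 'a
  assumes vU: "v \<in> \<Union>S" "v \<noteq> z" and d6: "d v \<ge> 6" and excess: "loss v > 10 * int (d v) - 60"
begin

text \<open>\<open>Y2\<close>, \<open>Y1\<close>, \<open>Y4\<close> and \<open>Y5\<close> are the neighbours that take 10, 5, 5 and 2 from \<open>v\<close>.\<close>

definition "N = nbrs S v"
definition "K = {x \<in> N. \<not> small x}"
definition "Y2 = {x \<in> N. small x \<and> d x = 3 \<and> tris_edge x v = 2}"
definition "Y1 = {x \<in> N. small x \<and> d x = 3 \<and> tris_edge x v = 1 \<and> (\<forall>f\<in>F. face_gift f x \<noteq> 20)}"
definition "Y4 = {x \<in> N. small x \<and> d x = 4 \<and> tris_edge x v = 2 \<and> tris_at x \<ge> 3}"
definition "Y5 = {x \<in> N. small x \<and> d x = 5 \<and> tris_at x = 5}"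
definition "R = {x \<in> N. small x} - Y2 - Y1 - Y4 - Y5"

lemma N_E: "nbrs E v = N" using nbrs_S[of v] vU by (simp add: N_def)

lemma finN [simp]: "finite N" by (simp add: N_def)

lemma small_E: "small x \<Longrightarrow> nbrs E x = nbrs S x" "small x \<Longrightarrow> vertex_degree E x = d x"
  using nbrs_S[of x] degree_d[of x] by (auto simp: small_def)

lemma fin_parts [simp]: "finite K" "finite Y2" "finite Y1" "finite Y4" "finite Y5" "finite R"
  by (auto simp: K_def Y2_def Y1_def Y4_def Y5_def R_def intro: finite_subset[OF _ finN])

lemma parts_N: "N = K \<union> Y2 \<union> Y1 \<union> Y4 \<union> Y5 \<union> R"
  by (auto simp: K_def Y2_def Y1_def Y4_def Y5_def R_def)

lemma parts_disjoint: "K \<inter> (Y2 \<union> Y1 \<union> Y4 \<union> Y5 \<union> R) = {}" "Y2 \<inter> (Y1 \<union> Y4 \<union> Y5 \<union> R) = {}"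
  "Y1 \<inter> (Y4 \<union> Y5 \<union> R) = {}" "Y4 \<inter> (Y5 \<union> R) = {}" "Y5 \<inter> R = {}"
  by (auto simp: K_def Y2_def Y1_def Y4_def Y5_def R_def)

lemma d_parts: "d v = card K + card Y2 + card Y1 + card Y4 + card Y5 + card R"
proof -
  have "d v = card N" by (simp add: d_def N_def)
  also have "\<dots> = card K + card (Y2 \<union> (Y1 \<union> (Y4 \<union> (Y5 \<union> R))))"
    unfolding parts_N using parts_disjoint by (subst card_Un_disjoint[symmetric]) (simp_all add: Un_assoc)
  also have "card (Y2 \<union> (Y1 \<union> (Y4 \<union> (Y5 \<union> R)))) = card Y2 + card Y1 + card Y4 + card Y5 + card R"
    using parts_disjoint by (simp add: card_Un_disjoint Un_assoc)
  finally show ?thesis by simp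
qed

lemma loss_parts: "loss v = 10 * int (card Y2) + 5 * int (card Y1) + 5 * int (card Y4) + 2 * int (card Y5)"
proof -
  have "loss v = (\<Sum>x\<in>{x \<in> N. small x}. (if x \<in> Y2 then 10 else 0) + (if x \<in> Y1 then 5 else 0) +
      (if x \<in> Y4 then 5 else 0) + (if x \<in> Y5 then 2 else 0))"
    unfolding loss_def N_def[symmetric]
  proof (rule sum.cong[OF refl])
    fix x assume "x \<in> {x \<in> N. small x}"
    then have x: "x \<in> N" "small x" by auto
    show "take_from x v = (if x \<in> Y2 then 10 else 0) + (if x \<in> Y1 then 5 else 0) +
      (if x \<in> Y4 then 5 else 0) + (if x \<in> Y5 then 2 else 0)"
      unfolding take_from_def Y2_def Y1_def Y4_def Y5_def using x by auto
  qed
  also have "\<dots> = 10 * int (card Y2) + 5 * int (card Y1) + 5 * int (card Y4) + 2 * int (card Y5)"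
  proof -
    have fin: "finite {x \<in> N. small x}" by (rule finite_subset[OF _ finN]) auto
    have "(\<Sum>x\<in>{x \<in> N. small x}. if x \<in> Y then c else 0) = c * int (card Y)"
      if "Y \<subseteq> {x \<in> N. small x}" for Y and c :: int
    proof -
      have "{x \<in> N. small x} \<inter> {x. x \<in> Y} = Y" using that by auto
      then show ?thesis using fin by (simp add: sum.If_cases)
    qed
    moreover have "Y2 \<subseteq> {x \<in> N. small x}" "Y1 \<subseteq> {x \<in> N. small x}" "Y4 \<subseteq> {x \<in> N. small x}" "Y5 \<subseteq> {x \<in> N. small x}"
      by (auto simp: Y2_def Y1_def Y4_def Y5_def)
    ultimately show ?thesis by (simp add: sum.distrib)
  qed
  finally show ?thesis .
qed

definition outer :: "'a \<Rightarrow> 'a set" where "outer a = nbrs E a - insert v N"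

text \<open>The outer neighbours form a clique, so an independent repair set contains at most one of
  them.\<close>

definition harmless :: "'a \<Rightarrow> bool" where
  "harmless a \<longleftrightarrow> (\<forall>i\<in>outer a. \<forall>j\<in>outer a. i = j \<or> {i, j} \<in> E)"

lemma card_le_if_harmless:
  assumes "finite A" "\<And>a. a \<in> A \<Longrightarrow> harmless a" "\<And>i. i \<in> I \<Longrightarrow> \<exists>a\<in>A. i \<in> outer a"
    "\<And>i. i \<in> I \<Longrightarrow> nbrs E i \<inter> I = {}"
  shows "card I \<le> card A"
proof -
  obtain h where h: "\<And>i. i \<in> I \<Longrightarrow> h i \<in> A \<and> i \<in> outer (h i)" using assms(3) by metis
  have "inj_on h I"
  proof (rule inj_onI)
    fix i j assume ij: "i \<in> I" "j \<in> I" "h i = h j"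
    then have "i = j \<or> {i, j} \<in> E" using assms(2)[of "h i"] h[of i] h[of j] by (auto simp: harmless_def)
    moreover have "{i, j} \<notin> E" using assms(4)[OF ij(1)] ij(2) by (auto simp: nbrs_def)
    ultimately show "i = j" by blast
  qed
  then show ?thesis using h assms(1) by (intro card_inj_on_le[of h]) auto
qed

lemma small_independent:
  assumes "\<And>x. x \<in> L \<Longrightarrow> small x \<and> d x \<le> 4" "x \<in> L"
  shows "nbrs E x \<inter> L = {}"
proof (rule ccontr)
  assume "nbrs E x \<inter> L \<noteq> {}"
  then obtain y where "y \<in> L" "{x, y} \<in> S" using small_E(1)[of x] assms by (auto simp: nbrs_def)
  then show False using small_adj(1)[of x y] assms(1)[of y] assms(1)[OF assms(2)] by simp
qed

text \<open>The vertices of \<open>D\<close> in \<open>N - L\<close> are harmless, since the others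
  are excluded by a neighbour in \<open>L\<close> or by \<open>w\<close> and \<open>y\<close>. Each
  accounts for at most one vertex of \<open>I\<close>, so \<open>card I\<close> is at most
  \<open>card (D \<inter> N) - card L\<close>, and \<open>card L \<ge> 2\<close> gives the gain
  required by \<open>kill_bound\<close>.\<close>

lemma kill:
  assumes L: "L \<subseteq> N" "card L \<ge> 2" "\<And>x. x \<in> L \<Longrightarrow> small x \<and> d x \<le> 4"
    and W: "W = {} \<or> W = {w}"
    and Ww: "W \<noteq> {} \<Longrightarrow> w \<in> N - L \<and> small w \<and> {w, y} \<in> S \<and> y \<noteq> v \<and>
       (\<forall>x \<in> nbrs S w - {v, y}. {x, y} \<in> S \<or> (\<exists>u\<in>L. {u, x} \<in> S))"
    and cost: "(\<Sum>x\<in>L. d x - 1) + 1 + (\<Sum>x\<in>W. d x - 2) \<le> 8"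
    and harmless: "\<And>a. a \<in> N - L \<Longrightarrow> (\<exists>x\<in>L. {a, x} \<in> S) \<or> (W \<noteq> {} \<and> {w, a} \<in> S \<and> {y, a} \<in> S) \<or> harmless a"
  shows False
proof -
  have finL: "finite L" using L(1) finN by (rule finite_subset)
  have "independent_bondage_number V E \<le> 8"
  proof (rule kill_bound[where v = v and L = L and W = W and w = w and z = y])
    show "L \<subseteq> nbrs E v" "finite L" "2 \<le> card L" "W = {} \<or> W = {w}" using L finL W by (simp_all add: N_E)
    fix x assume x: "x \<in> L"
    show "nbrs E x \<inter> L = {}" by (rule small_independent[OF L(3) x])
  next
    assume W0: "W \<noteq> {}"
    have w: "w \<in> N - L" "small w" "{w, y} \<in> S" "y \<noteq> v"
      "\<And>x. x \<in> nbrs S w - {v, y} \<Longrightarrow> {x, y} \<in> S \<or> (\<exists>u\<in>L. {u, x} \<in> S)" using Ww[OF W0] by auto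
    show "w \<in> nbrs E v - L \<and> nbrs E w \<inter> L = {} \<and> y \<in> nbrs E w \<and> y \<noteq> v \<and>
       (\<forall>ya \<in> nbrs E w - {v, y}. ya \<in> nbrs E y \<or> (\<exists>x\<in>L. ya \<in> nbrs E x))"
    proof (intro conjI ballI)
      show "w \<in> nbrs E v - L" "y \<noteq> v" using w by (simp_all add: N_E)
      show "y \<in> nbrs E w" using w(3) SE by (auto simp: nbrs_def)
      show "nbrs E w \<inter> L = {}"
      proof (rule ccontr)
        assume "nbrs E w \<inter> L \<noteq> {}"
        then obtain u where "u \<in> L" "{w, u} \<in> S" using small_E(1)[OF w(2)] by (auto simp: nbrs_def)
        then show False using small_adj(2)[of w u] w(2) L(3)[of u] by simp
      qed
      fix ya assume "ya \<in> nbrs E w - {v, y}"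
      then have "{ya, y} \<in> S \<or> (\<exists>u\<in>L. {u, ya} \<in> S)" using w(5) small_E(1)[OF w(2)] by simp
      then show "ya \<in> nbrs E y \<or> (\<exists>x\<in>L. ya \<in> nbrs E x)"
        using SE by (auto simp: nbrs_def insert_commute)
    qed
  next
    have "(\<Sum>x\<in>L. vertex_degree E x - 1) = (\<Sum>x\<in>L. d x - 1)"
      using L(3) small_E(2) by (intro sum.cong) auto
    moreover have "(\<Sum>x\<in>W. vertex_degree E x - 2) = (\<Sum>x\<in>W. d x - 2)"
      using W Ww small_E(2) by (intro sum.cong) auto
    ultimately show "(\<Sum>x\<in>L. vertex_degree E x - 1) + 1 + (\<Sum>x\<in>W. vertex_degree E x - 2) \<le> 8"
      using cost by simp
  next
    fix D I
    assume D: "\<And>x. x \<in> D \<Longrightarrow> nbrs E x \<inter> D = {}" "L \<subseteq> D"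
      and nW: "W \<noteq> {} \<Longrightarrow> nbrs E w \<inter> nbrs E y \<inter> nbrs E v \<inter> D = {}"
      and DV: "D \<subseteq> V" and IV: "I \<subseteq> V"
      and I: "\<And>x. x \<in> I \<Longrightarrow> nbrs E x \<inter> I = {}"
       "\<And>x. x \<in> I \<Longrightarrow> x \<notin> nbrs E v \<and> x \<noteq> v \<and> nbrs E x \<inter> (D \<inter> nbrs E v - L) \<noteq> {}"
    let ?A = "D \<inter> N - L"
    have finA: "finite ?A" by simp
    have near: "\<exists>a\<in>?A. i \<in> outer a" if "i \<in> I" for i
    proof -
      have i: "i \<notin> N" "i \<noteq> v" "nbrs E i \<inter> ?A \<noteq> {}" using I(2)[OF that] by (auto simp: N_E)
      then obtain a where "a \<in> ?A" "a \<in> nbrs E i" by blast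
      then have "i \<in> outer a" using i nbrs_sym[of i E a] by (simp add: outer_def)
      then show ?thesis using \<open>a \<in> ?A\<close> by blast
    qed
    have good: "harmless a" if a: "a \<in> ?A" for a
    proof -
      have "\<not> (\<exists>x\<in>L. {a, x} \<in> S)"
      proof
        assume "\<exists>x\<in>L. {a, x} \<in> S"
        then obtain x where "x \<in> L" "a \<in> nbrs E x" using SE by (auto simp: nbrs_def insert_commute)
        then show False using D(1)[of x] D(2) a by blast
      qed
      moreover have "\<not> (W \<noteq> {} \<and> {w, a} \<in> S \<and> {y, a} \<in> S)"
      proof
        assume "W \<noteq> {} \<and> {w, a} \<in> S \<and> {y, a} \<in> S"
        then have "a \<in> nbrs E w \<inter> nbrs E y \<inter> nbrs E v \<inter> D" using SE a by (auto simp: nbrs_def N_def)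
        then show False using nW \<open>W \<noteq> {} \<and> {w, a} \<in> S \<and> {y, a} \<in> S\<close> by blast
      qed
      ultimately show ?thesis using harmless[of a] a by blast
    qed
    have "card I \<le> card ?A" by (rule card_le_if_harmless[OF finA good near I(1)])
    also have "\<dots> = card (D \<inter> N) - card L" using L(1) D(2) finL by (intro card_Diff_subset) auto
    finally have "card I \<le> card (D \<inter> N) - card L" .
    moreover have "card L \<le> card (D \<inter> N)" using L(1) D(2) by (intro card_mono) auto
    ultimately show "card I + 2 \<le> card (D \<inter> nbrs E v)" using L(2) by (simp add: N_E)
  qed
  then show False using large_bondage by simp
qed

end

context block
begin

text \<open>Each of the edges to \<open>a\<close> and \<open>b\<close> lies in two faces, so
  \<open>f\<close> and \<open>g\<close> would be all the faces on them. No corner would then lead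
  from these two edges to a third one at \<open>x\<close>, against \<open>linked\<close>.\<close>

lemma faces_differ:
  assumes "f \<in> F" "g \<in> F" "f \<noteq> g" "nbrs f x = {a, b}" "nbrs g x = {a, b}" "d x \<ge> 3"
  shows False
proof -
  have inS: "{x, a} \<in> f" "{x, b} \<in> f" "{x, a} \<in> g" "{x, b} \<in> g" using assms(4,5) by (auto simp: nbrs_def)
  define A where "A = {{x, a}, {x, b}}"
  have "nbrs S x - {a, b} \<noteq> {}"
  proof
    assume "nbrs S x - {a, b} = {}"
    then have "card (nbrs S x) \<le> card {a, b}" by (intro card_mono) auto
    also have "\<dots> \<le> 2" by (simp add: card_insert_if)
    finally show False using assms(6) by (simp add: d_def)
  qed
  then obtain y where y: "{x, y} \<in> S" "y \<noteq> a" "y \<noteq> b" by (auto simp: nbrs_def)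
  have "A \<subseteq> {e \<in> S. x \<in> e}" using inS(1,2) face_sub[OF assms(1)] by (auto simp: A_def)
  moreover have "{x, y} \<in> {e \<in> S. x \<in> e}" "{x, y} \<notin> A" using y by (auto simp: A_def doubleton_eq_iff)
  then have "A \<noteq> {e \<in> S. x \<in> e}" by metis
  moreover have "linked S F" using cplx by (simp add: sphere_complex_def)
  ultimately obtain h e e' where h: "h \<in> F" "e \<in> h" "e' \<in> h" "x \<in> e'" "e \<in> A" "e' \<notin> A"
    unfolding linked_def by (metis A_def insert_not_empty)
  have "h = f \<or> h = g"
  proof -
    have eS: "e \<in> S" using h(1,2) face_sub by blast
    have "e \<in> f" "e \<in> g" using h(5) inS by (auto simp: A_def)
    then have "{f, g} \<subseteq> {k \<in> F. e \<in> k}" using assms(1,2) by auto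
    moreover have "card {f, g} = card {k \<in> F. e \<in> k}" using card_edge_faces[OF eS] assms(3) by simp
    ultimately have "{f, g} = {k \<in> F. e \<in> k}" by (intro card_subset_eq) simp_all
    moreover have "h \<in> {k \<in> F. e \<in> k}" using h(1,2) by simp
    ultimately show ?thesis by (metis insertE singletonD)
  qed
  then have nh: "nbrs h x = {a, b}" using assms(4,5) by auto
  have "e' \<in> E" using h(1,3) face_sub SE by blast
  then obtain w where "e' = {x, w}" using h(4) by (auto elim!: edgeE simp: insert_commute)
  then have "w \<in> {a, b}" using h(3) nh by (auto simp: nbrs_def)
  then show False using \<open>e' = {x, w}\<close> h(6) by (auto simp: A_def)
qed

end

section \<open>Counting corners at the hub\<close>

context hub
begin

text \<open>Corners rather than linked pairs are counted, because every neighbour of \<open>v\<close> lies in exactly two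
  corners.\<close>

definition "corners A B = {(f, x, y). f \<in> F \<and> x \<in> A \<and> y \<in> B \<and> x \<noteq> y \<and> {v, x} \<in> f \<and> {v, y} \<in> f}"

definition e :: "'a set \<Rightarrow> 'a set \<Rightarrow> nat" where "e A B = card (corners A B)"

lemma corner_N: "f \<in> F \<Longrightarrow> {v, x} \<in> f \<Longrightarrow> x \<in> N"
  using face_sub by (auto simp: N_def nbrs_def)

lemma fin_corners [simp]: "finite (corners A B)"
proof (rule finite_subset)
  show "corners A B \<subseteq> F \<times> N \<times> N" using corner_N by (auto simp: corners_def)
qed simp

lemma e_sym: "e A B = e B A"
  unfolding e_def
proof (rule bij_betw_same_card)
  show "bij_betw (\<lambda>(f, x, y). (f, y, x)) (corners A B) (corners B A)"
    by (rule bij_betw_byWitness[where f' = "\<lambda>(f, x, y). (f, y, x)"]) (auto simp: corners_def)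
qed

lemma e_Un: "A \<inter> A' = {} \<Longrightarrow> e (A \<union> A') B = e A B + e A' B"
proof -
  assume "A \<inter> A' = {}"
  then have "corners (A \<union> A') B = corners A B \<union> corners A' B" "corners A B \<inter> corners A' B = {}"
    by (auto simp: corners_def)
  then show ?thesis by (simp add: e_def card_Un_disjoint)
qed

lemma e_Un2: "B \<inter> B' = {} \<Longrightarrow> e A (B \<union> B') = e A B + e A B'"
  using e_Un[of B B' A] by (simp add: e_sym)

lemma e_0: "corners A B = {} \<Longrightarrow> e A B = 0"
  by (simp add: e_def)

lemma e_empty [simp]: "e {} B = 0" "e A {} = 0"
  by (rule e_0; auto simp: corners_def)+

lemma e_self [simp]: "e {x} {x} = 0"
  by (rule e_0) (auto simp: corners_def)

lemma e_mono: "A \<subseteq> A' \<Longrightarrow> B \<subseteq> B' \<Longrightarrow> e A B \<le> e A' B'"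
  unfolding e_def by (rule card_mono[OF fin_corners]) (auto simp: corners_def)

lemma e_sum: "finite A \<Longrightarrow> e A B = (\<Sum>x\<in>A. e {x} B)"
proof (induction A rule: finite_induct)
  case (insert x A)
  then have "e ({x} \<union> A) B = e {x} B + e A B" by (intro e_Un) auto
  then show ?case using insert by simp
qed simp

lemma e_N1: "x \<in> N \<Longrightarrow> e {x} N = 2"
proof -
  assume x: "x \<in> N"
  then have xS: "{v, x} \<in> S" by (simp add: N_def nbrs_def)
  have "inj_on fst (corners {x} N)"
  proof (rule inj_onI)
    fix s t assume st: "s \<in> corners {x} N" "t \<in> corners {x} N" "fst s = fst t"
    then obtain f y y' where fy: "s = (f, x, y)" "t = (f, x, y')" "f \<in> F" "{v, x} \<in> f" "{v, y} \<in> f"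
      "{v, y'} \<in> f" "x \<noteq> y" "x \<noteq> y'" by (auto simp: corners_def)
    then show "s = t" using face_nbrs_eq[of f v x y] face_nbrs_eq[of f v x y'] by auto
  qed
  then have "e {x} N = card (fst ` corners {x} N)" by (simp add: e_def card_image)
  also have "fst ` corners {x} N = {f \<in> F. {v, x} \<in> f}"
  proof (intro equalityI subsetI)
    fix f assume "f \<in> {f \<in> F. {v, x} \<in> f}"
    then have f: "f \<in> F" "{v, x} \<in> f" by auto
    obtain y where "y \<noteq> x" "{v, y} \<in> f" "nbrs f v = {x, y}" using partner[OF f] .
    then have "(f, x, y) \<in> corners {x} N" using f corner_N by (auto simp: corners_def)
    then show "f \<in> fst ` corners {x} N" by force
  qed (auto simp: corners_def)
  finally show ?thesis using card_edge_faces[OF xS] by simp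
qed

lemma e_N: "A \<subseteq> N \<Longrightarrow> e A N = 2 * card A"
proof -
  assume A: "A \<subseteq> N"
  then have "finite A" using finN by (rule finite_subset)
  then have "e A N = (\<Sum>x\<in>A. e {x} N)" by (rule e_sum)
  also have "\<dots> = (\<Sum>x\<in>A. 2)" using A e_N1 by (intro sum.cong) auto
  finally show ?thesis by simp
qed

lemma e_0D: "e A B = 0 \<Longrightarrow> x \<in> A \<Longrightarrow> y \<in> B \<Longrightarrow> \<not> link v x y"
proof -
  assume "e A B = 0" "x \<in> A" "y \<in> B"
  moreover from this have "corners A B = {}" using fin_corners[of A B] by (simp only: e_def card_0_eq)
  ultimately show "\<not> link v x y" by (auto simp: corners_def link_def)
qed

lemma e_posD: "e A B \<noteq> 0 \<Longrightarrow> \<exists>x\<in>A. \<exists>y\<in>B. link v x y"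
proof (rule ccontr)
  assume "e A B \<noteq> 0" "\<not> (\<exists>x\<in>A. \<exists>y\<in>B. link v x y)"
  then have "corners A B = {}" by (auto simp: corners_def link_def)
  then show False using \<open>e A B \<noteq> 0\<close> by (simp add: e_def)
qed

lemma e_ge_card:
  assumes "\<And>y. y \<in> A \<Longrightarrow> link v x y"
  shows "card A \<le> e {x} A"
proof -
  have "A \<subseteq> (\<lambda>(f, x, y). y) ` corners {x} A"
  proof
    fix y assume "y \<in> A"
    then obtain f where "(f, x, y) \<in> corners {x} A" using assms[of y] by (auto simp: link_def corners_def)
    then show "y \<in> (\<lambda>(f, x, y). y) ` corners {x} A" by force
  qed
  then have "card A \<le> card ((\<lambda>(f, x, y). y) ` corners {x} A)" by (rule card_mono[rotated]) simp
  also have "\<dots> \<le> e {x} A" unfolding e_def by (rule card_image_le) simp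
  finally show ?thesis .
qed

lemma N_edge: "x \<in> N \<Longrightarrow> {v, x} \<in> S" "x \<in> N \<Longrightarrow> {x, v} \<in> S"
  by (simp_all add: N_def nbrs_def insert_commute)

lemma link_N: "link v x y \<Longrightarrow> x \<in> N \<and> y \<in> N"
  using link_nbrs by (auto simp: N_def nbrs_def)

lemma v_big: "\<not> small v" using d6 by (simp add: small_def)

lemma tri_partner_K:
  assumes "f \<in> F" "tri f" "{v, x} \<in> f" "{v, y} \<in> f" "x \<noteq> y" "small x"
  shows "y \<in> K" "{x, y} \<in> S" "link x v y"
proof -
  have xy: "{x, y} \<in> f" using tri_third(1)[OF assms(1-5)] by blast
  then show xyS: "{x, y} \<in> S" using assms(1) face_sub by blast
  have "\<not> small y" using small_adj(3)[OF xyS assms(6) _ assms(1) xy] assms(2) by blast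
  then show "y \<in> K" using corner_N[OF assms(1,4)] by (simp add: K_def)
  have "{v, y} \<in> S" using assms(1,4) face_sub by blast
  then have "v \<noteq> y" using edgeS by simp
  then show "link x v y" using assms(1,3) xy unfolding link_def by (metis insert_commute)
qed

text \<open>The classes whose edge to \<open>v\<close> always lies in two triangles; hence both
  their corners at \<open>v\<close> lead to \<open>K\<close>.\<close>

definition "Y = Y2 \<union> Y4 \<union> Y5"

lemma Y_small: "x \<in> Y \<Longrightarrow> small x \<and> x \<in> N" "x \<in> Y1 \<Longrightarrow> small x \<and> x \<in> N" "x \<in> R \<Longrightarrow> small x \<and> x \<in> N"
  by (auto simp: Y_def Y2_def Y4_def Y5_def Y1_def R_def)

lemma Y_tri:
  assumes "x \<in> Y" "f \<in> F" "{v, x} \<in> f" shows "tri f"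
proof -
  have xv: "{x, v} \<in> f" using assms(3) by (simp add: insert_commute)
  have xS: "{x, v} \<in> S" using xv face_sub[OF assms(2)] by blast
  show ?thesis
  proof (cases "x \<in> Y5")
    case True
    then show ?thesis using all_tri_if[of x f v] assms(2) xv by (simp add: Y5_def small_def)
  next
    case False
    then have "tris_edge x v = 2" using assms(1) by (auto simp: Y_def Y2_def Y4_def)
    then show ?thesis using tris_edge_2[OF xS] assms(2) xv by blast
  qed
qed

lemma Y_link:
  assumes "x \<in> Y" "link v x y" shows "y \<in> K" "{x, y} \<in> S" "link x v y"
proof -
  obtain f where f: "f \<in> F" "{v, x} \<in> f" "{v, y} \<in> f" "x \<noteq> y" using assms(2) by (auto simp: link_def)
  show "y \<in> K" "{x, y} \<in> S" "link x v y"
    using tri_partner_K[OF f(1) Y_tri[OF assms(1) f(1,2)] f(2-4)] Y_small(1)[OF assms(1)] by auto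
qed

lemma e_Y:
  assumes "A \<subseteq> Y" "B \<inter> K = {}"
  shows "e A B = 0" "e A K = 2 * card A"
proof -
  have 0: "e A B = 0" if "B \<inter> K = {}" for B
    using e_posD[of A B] Y_link(1) assms(1) that by (metis disjoint_iff subsetD)
  then show "e A B = 0" using assms(2) .
  have "N = K \<union> (N - K)" by (auto simp: K_def)
  then have "e A N = e A K + e A (N - K)" using e_Un2[of K "N - K" A] by auto
  moreover have "A \<subseteq> N" using assms(1) Y_small(1) by blast
  ultimately show "e A K = 2 * card A" using 0[of "N - K"] e_N[of A] by auto
qed

lemma Y_e_le1: "x \<in> Y \<Longrightarrow> e {x} {n} \<le> 1"
proof -
  assume x: "x \<in> Y"
  have "s = t" if st: "s \<in> corners {x} {n}" "t \<in> corners {x} {n}" for s t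
  proof -
    obtain f g where fg: "s = (f, x, n)" "t = (g, x, n)" "f \<in> F" "g \<in> F" "{v, x} \<in> f" "{v, n} \<in> f"
      "{v, x} \<in> g" "{v, n} \<in> g" "x \<noteq> n" using st by (auto simp: corners_def)
    have "f = g"
      by (rule tri_distinct[OF fg(3,4) Y_tri[OF x fg(3,5)] Y_tri[OF x fg(4,7)] fg(5-9)])
    then show ?thesis using fg by simp
  qed
  then show ?thesis unfolding e_def by (simp add: card_le_Suc0_iff_eq)
qed

text \<open>The edge to \<open>v\<close> lies in a triangle \<open>g\<close> and a longer face
  \<open>f\<close>. As \<open>f\<close> does not give 20, it is not rich for \<open>x\<close>, so it
  is a quadrangle with another small vertex, which is not content. That vertex is neither
  \<open>v\<close> nor the neighbour \<open>p\<close> of the isolated vertex \<open>x\<close>, so it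
  is \<open>q\<close>, the other neighbour of \<open>v\<close> on \<open>f\<close>. The edge from
  \<open>v\<close> to \<open>q\<close> lies on the non-triangular face \<open>f\<close>, which
  leaves \<open>Y1\<close> and \<open>R\<close> for \<open>q\<close>.\<close>

lemma Y1_faces:
  assumes "x \<in> Y1"
  obtains f q p c where "f \<in> F" "\<not> tri f" "{v, x} \<in> f" "{v, q} \<in> f" "q \<noteq> x" "small q" "\<not> content q" "q \<in> Y1 \<union> R"
    "nbrs f x = {v, p}" "nbrs f q = {v, p}" "link v x c" "c \<in> K" "{x, c} \<in> S"
    "\<forall>b. link v x b \<longrightarrow> b = q \<or> b = c" "p \<noteq> c" "p \<noteq> v"
proof -
  have x: "small x" "d x = 3" "tris_edge x v = 1" "\<And>f. f \<in> F \<Longrightarrow> face_gift f x \<noteq> 20" "x \<in> N"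
    using assms by (auto simp: Y1_def)
  obtain f g where fg: "f \<noteq> g" "f \<in> F" "g \<in> F" "{x, v} \<in> f" "{x, v} \<in> g"
    "\<forall>h\<in>F. {x, v} \<in> h \<longrightarrow> h = f \<or> h = g" "\<not> tri f" "tri g"
  proof -
    obtain f g where fg: "f \<noteq> g" "f \<in> F" "g \<in> F" "{x, v} \<in> f" "{x, v} \<in> g"
      "\<And>h. h \<in> F \<Longrightarrow> {x, v} \<in> h \<Longrightarrow> h = f \<or> h = g"
      "tris_edge x v = (if tri f then 1 else 0) + (if tri g then 1 else 0)"
      using N_edge(2)[OF x(5)] by (rule tris_edge_cases) blast
    show thesis
    proof (cases "tri f")
      case True
      then have ng: "\<not> tri g" using fg(7) x(3) by (cases "tri g") simp_all
      have all: "\<forall>h\<in>F. {x, v} \<in> h \<longrightarrow> h = g \<or> h = f"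
        by (intro ballI impI) (rule fg(6)[THEN disj_commute[THEN iffD1]])
      show thesis by (rule that[OF fg(1)[symmetric] fg(3,2,5,4) all ng True])
    next
      case False
      then have tg: "tri g" using fg(7) x(3) by (cases "tri g") simp_all
      have all: "\<forall>h\<in>F. {x, v} \<in> h \<longrightarrow> h = f \<or> h = g"
        by (intro ballI impI) (rule fg(6))
      show thesis by (rule that[OF fg(1-5) all False tg])
    qed
  qed
  have vx: "{v, x} \<in> f" "{v, x} \<in> g" using fg by (simp_all add: insert_commute)
  have xf: "x \<in> \<Union>f" using vx by blast
  obtain q where q: "q \<noteq> x" "{v, q} \<in> f" "nbrs f v = {x, q}" using partner[OF fg(2) vx(1)] .
  obtain c where c: "c \<noteq> x" "{v, c} \<in> g" "nbrs g v = {x, c}" using partner[OF fg(3) vx(2)] .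
  have iso: "isolated f x" using gift_ge10(2)[OF x(1) _ fg(2) xf fg(7)] x(2) by simp
  have ncx: "\<not> content x" using x(2) by (simp add: content_def)
  have nr: "\<not> rich f x" "\<not> (\<exists>y\<in>\<Union>f. small y \<and> y \<noteq> x \<and> content y)"
    using x(4)[OF fg(2)] iso ncx fg(7) xf x(1) unfolding face_gift_def by (auto split: if_splits)
  then have r: "\<not> card f \<ge> 5" "\<exists>y\<in>\<Union>f. small y \<and> y \<noteq> x" using iso fg(7) unfolding rich_def by blast+
  have "card f \<ge> 3" using cycle_card(2)[OF face_cycle[OF fg(2)]] .
  then have c4: "card f = 4" using r(1) fg(7) by (simp add: tri_def)
  obtain p where p: "\<Union>f = {v, x, q, p}" "p \<notin> {v, x, q}" "nbrs f p = {x, q}" "nbrs f x = {v, p}" "nbrs f q = {v, p}"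
    using quad_fourth[OF fg(2) c4 vx(1) q(2) q(1)[symmetric]] .
  have "\<not> small p" using iso p(4) by (simp add: isolated_def)
  then have sq: "small q" "\<not> content q" using r(2) nr(2) p(1) v_big q(1) by auto
  have "q \<in> K \<union> Y2 \<union> Y1 \<union> Y4 \<union> Y5 \<union> R"
    using corner_N[OF fg(2) q(2)] unfolding parts_N[symmetric] .
  moreover have "q \<notin> K" using sq(1) by (simp add: K_def)
  moreover have "q \<notin> Y" using Y_tri[of q f] fg(2,7) q(2) by blast
  ultimately have qR: "q \<in> Y1 \<union> R" by (auto simp: Y_def)
  have lc: "link v x c" using c vx fg(3) unfolding link_def by metis
  have cK: "c \<in> K" "{x, c} \<in> S"
    using tri_partner_K[OF fg(3,8) vx(2) c(2) c(1)[symmetric] x(1)] by auto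
  have lb: "b = q \<or> b = c" if vb: "link v x b" for b
  proof -
    obtain h where h: "h \<in> F" "{v, x} \<in> h" "{v, b} \<in> h" "x \<noteq> b" using vb by (auto simp: link_def)
    then have "h = f \<or> h = g" using fg(6)[THEN bspec, of h] by (simp add: insert_commute)
    moreover have "b \<in> nbrs h v" using h by (simp add: nbrs_def)
    ultimately show ?thesis using q c h(4) by auto
  qed
  have pv: "p \<noteq> v" using p(2) by auto
  have xcg: "{x, c} \<in> g" using tri_third(1)[OF fg(3,8) vx(2) c(2) c(1)[symmetric]] by blast
  have "v \<noteq> c" using corner_N[OF fg(3) c(2)] N_edge(1) edgeS by blast
  then have "nbrs g x = {v, c}" using fg(3,5) xcg by (intro face_nbrs_eq)
  then have pc: "p \<noteq> c" using faces_differ[OF fg(2,3,1), of x v p] p(4) x(2) by auto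
  have all: "\<forall>b. link v x b \<longrightarrow> b = q \<or> b = c" using lb by (intro allI impI)
  show ?thesis
    by (rule that[OF fg(2,7) vx(1) q(2,1) sq qR p(4,5) lc cK all pc pv])
qed

lemma e_Y1:
  assumes "x \<in> Y1" shows "e {x} K = 1" "e {x} (Y1 \<union> R) = 1"
proof -
  obtain f q p c where *: "f \<in> F" "\<not> tri f" "{v, x} \<in> f" "{v, q} \<in> f" "q \<noteq> x" "small q" "\<not> content q" "q \<in> Y1 \<union> R"
    "nbrs f x = {v, p}" "nbrs f q = {v, p}" "link v x c" "c \<in> K" "{x, c} \<in> S"
    "\<forall>b. link v x b \<longrightarrow> b = q \<or> b = c" "p \<noteq> c" "p \<noteq> v" using Y1_faces[OF assms] .
  have "link v x q" using * unfolding link_def by metis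
  have "e {x} K \<noteq> 0" using e_0D[of "{x}" K x c] *(11,12) by blast
  moreover have "e {x} (Y1 \<union> R) \<noteq> 0" using e_0D[of "{x}" "Y1 \<union> R" x q] *(8) \<open>link v x q\<close> by blast
  moreover have "e {x} K + e {x} (Y1 \<union> R) = e {x} (K \<union> (Y1 \<union> R))"
    using parts_disjoint(1) by (intro e_Un2[symmetric]) blast
  moreover have "e {x} (K \<union> (Y1 \<union> R)) \<le> e {x} N" by (intro e_mono) (use parts_N in auto)
  ultimately show "e {x} K = 1" "e {x} (Y1 \<union> R) = 1" using e_N1[of x] Y_small(2)[OF assms] by linarith+
qed

lemma e_Y1_sum: "e Y1 K = card Y1" "e Y1 Y1 + e Y1 R = card Y1"
proof -
  show "e Y1 K = card Y1" using e_sum[of Y1 K] e_Y1(1) by simp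
  have "e Y1 (Y1 \<union> R) = card Y1" using e_sum[of Y1 "Y1 \<union> R"] e_Y1(2) by simp
  moreover have "e Y1 (Y1 \<union> R) = e Y1 Y1 + e Y1 R" using parts_disjoint by (intro e_Un2) blast
  ultimately show "e Y1 Y1 + e Y1 R = card Y1" by simp
qed

lemma e_parts: "A \<subseteq> N \<Longrightarrow> e A K + e A Y2 + e A Y1 + e A Y4 + e A Y5 + e A R = 2 * card A"
proof -
  assume "A \<subseteq> N"
  have "e A N = e A (K \<union> (Y2 \<union> (Y1 \<union> (Y4 \<union> (Y5 \<union> R)))))" using parts_N by (simp add: Un_assoc)
  also have "\<dots> = e A K + e A Y2 + e A Y1 + e A Y4 + e A Y5 + e A R"
    using parts_disjoint by (simp add: e_Un2 Un_assoc)
  finally show ?thesis using e_N[OF \<open>A \<subseteq> N\<close>] by simp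
qed

lemma Y_sub: "Y2 \<subseteq> Y" "Y4 \<subseteq> Y" "Y5 \<subseteq> Y"
  by (auto simp: Y_def)

lemma e_K_Y: "e K Y2 = 2 * card Y2" "e K Y4 = 2 * card Y4" "e K Y5 = 2 * card Y5" "e K Y1 = card Y1"
  using e_Y(2)[OF Y_sub(1), of "{}"] e_Y(2)[OF Y_sub(2), of "{}"] e_Y(2)[OF Y_sub(3), of "{}"]
    e_Y1_sum(1) e_sym[of K] by simp_all

lemma sub_N: "K \<subseteq> N" "Y2 \<subseteq> N" "Y1 \<subseteq> N" "Y4 \<subseteq> N" "Y5 \<subseteq> N" "R \<subseteq> N"
  using parts_N by blast+

text \<open>The corners at \<open>K\<close> are sorted by their other end: a vertex of
  \<open>Y2\<close>, \<open>Y4\<close> or \<open>Y5\<close> has both its corners with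
  \<open>K\<close>, a vertex of \<open>Y1\<close> has one.\<close>

lemma corner_count: "2 * card Y2 + card Y1 + 2 * card Y4 + 2 * card Y5 + e K R + e K K = 2 * card K"
  using e_parts[OF sub_N(1)] e_K_Y by simp

lemma e_R: "e R K + e R Y1 + e R R = 2 * card R"
proof -
  have "R \<inter> K = {}" using parts_disjoint by blast
  then have "e R Y2 = 0" "e R Y4 = 0" "e R Y5 = 0"
    using e_Y(1)[OF Y_sub(1)] e_Y(1)[OF Y_sub(2)] e_Y(1)[OF Y_sub(3)] e_sym[of R] by simp_all
  then show ?thesis using e_parts[OF sub_N(6)] by simp
qed

lemma e_card1: "card A = 1 \<Longrightarrow> e A A = 0"
  by (auto simp: card_1_singleton_iff)

text \<open>The second corner of a vertex of \<open>Y1\<close> leads to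
  \<open>Y1 \<union> R\<close>, and a corner has two different neighbours.\<close>

lemma Y1_R: "card Y1 = 1 \<Longrightarrow> card R \<ge> 1"
proof -
  assume Y1: "card Y1 = 1"
  have "R \<noteq> {}"
  proof
    assume "R = {}"
    then show False using e_Y1_sum(2) e_card1[of Y1] Y1 by simp
  qed
  then have "card R > 0" by (simp add: card_gt_0_iff)
  then show ?thesis by linarith
qed

text \<open>This bound and those for \<open>Y1\<close>, \<open>Y4\<close> and \<open>Y5\<close> come
  from the degree sums 12, 11, 12 and 12 of light edges, from which the degree 3, 3, 4 or 5 of the
  small end is subtracted.\<close>

lemma deg_Y2: "Y2 \<noteq> {} \<Longrightarrow> d v \<ge> 9"
proof -
  assume "Y2 \<noteq> {}"
  then obtain x where x: "x \<in> N" "small x" "d x = 3" "tris_edge x v = 2" by (auto simp: Y2_def)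
  obtain c1 c2 where c: "c1 \<noteq> c2" "v \<noteq> c1" "v \<noteq> c2" "\<forall>b. link x v b \<longleftrightarrow> b = c1 \<or> b = c2"
    "{v, c1} \<in> S" "{v, c2} \<in> S" "nbrs S x = {v, c1, c2}"
    using double_three[OF x(3) N_edge(2)[OF x(1)] x(4)] .
  have "{x, c1} \<in> S" "{x, c2} \<in> S" using c(7) by (auto simp: nbrs_def)
  then have "d x + d v \<ge> 12"
    using light_edge_double[of x v c1 c2] N_edge(2)[OF x(1)] x(2) c vU(2) by (auto simp: small_def)
  then show ?thesis using x(3) by simp
qed

lemma deg_Y1: "Y1 \<noteq> {} \<Longrightarrow> d v \<ge> 8"
proof -
  assume "Y1 \<noteq> {}"
  then obtain x where x: "x \<in> N" "small x" "d x = 3" "tris_edge x v = 1" by (auto simp: Y1_def)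
  then obtain f where "{f \<in> F. tri f \<and> {x, v} \<in> f} = {f}"
    unfolding tris_edge_def by (meson card_1_singletonE)
  then obtain f where "f \<in> F" "tri f" "{x, v} \<in> f" by blast
  then show ?thesis using light_edge_tri[of f x v] x(2,3) vU(2) by (simp add: small_def)
qed

lemma deg_Y4: "Y4 \<noteq> {} \<Longrightarrow> d v \<ge> 8"
proof -
  assume "Y4 \<noteq> {}"
  then obtain x where x: "x \<in> N" "small x" "d x = 4" "tris_edge x v = 2" "tris_at x \<ge> 3" by (auto simp: Y4_def)
  have xU: "x \<in> \<Union>S" using x(2) by (simp add: small_def)
  obtain c1 c2 y where c: "c1 \<noteq> c2" "v \<noteq> c1" "v \<noteq> c2" "y \<notin> {v, c1, c2}" "\<forall>b. link x v b \<longleftrightarrow> b = c1 \<or> b = c2"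
    "{v, c1} \<in> S" "{v, c2} \<in> S" "nbrs S x = {v, c1, c2, y}" "{y, c1} \<in> S \<or> {y, c2} \<in> S"
    using double_four[OF x(3) N_edge(2)[OF x(1)] x(4,5) xU] .
  have "{x, c1} \<in> S" "{x, c2} \<in> S" using c(8) by (auto simp: nbrs_def)
  then have "d x + d v \<ge> 12"
    using light_edge_double[of x v c1 c2] N_edge(2)[OF x(1)] x(2) c vU(2) by (auto simp: small_def)
  then show ?thesis using x(3) by simp
qed

lemma five_link:
  assumes "x \<in> Y5" "link v x c1"
  obtains y1 y2 c2 where "distinct [v, c1, y1, y2, c2]" "nbrs S x = {v, c1, y1, y2, c2}"
    "\<forall>b. link x v b \<longleftrightarrow> b = c1 \<or> b = c2"
    "{v, c1} \<in> S" "{c1, y1} \<in> S" "{y1, y2} \<in> S" "{y2, c2} \<in> S" "{v, c2} \<in> S"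
proof -
  have x: "x \<in> N" "small x" "d x = 5" "tris_at x = 5" using assms(1) by (auto simp: Y5_def)
  have xU: "x \<in> \<Union>S" using x(2) by (simp add: small_def)
  have "link x v c1" using Y_link(3)[of x c1] assms by (simp add: Y_def)
  obtain y1 y2 c2 where "distinct [v, c1, y1, y2, c2]" "nbrs S x = {v, c1, y1, y2, c2}"
    "\<forall>b. link x v b \<longleftrightarrow> b = c1 \<or> b = c2"
    "{v, c1} \<in> S" "{c1, y1} \<in> S" "{y1, y2} \<in> S" "{y2, c2} \<in> S" "{v, c2} \<in> S"
    using all_tri_five[OF x(3) N_edge(2)[OF x(1)] x(4) xU \<open>link x v c1\<close>] .
  then show ?thesis by (rule that)
qed

lemma link_exists: "x \<in> N \<Longrightarrow> \<exists>y. link v x y"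
  using e_posD[of "{x}" N] e_N1[of x] by auto

lemma deg_Y5: "Y5 \<noteq> {} \<Longrightarrow> d v \<ge> 7"
proof -
  assume "Y5 \<noteq> {}"
  then obtain x where x5: "x \<in> Y5" by blast
  then have x: "x \<in> N" "small x" "d x = 5" by (auto simp: Y5_def)
  obtain c1 where c1: "link v x c1" using link_exists[OF x(1)] by blast
  obtain y1 y2 c2 where c: "distinct [v, c1, y1, y2, c2]" "nbrs S x = {v, c1, y1, y2, c2}"
    "\<forall>b. link x v b \<longleftrightarrow> b = c1 \<or> b = c2"
    "{v, c1} \<in> S" "{c1, y1} \<in> S" "{y1, y2} \<in> S" "{y2, c2} \<in> S" "{v, c2} \<in> S"
    using five_link[OF x5 c1] .
  have "{x, c1} \<in> S" "{x, c2} \<in> S" using c(2) by (auto simp: nbrs_def)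
  have "d x + d v \<ge> 12"
  proof (rule light_edge_double[of x v c1 c2])
    show "{x, v} \<in> S" "{x, c1} \<in> S" "{x, c2} \<in> S" "{v, c1} \<in> S" "{v, c2} \<in> S" "v \<noteq> z"
      by (fact N_edge(2)[OF x(1)] \<open>{x, c1} \<in> S\<close> \<open>{x, c2} \<in> S\<close> c(4,8) vU(2))+
    show "x \<noteq> z" using x(2) by (simp add: small_def)
    show "c1 \<noteq> c2" using c(1) by simp
    fix y assume "y \<in> nbrs S x - {v, c1, c2}"
    then have "y = y1 \<or> y = y2" using c(2) by auto
    then show "{y, c1} \<in> S \<or> {y, c2} \<in> S" using c(5,7) by (metis insert_commute)
  qed
  then show ?thesis using x(3) by simp
qed

end

text \<open>The variables stand for \<open>d v\<close>, the sizes of \<open>K\<close>,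
  \<open>Y2\<close>, \<open>Y1\<close>, \<open>Y4\<close>, \<open>Y5\<close> and \<open>R\<close>,
  and the corner counts \<open>e K R\<close> and \<open>e K K\<close>. Fact 6 holds because a single
  vertex of \<open>R\<close> has no corner with itself, so without \<open>Y1\<close> its corners
  must lead to \<open>K\<close>.\<close>

lemma configuration_arith:
  fixes D k y2 y1 y4 y5 r eR eK :: nat
  assumes 1: "10 * y2 + 5 * y1 + 5 * y4 + 2 * y5 + 60 > 10 * D"
  and 2: "D = k + y2 + y1 + y4 + y5 + r"
  and 3: "2 * y2 + y1 + 2 * y4 + 2 * y5 + eR + eK = 2 * k"
  and 4: "y2 = 0 \<or> D \<ge> 9" "y1 = 0 \<or> D \<ge> 8" "y4 = 0 \<or> D \<ge> 8" "y5 = 0 \<or> D \<ge> 7"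
  and 5: "y1 \<noteq> 1 \<or> r \<ge> 1"
  and 6: "\<not> (r = 1 \<and> y1 = 0 \<and> eR = 0)" and 7: "6 \<le> D"
  shows "D = 8 \<and> k = 3 \<and> y2 = 0 \<and> r = 0 \<and> (y1 = 5 \<and> y4 + y5 = 0 \<or> y1 = 4 \<and> y4 + y5 = 1) \<or>
    D = 9 \<and> k = 4 \<and> r = 0 \<and>
      (y2 = 2 \<and> y1 = 2 \<and> y4 + y5 = 1 \<or> y2 = 2 \<and> y1 = 3 \<and> y4 + y5 = 0 \<or> y2 = 3 \<and> y1 = 2 \<and> y4 + y5 = 0) \<or>
    D = 9 \<and> k = 4 \<and> r = 1 \<and> y2 = 3 \<and> y1 = 1 \<and> y4 + y5 = 0 \<or>
    k = 5 \<and> r = 0 \<and> y1 = 0 \<and> (y2 = 5 \<and> y4 + y5 = 0 \<or> y2 = 4 \<and> y4 + y5 \<le> 1 \<or> y2 = 3 \<and> y4 + y5 = 1)"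
proof -
  \<comment> \<open>Together the first two facts say
    \<open>10 * k + 5 * y1 + 5 * y4 + 8 * y5 + 10 * r < 60\<close>.\<close>
  have k5: "k \<le> 5" using 1 2 by linarith
  have y2: "y2 \<le> 5" using 3 k5 by linarith
  have y45: "y4 \<le> 5" "y5 \<le> 5" "r \<le> 5" using 1 2 3 k5 by linarith+
  have y1: "y1 \<le> 10" using 3 k5 by linarith
  consider "D \<le> 7" | "D = 8" | "D = 9" | "D \<ge> 10" by linarith
  then show ?thesis
  proof cases
    case 1
    then have "y2 = 0" "y1 = 0" "y4 = 0" using 4 by auto
    moreover have "y5 = 0 \<or> D = 7" using 4 1 by linarith
    ultimately have False using assms(1-3) 7 1 by (elim disjE) linarith+
    then show ?thesis ..
  next
    case 2
    then have "y2 = 0" using 4 by auto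
    have "k \<le> 3" "k \<ge> 3" using \<open>y2 = 0\<close> assms(1-3) 2 by linarith+
    then have "k = 3" by simp
    then have "r = 0" "y4 + y5 \<le> 1" using \<open>y2 = 0\<close> assms(1-3) 2 by linarith+
    then consider "y4 + y5 = 0" | "y4 + y5 = 1" by linarith
    then show ?thesis
    proof cases
      case w: 1
      then have "y1 = 5" using assms(2) 2 \<open>y2 = 0\<close> \<open>k = 3\<close> \<open>r = 0\<close> by linarith
      then show ?thesis using w 2 \<open>y2 = 0\<close> \<open>k = 3\<close> \<open>r = 0\<close> by simp
    next
      case w: 2
      then have "y1 = 4" using assms(2) 2 \<open>y2 = 0\<close> \<open>k = 3\<close> \<open>r = 0\<close> by linarith
      then show ?thesis using w 2 \<open>y2 = 0\<close> \<open>k = 3\<close> \<open>r = 0\<close> by simp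
    qed
  next
    case D: 3
    then have "k \<ge> 4" using assms(1,2,3) by linarith
    then consider "k = 4" | "k = 5" using k5 by linarith
    then show ?thesis
    proof cases
      case k: 1
      have "r \<le> 1" using assms(1,2,3) D k by linarith
      moreover have y13: "y1 \<le> 3" using assms(1,2,3) D k by linarith
      moreover have "y4 + y5 \<le> 1" using assms(1,2,3) D k by linarith
      ultimately have "r = 0 \<or> r = 1" "y1 = 0 \<or> y1 = 1 \<or> y1 = 2 \<or> y1 = 3" "y4 + y5 = 0 \<or> y4 + y5 = 1"
        by linarith+
      then consider "r = 0" "y1 = 0 \<or> y1 = 1" | "r = 0" "y1 = 2" "y4 + y5 = 0" | "r = 0" "y1 = 2" "y4 + y5 = 1"
        | "r = 0" "y1 = 3" "y4 + y5 = 0" | "r = 0" "y1 = 3" "y4 + y5 = 1"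
        | "r = 1" "y1 = 0" | "r = 1" "y1 = 1" "y4 + y5 = 0" | "r = 1" "y1 = 1" "y4 + y5 = 1" | "r = 1" "y1 = 2 \<or> y1 = 3"
        by blast
      then show ?thesis
      proof cases
        case 1
        then have False using assms(2,3) 5 D k by linarith
        then show ?thesis ..
      next
        case c: 2
        then have "y2 = 3" using assms(2) D k by linarith
        then show ?thesis using c D k by simp
      next
        case c: 3
        then have "y2 = 2" using assms(2) D k by linarith
        then show ?thesis using c D k by simp
      next
        case c: 4
        then have "y2 = 2" using assms(2) D k by linarith
        then show ?thesis using c D k by simp
      next
        case c: 5
        then have False using assms(1,2) D k by linarith
        then show ?thesis ..
      next
        case c: 6
        then have "eR = 0" using assms(2,3) D k by linarith
        then show ?thesis using c 6 by simp
      next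
        case c: 7
        then have "y2 = 3" using assms(2) D k by linarith
        then show ?thesis using c D k by simp
      next
        case c: 8
        then have False using assms(1,2) D k by linarith
        then show ?thesis ..
      next
        case c: 9
        then have False using assms(1,2) D k by linarith
        then show ?thesis ..
      qed
    next
      case k: 2
      have r: "r = 0" using assms(1,2,3) D k by linarith
      have "y1 \<le> 1" using assms(1,2,3) D k by linarith
      then have y1: "y1 = 0" using 5 r by linarith
      have "y4 + y5 \<le> 1" using assms(1,2,3) D k by linarith
      then consider "y4 + y5 = 0" "y2 = 4" | "y4 + y5 = 1" "y2 = 3" using assms(2) D k r y1 by linarith
      then show ?thesis using D k r y1 by cases simp_all
    qed
  next
    case D: 4
    then have k: "k = 5" using assms(1,2,3) k5 by linarith
    have r: "r = 0" using assms(1,2,3) D k by linarith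
    have "y1 \<le> 1" using assms(1,2,3) D k by linarith
    then have y1: "y1 = 0" using 5 r by linarith
    have "D = 10" using assms(2,3) k r y1 D by linarith
    moreover have "y4 + y5 \<le> 1" using assms(1,2,3) D k by linarith
    ultimately consider "y4 + y5 = 0" "y2 = 5" | "y4 + y5 = 1" "y2 = 4" using assms(2) k r y1 by linarith
    then show ?thesis using k r y1 by cases simp_all
  qed
qed

context hub
begin

lemma configurations:
  defines "w \<equiv> card Y4 + card Y5"
  shows "d v = 8 \<and> card K = 3 \<and> card Y2 = 0 \<and> card R = 0 \<and> (card Y1 = 5 \<and> w = 0 \<or> card Y1 = 4 \<and> w = 1) \<or>
    d v = 9 \<and> card K = 4 \<and> card R = 0 \<and>
      (card Y2 = 2 \<and> card Y1 = 2 \<and> w = 1 \<or> card Y2 = 2 \<and> card Y1 = 3 \<and> w = 0 \<or> card Y2 = 3 \<and> card Y1 = 2 \<and> w = 0) \<or>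
    d v = 9 \<and> card K = 4 \<and> card R = 1 \<and> card Y2 = 3 \<and> card Y1 = 1 \<and> w = 0 \<or>
    card K = 5 \<and> card R = 0 \<and> card Y1 = 0 \<and> (card Y2 = 5 \<and> w = 0 \<or> card Y2 = 4 \<and> w \<le> 1 \<or> card Y2 = 3 \<and> w = 1)"
  unfolding w_def
proof (rule configuration_arith)
  show "10 * d v < 10 * card Y2 + 5 * card Y1 + 5 * card Y4 + 2 * card Y5 + 60"
    using excess loss_parts by linarith
  show "d v = card K + card Y2 + card Y1 + card Y4 + card Y5 + card R" by (rule d_parts)
  show "2 * card Y2 + card Y1 + 2 * card Y4 + 2 * card Y5 + e K R + e K K = 2 * card K" by (rule corner_count)
  show "card Y2 = 0 \<or> 9 \<le> d v" "card Y1 = 0 \<or> 8 \<le> d v" "card Y4 = 0 \<or> 8 \<le> d v" "card Y5 = 0 \<or> 7 \<le> d v"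
    using deg_Y2 deg_Y1 deg_Y4 deg_Y5 by auto
  show "card Y1 \<noteq> 1 \<or> 1 \<le> card R" using Y1_R by blast
  show "6 \<le> d v" by (rule d6)
  show "\<not> (card R = 1 \<and> card Y1 = 0 \<and> e K R = 0)"
  proof
    assume *: "card R = 1 \<and> card Y1 = 0 \<and> e K R = 0"
    then have "e R Y1 = 0" using e_Y1_sum(2) e_sym[of R Y1] by simp
    moreover have "e R K = 0" using * e_sym[of R K] by simp
    ultimately show False using e_R e_card1[of R] * by simp
  qed
qed

text \<open>A vertex of \<open>Y2\<close> has no outer neighbour, one of \<open>Y1\<close> or
  \<open>Y4\<close> at most one. For \<open>Y5\<close> only \<open>y1\<close> and \<open>y2\<close>
  remain, which are adjacent because the faces around the vertex are triangles.\<close>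

lemma harmless_Y: assumes "x \<in> Y2 \<union> Y1 \<union> Y4 \<union> Y5" shows "harmless x"
proof -
  have x: "small x" "x \<in> N" using assms by (auto simp: Y2_def Y1_def Y4_def Y5_def)
  have out: "outer x = nbrs S x - insert v N" using small_E(1)[OF x(1)] by (simp add: outer_def)
  have vN: "y \<in> N" if "{v, y} \<in> S" for y using that by (simp add: N_def nbrs_def)
  have xU: "x \<in> \<Union>S" using x(1) by (simp add: small_def)
  have one: "harmless x" if "outer x \<subseteq> {y}" for y
    using that unfolding harmless_def by (metis singletonD subsetD)
  consider "x \<in> Y2" | "x \<in> Y1" | "x \<in> Y4" | "x \<in> Y5" using assms by blast
  then show ?thesis
  proof cases
    case 1
    then have *: "d x = 3" "tris_edge x v = 2" by (auto simp: Y2_def)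
    obtain c1 c2 where c: "c1 \<noteq> c2" "v \<noteq> c1" "v \<noteq> c2" "\<forall>b. link x v b \<longleftrightarrow> b = c1 \<or> b = c2"
      "{v, c1} \<in> S" "{v, c2} \<in> S" "nbrs S x = {v, c1, c2}"
      using double_three[OF *(1) N_edge(2)[OF x(2)] *(2)] .
    then have "outer x \<subseteq> {v}" using vN[of c1] vN[of c2] unfolding out by auto
    then show ?thesis by (rule one)
  next
    case 2
    obtain f q p c where *: "f \<in> F" "\<not> tri f" "{v, x} \<in> f" "{v, q} \<in> f" "q \<noteq> x" "small q" "\<not> content q" "q \<in> Y1 \<union> R"
      "nbrs f x = {v, p}" "nbrs f q = {v, p}" "link v x c" "c \<in> K" "{x, c} \<in> S"
      "\<forall>b. link v x b \<longrightarrow> b = q \<or> b = c" "p \<noteq> c" "p \<noteq> v" using Y1_faces[OF 2] .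
    have cN: "c \<in> N" using *(12) by (simp add: K_def)
    then have "v \<noteq> c" using N_edge(1) edgeS by blast
    moreover have "{v, c} \<subseteq> nbrs S x" using *(13) N_edge(2)[OF x(2)] by (simp add: nbrs_def)
    ultimately have "card (nbrs S x - {v, c}) = 1" using 2 by (simp add: card_Diff_subset Y1_def flip: d_def)
    then obtain y where "nbrs S x - {v, c} = {y}" by (meson card_1_singletonE)
    then have "outer x \<subseteq> {y}" using cN unfolding out by blast
    then show ?thesis by (rule one)
  next
    case 3
    then have *: "d x = 4" "tris_edge x v = 2" "tris_at x \<ge> 3" by (auto simp: Y4_def)
    obtain c1 c2 y where c: "c1 \<noteq> c2" "v \<noteq> c1" "v \<noteq> c2" "y \<notin> {v, c1, c2}" "\<forall>b. link x v b \<longleftrightarrow> b = c1 \<or> b = c2"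
      "{v, c1} \<in> S" "{v, c2} \<in> S" "nbrs S x = {v, c1, c2, y}" "{y, c1} \<in> S \<or> {y, c2} \<in> S"
      using double_four[OF *(1) N_edge(2)[OF x(2)] *(2,3) xU] .
    then have "outer x \<subseteq> {y}" using vN[of c1] vN[of c2] unfolding out by auto
    then show ?thesis by (rule one)
  next
    case 4
    obtain c1 where c1: "link v x c1" using link_exists[OF x(2)] by blast
    obtain y1 y2 c2 where c: "distinct [v, c1, y1, y2, c2]" "nbrs S x = {v, c1, y1, y2, c2}"
      "\<forall>b. link x v b \<longleftrightarrow> b = c1 \<or> b = c2"
      "{v, c1} \<in> S" "{c1, y1} \<in> S" "{y1, y2} \<in> S" "{y2, c2} \<in> S" "{v, c2} \<in> S"
      using five_link[OF 4 c1] .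
    then have sub: "outer x \<subseteq> {y1, y2}" using vN[of c1] vN[of c2] unfolding out by auto
    have y12: "{y1, y2} \<in> E" "{y2, y1} \<in> E" using c(6) SE by (auto simp: insert_commute)
    show ?thesis unfolding harmless_def
    proof (intro ballI)
      fix i j assume "i \<in> outer x" "j \<in> outer x"
      then have "i \<in> {y1, y2}" "j \<in> {y1, y2}" using sub by blast+
      then show "i = j \<or> {i, j} \<in> E" using y12 by auto
    qed
  qed
qed

lemma link_K_S:
  assumes "x \<in> Y2 \<union> Y1 \<union> Y4 \<union> Y5" "n \<in> K" "link v n x" shows "{n, x} \<in> S"
proof (cases "x \<in> Y1")
  case True
  obtain f q p c where *: "f \<in> F" "\<not> tri f" "{v, x} \<in> f" "{v, q} \<in> f" "q \<noteq> x" "small q" "\<not> content q" "q \<in> Y1 \<union> R"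
    "nbrs f x = {v, p}" "nbrs f q = {v, p}" "link v x c" "c \<in> K" "{x, c} \<in> S"
    "\<forall>b. link v x b \<longrightarrow> b = q \<or> b = c" "p \<noteq> c" "p \<noteq> v" using Y1_faces[OF True] .
  have "n = q \<or> n = c" using *(14) link_sym[OF assms(3)] by simp
  moreover have "n \<noteq> q" using assms(2) *(6) by (auto simp: K_def)
  ultimately show ?thesis using *(13) by (simp add: insert_commute)
next
  case False
  then have "x \<in> Y" using assms(1) by (auto simp: Y_def)
  then have "{x, n} \<in> S" using link_sym[OF assms(3)] by (rule Y_link(2))
  then show ?thesis by (simp add: insert_commute)
qed

text \<open>All corners between \<open>K\<close> and \<open>Y2\<close> or \<open>Y1\<close> then sit
  at \<open>K - {n}\<close>. So does at least one of the two corners of each vertex of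
  \<open>Y4\<close> and \<open>Y5\<close>, since such a vertex has at most one corner with
  \<open>n\<close>.\<close>

lemma uncovered:
  assumes n: "n \<in> K" and no: "\<And>x. x \<in> Y2 \<union> Y1 \<Longrightarrow> \<not> link v n x"
  shows "2 * card Y2 + card Y1 + card Y4 + card Y5 + 2 \<le> 2 * card K"
    "e {n} Y2 = 0" "e {n} Y1 = 0" "e (K - {n}) Y2 = 2 * card Y2" "e (K - {n}) Y1 = card Y1"
proof -
  show 0: "e {n} Y2 = 0" "e {n} Y1 = 0" using e_posD[of "{n}"] no by blast+
  have split: "e K A = e (K - {n}) A + e {n} A" for A
    using e_Un[of "K - {n}" "{n}" A] n by (simp add: insert_absorb)
  show 1: "e (K - {n}) Y2 = 2 * card Y2" "e (K - {n}) Y1 = card Y1"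
    using split[of Y2] split[of Y1] 0 e_K_Y by simp_all
  have w: "e {n} A \<le> card A" if "A \<subseteq> Y" "finite A" for A
  proof -
    have "e A {n} = (\<Sum>x\<in>A. e {x} {n})" by (rule e_sum[OF that(2)])
    also have "\<dots> \<le> (\<Sum>x\<in>A. 1)" using that(1) Y_e_le1 by (intro sum_mono) blast
    finally show ?thesis by (simp add: e_sym)
  qed
  have "e (K - {n}) Y4 \<ge> card Y4" "e (K - {n}) Y5 \<ge> card Y5"
    using split[of Y4] split[of Y5] e_K_Y w[OF Y_sub(2)] w[OF Y_sub(3)] by simp_all
  moreover have "e (K - {n}) Y2 + e (K - {n}) Y1 + e (K - {n}) Y4 + e (K - {n}) Y5 \<le> 2 * card (K - {n})"
  proof -
    have "K - {n} \<subseteq> N" using sub_N(1) by blast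
    from e_parts[OF this] show ?thesis by linarith
  qed
  moreover have "card (K - {n}) + 1 = card K"
    using n by (metis Suc_eq_plus1 card_Suc_Diff1 fin_parts(1))
  ultimately show "2 * card Y2 + card Y1 + card Y4 + card Y5 + 2 \<le> 2 * card K" using 1 by linarith
qed

text \<open>At most three vertices of degree 3 cost at most \<open>3 * 2 + 1 = 7\<close> deletions.
  Every vertex of \<open>K\<close> has a neighbour in \<open>L\<close>, and the remaining neighbours
  of \<open>v\<close> are harmless.\<close>

lemma kill_cover:
  assumes L: "L \<subseteq> Y2 \<union> Y1" "2 \<le> card L" "card L \<le> 3" and R: "R = {}"
    and cov: "\<And>n. n \<in> K \<Longrightarrow> \<exists>x\<in>L. link v n x"
  shows False
proof (rule kill[where L = L and W = "{}"])
  have L3: "small x \<and> d x = 3" if "x \<in> L" for x using L(1) that by (auto simp: Y2_def Y1_def)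
  show "L \<subseteq> N" using L(1) sub_N by blast
  show "small x \<and> d x \<le> 4" if "x \<in> L" for x using L3[OF that] by simp
  have "(\<Sum>x\<in>L. d x - 1) = (\<Sum>x\<in>L. 2)" using L3 by (intro sum.cong) auto
  then show "(\<Sum>x\<in>L. d x - 1) + 1 + (\<Sum>x\<in>{}. d x - 2) \<le> 8" using L(3) by simp
  fix a assume a: "a \<in> N - L"
  have "a \<in> K \<or> a \<in> Y2 \<union> Y1 \<union> Y4 \<union> Y5" using a R parts_N by auto
  then show "(\<exists>x\<in>L. {a, x} \<in> S) \<or> {} \<noteq> {} \<and> {undefined, a} \<in> S \<and> {undefined, a} \<in> S \<or> harmless a"
  proof
    assume "a \<in> K"
    then obtain x where "x \<in> L" "link v a x" using cov by blast
    then have "{a, x} \<in> S" using link_K_S[of x a] \<open>a \<in> K\<close> L(1) by blast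
    then show ?thesis using \<open>x \<in> L\<close> by blast
  qed (use harmless_Y in blast)
qed (use L in auto)

end

section \<open>Covering the large neighbours, and the configurations that resist\<close>

context hub
begin

lemma Y2_link:
  assumes "x \<in> Y2"
  obtains a b where "a \<noteq> b" "a \<in> K" "b \<in> K" "\<forall>n. link v x n \<longleftrightarrow> n = a \<or> n = b"
proof -
  have xY: "x \<in> Y" and xN: "x \<in> N" using assms Y_sub sub_N by blast+
  obtain a b where ab: "a \<noteq> b" "\<forall>n. link v x n \<longleftrightarrow> n = a \<or> n = b" "{x, a} \<in> S" "{x, b} \<in> S"
    using link_double[OF N_edge(1)[OF xN] Y_tri[OF xY]] .
  then have "a \<in> K" "b \<in> K" using Y_link(1)[OF xY] by auto
  then show ?thesis using ab by (intro that[of a b]) auto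
qed

text \<open>One vertex of \<open>Y1\<close> is chosen for each element of \<open>K\<close>. They
  cannot all coincide, since a vertex of \<open>Y1\<close> has only one corner with
  \<open>K\<close>.\<close>

lemma cover_three:
  assumes K: "card K = 3" and Y2: "Y2 = {}" and cov: "\<And>n. n \<in> K \<Longrightarrow> \<exists>x\<in>Y2 \<union> Y1. link v n x"
  shows "\<exists>L\<subseteq>Y2 \<union> Y1. 2 \<le> card L \<and> card L \<le> 3 \<and> (\<forall>n\<in>K. \<exists>x\<in>L. link v n x)"
proof -
  obtain h where h: "\<And>n. n \<in> K \<Longrightarrow> h n \<in> Y2 \<union> Y1 \<and> link v n (h n)" using cov by metis
  have "card (h ` K) \<le> 3" using card_image_le[of K h] K by simp
  moreover have "2 \<le> card (h ` K)"
  proof (rule ccontr)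
    assume "\<not> 2 \<le> card (h ` K)"
    moreover have "h ` K \<noteq> {}" using K by auto
    then have "card (h ` K) > 0" by (simp add: card_gt_0_iff)
    ultimately have "card (h ` K) = 1" by linarith
    then obtain x where x: "h ` K = {x}" by (meson card_1_singletonE)
    then have hx: "h n = x" if "n \<in> K" for n using that by blast
    obtain n where n: "n \<in> K" using \<open>h ` K \<noteq> {}\<close> by blast
    have "x \<in> Y1" using h[OF n] hx[OF n] Y2 by simp
    have "card K \<le> e {x} K" using h hx link_sym by (intro e_ge_card) metis
    then show False using K e_Y1(1)[OF \<open>x \<in> Y1\<close>] by simp
  qed
  ultimately show ?thesis using h by (intro exI[of _ "h ` K"]) auto
qed

text \<open>A vertex of \<open>Y2\<close> covers two elements of \<open>K\<close>; one vertex for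
  each of the other two suffices.\<close>

lemma cover_four:
  assumes K: "card K = 4" and Y2: "Y2 \<noteq> {}" and cov: "\<And>n. n \<in> K \<Longrightarrow> \<exists>x\<in>Y2 \<union> Y1. link v n x"
  shows "\<exists>L\<subseteq>Y2 \<union> Y1. 2 \<le> card L \<and> card L \<le> 3 \<and> (\<forall>n\<in>K. \<exists>x\<in>L. link v n x)"
proof -
  obtain x where x: "x \<in> Y2" using Y2 by blast
  obtain a b where ab: "a \<noteq> b" "a \<in> K" "b \<in> K" "\<forall>n. link v x n \<longleftrightarrow> n = a \<or> n = b" using Y2_link[OF x] .
  have "card (K - {a, b}) = 2" using K ab by (simp add: card_Diff_subset)
  then obtain m n where mn: "K - {a, b} = {m, n}" by (meson card_2_iff)
  then have mK: "m \<in> K" "n \<in> K" "m \<notin> {a, b}" by blast+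
  obtain y where y: "y \<in> Y2 \<union> Y1" "link v m y" using cov[OF mK(1)] by blast
  obtain w where w: "w \<in> Y2 \<union> Y1" "link v n w" using cov[OF mK(2)] by blast
  have "y \<noteq> x" using link_sym[OF y(2)] ab(4) mK(3) by auto
  then have "card {x, y} \<le> card {x, y, w}" by (intro card_mono) auto
  then have "2 \<le> card {x, y, w}" using \<open>y \<noteq> x\<close> by simp
  moreover have "card {x, y, w} \<le> 3" by (simp add: card_insert_if)
  moreover have "\<exists>u\<in>{x, y, w}. link v k u" if "k \<in> K" for k
  proof (cases "k \<in> {a, b}")
    case True
    then show ?thesis using ab(4) link_sym by blast
  next
    case False
    then have "k \<in> {m, n}" unfolding mn[symmetric] using that by simp
    then show ?thesis using y w by auto
  qed
  ultimately show ?thesis using x y w by (intro exI[of _ "{x, y, w}"]) auto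
qed

text \<open>Two vertices of \<open>Y2\<close> with disjoint links and one more vertex cover
  \<open>K\<close>. If every vertex of \<open>Y2\<close> were linked to \<open>a\<close> or
  \<open>b\<close>, these two would have at least \<open>2 + 3\<close> corners with
  \<open>Y2\<close>, but they have only 4 corners in all.\<close>

lemma cover_five:
  assumes K: "card K = 5" and Y2: "card Y2 \<ge> 4" and cov: "\<And>n. n \<in> K \<Longrightarrow> \<exists>x\<in>Y2. link v n x"
  shows "\<exists>L\<subseteq>Y2 \<union> Y1. 2 \<le> card L \<and> card L \<le> 3 \<and> (\<forall>n\<in>K. \<exists>x\<in>L. link v n x)"
proof -
  have "Y2 \<noteq> {}" using Y2 by auto
  then obtain x where x: "x \<in> Y2" by blast
  obtain a b where ab: "a \<noteq> b" "a \<in> K" "b \<in> K" "\<forall>n. link v x n \<longleftrightarrow> n = a \<or> n = b" using Y2_link[OF x] .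
  have card3: "card (K - {a, b}) = 3" using K ab by (simp add: card_Diff_subset)
  have "\<exists>y\<in>Y2. \<forall>n\<in>{a, b}. \<not> link v y n"
  proof (rule ccontr)
    assume "\<not> ?thesis"
    then have ge1: "e {y} {a, b} \<ge> 1" if "y \<in> Y2" for y
      using e_0D[of "{y}" "{a, b}" y] that by (metis One_nat_def Suc_leI insertI1 not_gr_zero)
    have "card {a, b} \<le> e {x} {a, b}" using ab(4) by (intro e_ge_card) auto
    then have "2 \<le> e {x} {a, b}" using ab(1) by simp
    moreover have "(\<Sum>y\<in>Y2 - {x}. e {y} {a, b}) \<ge> (\<Sum>y\<in>Y2 - {x}. 1)" using ge1 by (intro sum_mono) auto
    moreover have "e Y2 {a, b} = e {x} {a, b} + (\<Sum>y\<in>Y2 - {x}. e {y} {a, b})"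
      using e_sum[of Y2 "{a, b}"] x by (simp add: sum.remove)
    moreover have "card (Y2 - {x}) \<ge> 3" using Y2 x by simp
    moreover have "e Y2 {a, b} \<le> e {a, b} N" using e_mono[of "{a, b}" "{a, b}" Y2 N] sub_N(2) e_sym[of Y2] by simp
    moreover have "e {a, b} N = 2 * card {a, b}" using ab sub_N(1) by (intro e_N) blast
    ultimately show False using ab(1) by simp
  qed
  then obtain y where y: "y \<in> Y2" "\<not> link v y a" "\<not> link v y b" by blast
  obtain c d where cd: "c \<noteq> d" "c \<in> K" "d \<in> K" "\<forall>n. link v y n \<longleftrightarrow> n = c \<or> n = d" using Y2_link[OF y(1)] .
  have cd': "{c, d} \<subseteq> K - {a, b}" using cd y by auto
  then have "card (K - {a, b} - {c, d}) = 1" using card3 cd(1) by (subst card_Diff_subset) auto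
  then obtain m where m: "K - {a, b} - {c, d} = {m}" by (meson card_1_singletonE)
  then have "m \<in> K" by blast
  then obtain w where w: "w \<in> Y2" "link v m w" using cov by blast
  have "y \<noteq> x" using y ab by auto
  then have "card {x, y} \<le> card {x, y, w}" by (intro card_mono) auto
  then have "2 \<le> card {x, y, w}" using \<open>y \<noteq> x\<close> by simp
  moreover have "card {x, y, w} \<le> 3" by (simp add: card_insert_if)
  moreover have "\<exists>u\<in>{x, y, w}. link v k u" if "k \<in> K" for k
  proof -
    have "k \<in> {a, b} \<or> k \<in> {c, d} \<or> k \<in> K - {a, b} - {c, d}" using that by blast
    then show ?thesis
    proof (elim disjE)
      assume "k \<in> {a, b}" then show ?thesis using ab(4) link_sym by blast
    next
      assume "k \<in> {c, d}" then show ?thesis using cd(4) link_sym by blast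
    next
      assume "k \<in> K - {a, b} - {c, d}" then show ?thesis using w unfolding m by blast
    qed
  qed
  ultimately show ?thesis using x y w by (intro exI[of _ "{x, y, w}"]) auto
qed

text \<open>Three doubles whose links pairwise meet form a closed triangle in the link of \<open>v\<close>, which is impossible
  if some other neighbour exists.\<close>

lemma disjoint_doubles:
  assumes Y2: "card Y2 = 3" and n: "n \<in> K" "e {n} Y2 = 0"
  obtains x y where "x \<in> Y2" "y \<in> Y2" "x \<noteq> y" "\<And>m. \<not> (link v x m \<and> link v y m)"
proof (rule ccontr)
  note found = that
  assume no: "\<not> thesis"
  have meet: "\<exists>m. link v x m \<and> link v y m" if xy: "x \<in> Y2" "y \<in> Y2" "x \<noteq> y" for x y
  proof (rule ccontr)
    assume "\<not> ?thesis"
    then have thesis by (intro found[OF xy]) blast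
    then show False using no by simp
  qed
  obtain x y w where xyw: "Y2 = {x, y, w}" "x \<noteq> y" "x \<noteq> w" "y \<noteq> w" using Y2 by (auto simp: card_3_iff)
  obtain a b where ab: "a \<noteq> b" "a \<in> K" "b \<in> K" "\<forall>m. link v x m \<longleftrightarrow> m = a \<or> m = b"
    using Y2_link[of x] xyw(1) by blast
  obtain c d where cd: "c \<noteq> d" "c \<in> K" "d \<in> K" "\<forall>m. link v y m \<longleftrightarrow> m = c \<or> m = d"
    using Y2_link[of y] xyw(1) by blast
  obtain g h where gh: "g \<noteq> h" "g \<in> K" "h \<in> K" "\<forall>m. link v w m \<longleftrightarrow> m = g \<or> m = h"
    using Y2_link[of w] xyw(1) by blast
  have KN: "K \<subseteq> N" by (rule sub_N(1))
  have no3: False if "link v x m" "link v y m" "link v w m" for m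
  proof -
    have "m \<in> N" using link_N[OF that(1)] by simp
    have "card Y2 \<le> e {m} Y2" using that link_sym xyw(1) by (intro e_ge_card) auto
    also have "\<dots> \<le> e {m} N" using sub_N(2) by (intro e_mono) auto
    finally show False using e_N1[OF \<open>m \<in> N\<close>] Y2 by simp
  qed
  define T where "T = {a, b, c, d, g, h}"
  have "card T \<le> 3"
  proof -
    obtain m1 where m1: "m1 \<in> {a, b}" "m1 \<in> {c, d}" using meet[of x y] xyw ab(4) cd(4) by auto
    obtain m2 where m2: "m2 \<in> {a, b}" "m2 \<in> {g, h}" using meet[of x w] xyw ab(4) gh(4) by auto
    obtain m3 where m3: "m3 \<in> {c, d}" "m3 \<in> {g, h}" using meet[of y w] xyw cd(4) gh(4) by auto
    have "m1 \<noteq> m2" "m1 \<noteq> m3" "m2 \<noteq> m3" using no3[of m1] no3[of m2] m1 m2 m3 ab(4) cd(4) gh(4) by auto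
    then have "{a, b} = {m1, m2}" "{c, d} = {m1, m3}" "{g, h} = {m2, m3}"
      using m1 m2 m3 by auto
    then have "{a, b} \<union> {c, d} \<union> {g, h} = {m1, m2} \<union> {m1, m3} \<union> {m2, m3}" by simp
    moreover have "T = {a, b} \<union> {c, d} \<union> {g, h}" by (auto simp: T_def)
    ultimately have "T = {m1, m2, m3}" by auto
    then show ?thesis by (simp add: card_insert_if)
  qed
  have TK: "T \<subseteq> K" using ab cd gh by (auto simp: T_def)
  have Y2T: "m \<in> T" if "u \<in> Y2" "link v u m" for u m
    using that xyw(1) ab(4) cd(4) gh(4) by (auto simp: T_def)
  have "e Y2 T = e Y2 N"
  proof -
    have "N = T \<union> (N - T)" using TK KN by blast
    then have "e Y2 N = e Y2 T + e Y2 (N - T)" using e_Un2[of T "N - T" Y2] by auto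
    moreover have "e Y2 (N - T) = 0" using e_posD[of Y2 "N - T"] Y2T by blast
    ultimately show ?thesis by simp
  qed
  then have "e T Y2 = 6" using e_N[OF sub_N(2)] Y2 e_sym[of Y2 T] by simp
  moreover have "e T N = e T Y2 + e T (N - Y2)"
  proof -
    have "N = Y2 \<union> (N - Y2)" using sub_N(2) by blast
    then show ?thesis using e_Un2[of Y2 "N - Y2" T] by auto
  qed
  moreover have "e T N = 2 * card T" using TK KN by (intro e_N) blast
  ultimately have eT: "e T (N - Y2) = 0" using \<open>card T \<le> 3\<close> by linarith
  have closed: "m' \<in> T \<union> Y2" if m: "m \<in> T \<union> Y2" "link v m m'" for m m'
  proof (cases "m \<in> Y2")
    case True then show ?thesis using Y2T m(2) by blast
  next
    case False
    then have "m \<in> T" using m(1) by blast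
    then have "m' \<notin> N - Y2" using e_0D[OF eT] m(2) by blast
    then show ?thesis using link_N[OF m(2)] by blast
  qed
  have nT: "n \<notin> T \<union> Y2"
  proof -
    have "n \<notin> T"
    proof
      assume "n \<in> T"
      then obtain u where "u \<in> Y2" "link v u n" using xyw(1) ab(4) cd(4) gh(4) unfolding T_def by blast
      then show False using e_0D[OF n(2), of n u] link_sym by blast
    qed
    moreover have "n \<notin> Y2" using n(1) parts_disjoint by blast
    ultimately show ?thesis by blast
  qed
  \<comment> \<open>\<open>T \<union> Y2\<close> is closed under links at \<open>v\<close>, so no
    corner leads out of the set \<open>A\<close> of edges from \<open>v\<close> to it. Since
    \<open>{v, n}\<close> is not in \<open>A\<close>, this contradicts
    \<open>linked\<close>.\<close>
  define A where "A = (\<lambda>m. {v, m}) ` (T \<union> Y2)"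
  have TYN: "T \<union> Y2 \<subseteq> N" using TK KN sub_N(2) by blast
  have "A \<subseteq> {k \<in> S. v \<in> k}" using TYN N_edge(1) by (auto simp: A_def)
  moreover have "A \<noteq> {}" using xyw(1) by (auto simp: A_def)
  moreover have "{v, n} \<in> {k \<in> S. v \<in> k}" using N_edge(1) n(1) KN by blast
  moreover have "{v, n} \<notin> A" using nT by (auto simp: A_def doubleton_eq_iff)
  ultimately have "A \<subseteq> {k \<in> S. v \<in> k} \<and> A \<noteq> {} \<and> A \<noteq> {k \<in> S. v \<in> k}" by metis
  moreover have "\<forall>v A. A \<subseteq> {k \<in> S. v \<in> k} \<and> A \<noteq> {} \<and> A \<noteq> {k \<in> S. v \<in> k} \<longrightarrow>
      (\<exists>f\<in>F. \<exists>k\<in>f. \<exists>k'\<in>f. v \<in> k' \<and> k \<in> A \<and> k' \<notin> A)"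
    using cplx unfolding sphere_complex_def linked_def by (elim conjE)
  ultimately have "\<exists>f\<in>F. \<exists>k\<in>f. \<exists>k'\<in>f. v \<in> k' \<and> k \<in> A \<and> k' \<notin> A" by (elim allE impE)
  then obtain f k k' where f: "f \<in> F" "k \<in> f" "k' \<in> f" "v \<in> k'" "k \<in> A" "k' \<notin> A" by (elim bexE conjE)
  obtain m where m: "m \<in> T \<union> Y2" "k = {v, m}" using f(5) by (auto simp: A_def)
  have "k' \<in> E" using f(1,3) face_sub SE by blast
  then obtain m' where m': "k' = {v, m'}" using f(4) by (auto elim!: edgeE simp: insert_commute)
  have "m \<noteq> m'" using f(5,6) m(2) m' by auto
  then have "link v m m'" using f m(2) m' unfolding link_def by blast
  then have "m' \<in> T \<union> Y2" by (rule closed[OF m(1)])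
  then show False using f(6) m' by (auto simp: A_def)
qed

text \<open>Two vertices of \<open>Y2\<close> with disjoint links cover all of \<open>K\<close> but
  \<open>n\<close>, and \<open>n\<close> is linked to the only vertex \<open>w\<close> of
  \<open>Y4 \<union> Y5\<close>. If \<open>w\<close> has degree 4 it joins \<open>L\<close>, at the
  cost \<open>2 + 2 + 3 + 1\<close>. If it has degree 5 it keeps its edges to \<open>v\<close> and
  to \<open>y1\<close>, the neighbour following \<open>n\<close> around \<open>w\<close>, at the
  cost \<open>2 + 2 + 1 + 3\<close>; then \<open>n\<close> is excluded as a common neighbour of
  \<open>w\<close>, \<open>y1\<close> and \<open>v\<close>.\<close>

lemma kill_uncovered:
  assumes K: "card K = 5" and R: "R = {}" and Y1: "Y1 = {}" and Y2: "card Y2 = 3" and w1: "card Y4 + card Y5 = 1"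
    and n: "n \<in> K" "\<And>x. x \<in> Y2 \<union> Y1 \<Longrightarrow> \<not> link v n x"
  shows False
proof -
  note unc = uncovered[OF n]
  obtain x y where xy: "x \<in> Y2" "y \<in> Y2" "x \<noteq> y" "\<And>m. \<not> (link v x m \<and> link v y m)"
    using disjoint_doubles[OF Y2 n(1) unc(2)] by blast
  obtain a b where ab: "a \<noteq> b" "a \<in> K" "b \<in> K" "\<forall>m. link v x m \<longleftrightarrow> m = a \<or> m = b" using Y2_link[OF xy(1)] .
  obtain c d' where cd: "c \<noteq> d'" "c \<in> K" "d' \<in> K" "\<forall>m. link v y m \<longleftrightarrow> m = c \<or> m = d'" using Y2_link[OF xy(2)] .
  have nab: "n \<notin> {a, b, c, d'}" using n(2) xy(1,2) ab(4) cd(4) link_sym by blast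
  have dis: "{a, b} \<inter> {c, d'} = {}" using xy(4)[of a] xy(4)[of b] ab(4) cd(4) by auto
  have "card {n, a, b, c, d'} = 5" using nab dis ab(1) cd(1) by auto
  moreover have "{n, a, b, c, d'} \<subseteq> K" using ab cd n(1) by blast
  ultimately have K5: "K = {n, a, b, c, d'}" using K card_subset_eq[of K "{n, a, b, c, d'}"] by simp
  have cov: "\<exists>u\<in>{x, y}. link v k u" if "k \<in> K" "k \<noteq> n" for k
  proof -
    have "k \<in> {a, b} \<or> k \<in> {c, d'}" using that K5 by auto
    then show ?thesis using ab(4) cd(4) link_sym by blast
  qed
  have xyd: "small x" "d x = 3" "small y" "d y = 3" using xy by (auto simp: Y2_def)
  have covS: "\<exists>u\<in>{x, y}. {k, u} \<in> S" if "k \<in> K" "k \<noteq> n" for k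
    using cov[OF that] link_K_S[OF _ that(1)] xy(1,2) by blast
  \<comment> \<open>Otherwise both corners of \<open>n\<close> lead into \<open>K\<close>, and the
    four vertices of \<open>K - {n}\<close> would have at least \<open>2 + 6 + 2\<close> corners
    instead of 8.\<close>
  have nw: "\<exists>w \<in> Y4 \<union> Y5. link v n w"
  proof (rule ccontr)
    assume "\<not> ?thesis"
    then have "e {n} Y4 = 0" "e {n} Y5 = 0" using e_posD[of "{n}"] by blast+
    moreover have "n \<in> N" using n(1) sub_N by blast
    ultimately have nK: "e {n} K = 2" using e_parts[of "{n}"] unc(2,3) R by simp
    have split: "e K B = e (K - {n}) B + e {n} B" for B
      using e_Un[of "K - {n}" "{n}" B] n(1) by (simp add: insert_absorb)
    have "e {n} K = e {n} (K - {n})" using split[of "{n}"] e_sym[of K "{n}"] e_sym[of "K - {n}" "{n}"] by simp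
    then have "e (K - {n}) {n} = 2" using nK e_sym by simp
    then have "e (K - {n}) K \<ge> 2" using e_mono[of "K - {n}" "K - {n}" "{n}" K] n(1) by simp
    moreover have "e (K - {n}) Y4 = 2 * card Y4" "e (K - {n}) Y5 = 2 * card Y5"
      using split[of Y4] split[of Y5] e_K_Y \<open>e {n} Y4 = 0\<close> \<open>e {n} Y5 = 0\<close> by simp_all
    moreover have "K - {n} \<subseteq> N" using sub_N(1) by blast
    from e_parts[OF this] have "e (K - {n}) K + e (K - {n}) Y2 + e (K - {n}) Y4 + e (K - {n}) Y5 \<le> 2 * card (K - {n})"
      by linarith
    moreover have "card (K - {n}) = 4" using K n(1) by simp
    ultimately show False using unc(4) Y2 w1 by linarith
  qed
  then obtain w where w: "w \<in> Y4 \<union> Y5" "link v n w" by blast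
  have wS: "{n, w} \<in> S" using link_K_S[of w n] w n(1) by blast
  have wsm: "small w" "w \<in> N" using w(1) by (auto simp: Y4_def Y5_def)
  have wY2: "w \<notin> Y2" using w(1) parts_disjoint by blast
  have rest: "k \<in> K \<or> k \<in> Y2 \<union> Y1 \<union> Y4 \<union> Y5" if "k \<in> N" for k using that R parts_N by auto
  show False
  proof (cases "w \<in> Y4")
    case True
    then have dw: "d w = 4" by (simp add: Y4_def)
    have wxy: "w \<noteq> x" "w \<noteq> y" using wY2 xy by auto
    show False
    proof (rule kill[where L = "{x, y, w}" and W = "{}"])
      show "{x, y, w} \<subseteq> N" using xy(1,2) sub_N(2) wsm(2) by blast
      show "2 \<le> card {x, y, w}" using xy(3) wxy by (simp add: card_insert_if)
      show "(\<Sum>x\<in>{x, y, w}. d x - 1) + 1 + (\<Sum>x\<in>{}. d x - 2) \<le> 8"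
        using xy(3) wxy xyd dw by auto
      show "small u \<and> d u \<le> 4" if "u \<in> {x, y, w}" for u using that xyd wsm dw by auto
      fix k assume "k \<in> N - {x, y, w}"
      then have "k \<in> K \<or> k \<in> Y2 \<union> Y1 \<union> Y4 \<union> Y5" using rest by blast
      then show "(\<exists>x\<in>{x, y, w}. {k, x} \<in> S) \<or> {} \<noteq> {} \<and> {undefined, k} \<in> S \<and> {undefined, k} \<in> S \<or> harmless k"
      proof
        assume "k \<in> K"
        then have "\<exists>x\<in>{x, y, w}. {k, x} \<in> S" using covS[of k] wS by (cases "k = n") auto
        then show ?thesis by blast
      qed (use harmless_Y in blast)
    qed auto
  next
    case False
    then have w5: "w \<in> Y5" using w(1) by blast
    obtain y1 y2 c2 where c: "distinct [v, n, y1, y2, c2]" "nbrs S w = {v, n, y1, y2, c2}"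
      "\<forall>b. link w v b \<longleftrightarrow> b = n \<or> b = c2"
      "{v, n} \<in> S" "{n, y1} \<in> S" "{y1, y2} \<in> S" "{y2, c2} \<in> S" "{v, c2} \<in> S"
      using five_link[OF w5 link_sym[OF w(2)]] .
    have dw: "d w = 5" using w5 by (simp add: Y5_def)
    have "{w, c2} \<in> S" "{w, y1} \<in> S" using c(2) by (auto simp: nbrs_def)
    have c2K: "c2 \<in> K"
    proof -
      have "\<not> small c2" using small_adj(3)[of w c2] wsm(1) \<open>{w, c2} \<in> S\<close>
      proof -
        have "link w v c2" using c(3) by blast
        then obtain f where f: "f \<in> F" "{w, v} \<in> f" "{w, c2} \<in> f" by (auto simp: link_def)
        have "tri f" using Y_tri[of w f] w5 f(1,2) by (simp add: Y_def insert_commute)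
        then show ?thesis using small_adj(3)[OF \<open>{w, c2} \<in> S\<close> wsm(1) _ f(1,3)] by blast
      qed
      then show ?thesis using c(8) by (simp add: K_def N_def nbrs_def)
    qed
    have "c2 \<noteq> n" using c(1) by auto
    show False
    proof (rule kill[where L = "{x, y}" and W = "{w}" and w = w and y = y1])
      show "{x, y} \<subseteq> N" using xy(1,2) sub_N(2) by blast
      show "2 \<le> card {x, y}" using xy(3) by simp
      show "(\<Sum>x\<in>{x, y}. d x - 1) + 1 + (\<Sum>x\<in>{w}. d x - 2) \<le> 8"
        using xy(3) xyd dw by simp
      show "small u \<and> d u \<le> 4" if "u \<in> {x, y}" for u using that xyd by auto
      show "{w} = {} \<or> {w} = {w}" by simp
      show "w \<in> N - {x, y} \<and> small w \<and> {w, y1} \<in> S \<and> y1 \<noteq> v \<and>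
         (\<forall>k\<in>nbrs S w - {v, y1}. {k, y1} \<in> S \<or> (\<exists>u\<in>{x, y}. {u, k} \<in> S))"
      proof (intro conjI ballI)
        show "w \<in> N - {x, y}" using wsm wY2 xy by auto
        show "small w" "{w, y1} \<in> S" by fact+
        show "y1 \<noteq> v" using c(1) by auto
        fix k assume "k \<in> nbrs S w - {v, y1}"
        then have "k = n \<or> k = y2 \<or> k = c2" using c(2) by auto
        then show "{k, y1} \<in> S \<or> (\<exists>u\<in>{x, y}. {u, k} \<in> S)"
        proof (elim disjE)
          assume "k = c2"
          then show ?thesis using covS[OF c2K \<open>c2 \<noteq> n\<close>] by (auto simp: insert_commute)
        qed (use c(5,6) in \<open>simp_all add: insert_commute\<close>)
      qed
      fix k assume "k \<in> N - {x, y}"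
      then have "k \<in> K \<or> k \<in> Y2 \<union> Y1 \<union> Y4 \<union> Y5" using rest by blast
      then show "(\<exists>x\<in>{x, y}. {k, x} \<in> S) \<or> {w} \<noteq> {} \<and> {w, k} \<in> S \<and> {y1, k} \<in> S \<or> harmless k"
      proof
        assume "k \<in> K"
        then show ?thesis using covS[of k] wS c(5) by (cases "k = n") (auto simp: insert_commute)
      qed (use harmless_Y in blast)
    qed
  qed
qed

lemma outer_small: "small x \<Longrightarrow> outer x = nbrs S x - insert v N"
  by (simp add: outer_def small_E)

text \<open>The only vertex \<open>t\<close> of \<open>R\<close> need not be harmless. If it is not
  in \<open>D\<close>, the usual count works. If it is, then \<open>v\<close>, \<open>K\<close> and
  the common neighbour \<open>p\<close> of \<open>t\<close> and \<open>u\<close> are not in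
  \<open>D\<close>, so \<open>Y2\<close> and \<open>u\<close> lack dominators and lie in
  \<open>D\<close>. Thus \<open>D \<inter> N\<close> has five elements, while every vertex of
  \<open>I\<close> is one of at most three outer neighbours of \<open>t\<close>.\<close>

lemma exceptional_configuration:
  assumes K: "card K = 4" and R1: "card R = 1" and Y2: "card Y2 = 3" and Y1c: "card Y1 = 1" and w0: "Y4 = {}" "Y5 = {}"
    and L: "L \<subseteq> Y2 \<union> Y1" "2 \<le> card L" "card L \<le> 3" "\<And>n. n \<in> K \<Longrightarrow> \<exists>x\<in>L. link v n x"
  shows False
proof -
  obtain u where u: "Y1 = {u}" using Y1c by (meson card_1_singletonE)
  obtain t where t: "R = {t}" using R1 by (meson card_1_singletonE)
  have ut: "u \<in> Y1" "t \<in> R" "u \<noteq> t" using u t parts_disjoint by auto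
  have tsm: "small t" "t \<in> N" using Y_small(3)[OF ut(2)] by auto
  have usm: "small u" "u \<in> N" "d u = 3" using ut(1) by (auto simp: Y1_def)
  obtain f q p c where f: "f \<in> F" "\<not> tri f" "{v, u} \<in> f" "{v, q} \<in> f" "q \<noteq> u" "small q" "\<not> content q" "q \<in> Y1 \<union> R"
    "nbrs f u = {v, p}" "nbrs f q = {v, p}" "link v u c" "c \<in> K" "{u, c} \<in> S"
    "\<forall>b. link v u b \<longrightarrow> b = q \<or> b = c" "p \<noteq> c" "p \<noteq> v" using Y1_faces[OF ut(1)] .
  have qt: "q = t" using f(5,8) u t by auto
  have vc: "v \<noteq> c" using f(12) sub_N(1) N_edge(1) edgeS by blast
  have up: "{u, p} \<in> S" "{t, p} \<in> S"
    using f(1,9,10) face_sub qt by (auto simp: nbrs_def)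
  have nu: "nbrs S u = {v, c, p}"
    using nbrs_three[OF usm(3) N_edge(2)[OF usm(2)] f(13) up(1)] vc f(15,16) by auto
  have "e R K = 1"
  proof -
    have "e Y1 Y1 = 0" using e_card1[OF Y1c] .
    then have "e R Y1 = 1" using e_Y1_sum(2) Y1c e_sym[of R Y1] by simp
    then show ?thesis using e_R e_card1[OF R1] R1 by simp
  qed
  then obtain n where n: "n \<in> K" "link v t n" using e_posD[of R K] t by auto
  then obtain g where g: "g \<in> F" "{v, t} \<in> g" "{v, n} \<in> g" "t \<noteq> n" by (auto simp: link_def)
  \<comment> \<open>By \<open>Y1_faces\<close> the vertex \<open>t\<close> is not content, so it has
    no small neighbour and no rich face. A longer face \<open>g\<close> would be rich for
    \<open>t\<close>: if it is a quadrangle, its other vertices are \<open>v\<close>,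
    \<open>n\<close> and a neighbour of \<open>t\<close>, none of them small.\<close>
  have tg: "tri g" if "d t = 5"
  proof (rule ccontr)
    assume ng: "\<not> tri g"
    have tg: "t \<in> \<Union>g" using g by blast
    have nosm: "\<not> small k" if "k \<in> nbrs S t" for k using f(7) that \<open>d t = 5\<close> qt by (auto simp: content_def)
    have "nbrs g t \<subseteq> nbrs S t" using face_sub[OF g(1)] by (auto simp: nbrs_def)
    then have iso: "isolated g t" using nosm by (auto simp: isolated_def)
    have "\<not> rich g t" using f(7) g(1) tg \<open>d t = 5\<close> qt by (auto simp: content_def)
    then have r: "\<not> card g \<ge> 5" "\<exists>k\<in>\<Union>g. small k \<and> k \<noteq> t" using iso ng unfolding rich_def by blast+
    have "card g \<ge> 3" using cycle_card(2)[OF face_cycle[OF g(1)]] .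
    then have c4: "card g = 4" using r(1) ng by (simp add: tri_def)
    obtain p' where p': "\<Union>g = {v, t, n, p'}" "p' \<notin> {v, t, n}" "nbrs g p' = {t, n}" "nbrs g t = {v, p'}" "nbrs g n = {v, p'}"
      using quad_fourth[OF g(1) c4 g(2,3,4)] .
    have "\<not> small p'" using iso p'(4) by (simp add: isolated_def)
    moreover have "\<not> small n" using n(1) by (simp add: K_def)
    ultimately show False using r(2) p'(1) v_big by auto
  qed
  \<comment> \<open>The vertex \<open>v\<close> is not outer, and if \<open>t\<close> has degree 5,
    the triangle \<open>g\<close> supplies \<open>n\<close> as a second neighbour that is not
    outer.\<close>
  have outer_t: "card (outer t) \<le> 3"
  proof (cases "d t = 5")
    case True
    have tn: "{t, n} \<in> S" using tri_partner_K(2)[OF g(1) tg[OF True] g(2,3,4) tsm(1)] .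
    have "v \<noteq> n" using n(1) sub_N(1) N_edge(1) edgeS by blast
    moreover have "{v, n} \<subseteq> nbrs S t" using tn N_edge(2)[OF tsm(2)] by (simp add: nbrs_def)
    ultimately have "card (nbrs S t - {v, n}) = 3" using True by (simp add: card_Diff_subset flip: d_def)
    moreover have "outer t \<subseteq> nbrs S t - {v, n}" using n(1) sub_N(1) unfolding outer_small[OF tsm(1)] by blast
    ultimately show ?thesis using card_mono[of "nbrs S t - {v, n}" "outer t"] by simp
  next
    case False
    then have "d t \<le> 4" using small_d[OF tsm(1)] by auto
    moreover have "v \<in> nbrs S t" using N_edge(2)[OF tsm(2)] by (simp add: nbrs_def)
    ultimately have "card (nbrs S t - {v}) \<le> 3" by (simp flip: d_def)
    moreover have "outer t \<subseteq> nbrs S t - {v}" unfolding outer_small[OF tsm(1)] by blast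
    ultimately show ?thesis using card_mono[of "nbrs S t - {v}" "outer t"] by simp
  qed
  have L3: "small x \<and> d x = 3" if "x \<in> L" for x using L(1) that by (auto simp: Y2_def Y1_def)
  have LN: "L \<subseteq> N" using L(1) sub_N by blast
  have finL: "finite L" using LN finN by (rule finite_subset)
  have "independent_bondage_number V E \<le> 8"
  proof (rule kill_bound[where v = v and L = L and W = "{}" and w = v and z = v])
    show "L \<subseteq> nbrs E v" "finite L" "2 \<le> card L" "{} = {} \<or> {} = {v}" using LN finL L(2) by (simp_all add: N_E)
    show "nbrs E x \<inter> L = {}" if "x \<in> L" for x
      by (rule small_independent[OF _ that]) (use L3 in auto)
    have "(\<Sum>x\<in>L. vertex_degree E x - 1) = (\<Sum>x\<in>L. 2)"
      using L3 small_E(2) by (intro sum.cong) auto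
    then show "(\<Sum>x\<in>L. vertex_degree E x - 1) + 1 + (\<Sum>x\<in>{}. vertex_degree E x - 2) \<le> 8"
      using L(3) by simp
  next
    fix D I
    assume DV: "D \<subseteq> V" and D: "\<And>x. x \<in> D \<Longrightarrow> nbrs E x \<inter> D = {}"
      and Ddom: "\<And>x. x \<in> V - D \<Longrightarrow> nbrs E x \<inter> D \<noteq> {}" and LD: "L \<subseteq> D" and IV: "I \<subseteq> V"
      and I: "\<And>x. x \<in> I \<Longrightarrow> nbrs E x \<inter> I = {}"
       "\<And>x. x \<in> I \<Longrightarrow> x \<notin> nbrs E v \<and> x \<noteq> v \<and> nbrs E x \<inter> (D \<inter> nbrs E v - L) \<noteq> {}"
    let ?A = "D \<inter> N - L"
    have nedge: "\<not> (x \<in> D \<and> y \<in> D)" if "{x, y} \<in> S" for x y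
      using D[of x] that SE by (auto simp: nbrs_def)
    have near: "\<exists>a\<in>?A. i \<in> outer a" if "i \<in> I" for i
    proof -
      have i: "i \<notin> N" "i \<noteq> v" "nbrs E i \<inter> ?A \<noteq> {}" using I(2)[OF that] by (auto simp: N_E)
      then obtain a where "a \<in> ?A" "a \<in> nbrs E i" by blast
      then have "i \<in> outer a" using i nbrs_sym[of i E a] by (simp add: outer_def)
      then show ?thesis using \<open>a \<in> ?A\<close> by blast
    qed
    have DK: "D \<inter> K = {}"
    proof (rule ccontr)
      assume "D \<inter> K \<noteq> {}"
      then obtain k where k: "k \<in> D" "k \<in> K" by blast
      then obtain x where "x \<in> L" "link v k x" using L(4) by blast
      then have "{k, x} \<in> S" using link_K_S[of x k] k(2) L(1) by blast
      then show False using nedge k(1) \<open>x \<in> L\<close> LD by blast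
    qed
    have vD: "v \<notin> D"
    proof
      assume "v \<in> D"
      obtain x where "x \<in> L" using L(2) by fastforce
      then show False using nedge[of v x] N_edge(1)[of x] LN LD \<open>v \<in> D\<close> by blast
    qed
    have inV: "x \<in> V" if "x \<in> N" for x using that edgeD SE N_edge(1) by blast
    have "D \<inter> N \<subseteq> Y2 \<union> {u, t}" using DK parts_N w0 u t by blast
    show "card I + 2 \<le> card (D \<inter> nbrs E v)"
    proof (cases "t \<in> D")
      case False
      have "card I \<le> card ?A"
      proof (rule card_le_if_harmless[OF _ _ near I(1)])
        fix a assume "a \<in> ?A"
        then have "a \<in> Y2 \<union> Y1" using \<open>D \<inter> N \<subseteq> Y2 \<union> {u, t}\<close> False u by blast
        then show "harmless a" using harmless_Y by blast
      qed simp_all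
      also have "\<dots> = card (D \<inter> N) - card L" using LN LD finL by (intro card_Diff_subset) auto
      finally have "card I \<le> card (D \<inter> N) - card L" .
      moreover have "card L \<le> card (D \<inter> N)" using LN LD by (intro card_mono) auto
      ultimately show ?thesis using L(2) by (simp add: N_E)
    next
      case True
      have YD: "Y2 \<subseteq> D"
      proof
        fix x assume x: "x \<in> Y2"
        then have xs: "small x" "x \<in> N" "d x = 3" by (auto simp: Y2_def)
        show "x \<in> D"
        proof (rule ccontr)
          assume "x \<notin> D"
          then obtain k where k: "k \<in> D" "{x, k} \<in> S"
            using Ddom[of x] inV[OF xs(2)] small_E(1)[OF xs(1)] by (auto simp: nbrs_def)
          have *: "d x = 3" "tris_edge x v = 2" using x by (auto simp: Y2_def)
          obtain c1 c2 where c: "c1 \<noteq> c2" "v \<noteq> c1" "v \<noteq> c2" "\<forall>b. link x v b \<longleftrightarrow> b = c1 \<or> b = c2"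
            "{v, c1} \<in> S" "{v, c2} \<in> S" "nbrs S x = {v, c1, c2}"
            using double_three[OF *(1) N_edge(2)[OF xs(2)] *(2)] .
          have "k \<in> {v, c1, c2}" using k(2) c(7) by (auto simp: nbrs_def)
          then have "k \<in> N" using c(5,6) k(1) vD by (auto simp: N_def nbrs_def)
          moreover have "\<not> small k" using small_adj(1)[OF k(2) xs(1)] xs(3) by auto
          ultimately have "k \<in> K" by (simp add: K_def)
          then show False using DK k(1) by blast
        qed
      qed
      have uD: "u \<in> D"
      proof (rule ccontr)
        assume "u \<notin> D"
        then obtain k where k: "k \<in> D" "{u, k} \<in> S"
          using Ddom[of u] inV[OF usm(2)] small_E(1)[OF usm(1)] by (auto simp: nbrs_def)
        then have "k \<in> {v, c, p}" using nu by (auto simp: nbrs_def)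
        then show False using vD DK f(12) k(1) nedge[OF up(2)] True by blast
      qed
      have "D \<inter> N = Y2 \<union> {u, t}" using \<open>D \<inter> N \<subseteq> Y2 \<union> {u, t}\<close> YD uD True sub_N(2) usm(2) tsm(2) by blast
      moreover have "u \<notin> Y2" "t \<notin> Y2" using ut parts_disjoint by blast+
      ultimately have card5: "card (D \<inter> N) = 5" using Y2 ut(3) by simp
      have "I \<subseteq> outer t"
      proof
        fix i assume i: "i \<in> I"
        then obtain a where a: "a \<in> ?A" "i \<in> outer a" using near by blast
        have iN: "i \<notin> N" "i \<noteq> v" using a(2) by (auto simp: outer_def)
        have "a \<in> Y2 \<union> {u, t}" using a(1) \<open>D \<inter> N = Y2 \<union> {u, t}\<close> by blast
        then consider "a \<in> Y2" | "a = u" | "a = t" by blast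
        then show "i \<in> outer t"
        proof cases
          case 1
          then have *: "small a" "d a = 3" "tris_edge a v = 2" "a \<in> N" by (auto simp: Y2_def)
          obtain c1 c2 where c: "c1 \<noteq> c2" "v \<noteq> c1" "v \<noteq> c2" "\<forall>b. link a v b \<longleftrightarrow> b = c1 \<or> b = c2"
            "{v, c1} \<in> S" "{v, c2} \<in> S" "nbrs S a = {v, c1, c2}"
            using double_three[OF *(2) N_edge(2)[OF *(4)] *(3)] .
          have "i \<in> {v, c1, c2}" using a(2) c(7) outer_small[OF *(1)] by auto
          then show ?thesis using iN c(5,6) by (auto simp: N_def nbrs_def)
        next
          case 2
          then have "i \<in> {v, c, p}" using a(2) nu outer_small[OF usm(1)] by auto
          then have "i = p" using iN f(12) sub_N(1) by blast
          then show ?thesis using up(2) iN outer_small[OF tsm(1)] by (simp add: nbrs_def)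
        qed (use a in simp)
      qed
      moreover have "finite (outer t)" by (simp add: outer_def)
      ultimately have "card I \<le> 3" using outer_t card_mono[of "outer t" I] by simp
      then show ?thesis using card5 by (simp add: N_E)
    qed
  qed simp_all
  then show False using large_bondage by simp
qed

lemma no_hub: False
proof -
  define w where "w = card Y4 + card Y5"
  have cov: "\<exists>x\<in>Y2 \<union> Y1. link v n x"
    if big: "2 * card K < 2 * card Y2 + card Y1 + w + 2" and n: "n \<in> K" for n
  proof (rule ccontr)
    assume "\<not> ?thesis"
    then have "2 * card Y2 + card Y1 + card Y4 + card Y5 + 2 \<le> 2 * card K"
      using uncovered(1)[OF n] by blast
    then show False using big by (simp add: w_def)
  qed
  have kc: False if RR: "R = {}" and ex: "\<exists>L\<subseteq>Y2 \<union> Y1. 2 \<le> card L \<and> card L \<le> 3 \<and> (\<forall>n\<in>K. \<exists>x\<in>L. link v n x)"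
  proof -
    obtain L where "L \<subseteq> Y2 \<union> Y1" "2 \<le> card L" "card L \<le> 3" "\<forall>n\<in>K. \<exists>x\<in>L. link v n x" using ex by blast
    then show False using kill_cover[of L] RR by blast
  qed
  have R0: "R = {}" if "card R = 0" using that by simp
  consider "card K = 3" "card Y2 = 0" "card R = 0" "card Y1 = 5 \<and> w = 0 \<or> card Y1 = 4 \<and> w = 1"
    | "card K = 4" "card R = 0" "card Y2 = 2 \<and> card Y1 = 2 \<and> w = 1 \<or> card Y2 = 2 \<and> card Y1 = 3 \<and> w = 0 \<or> card Y2 = 3 \<and> card Y1 = 2 \<and> w = 0"
    | "card K = 4" "card R = 1" "card Y2 = 3" "card Y1 = 1" "w = 0"
    | "card K = 5" "card R = 0" "card Y1 = 0" "card Y2 = 5 \<and> w = 0 \<or> card Y2 = 4 \<and> w = 1"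
    | "card K = 5" "card R = 0" "card Y1 = 0" "card Y2 = 4" "w = 0"
    | "card K = 5" "card R = 0" "card Y1 = 0" "card Y2 = 3" "w = 1"
  proof -
    have "w \<le> 1 \<longleftrightarrow> w = 0 \<or> w = 1" by auto
    then show thesis using configurations[folded w_def] that by (elim disjE conjE) auto
  qed
  then show False
  proof cases
    case 1
    have "2 * card K < 2 * card Y2 + card Y1 + w + 2" using 1 by auto
    then show False using kc[OF R0[OF 1(3)] cover_three[OF 1(1)]] cov 1(2) by simp
  next
    case 2
    have "2 * card K < 2 * card Y2 + card Y1 + w + 2" "Y2 \<noteq> {}" using 2 by auto
    then show False using kc[OF R0[OF 2(2)] cover_four[OF 2(1)]] cov by simp
  next
    case 3
    have "2 * card K < 2 * card Y2 + card Y1 + w + 2" "Y2 \<noteq> {}" using 3 by auto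
    then obtain L where L: "L \<subseteq> Y2 \<union> Y1" "2 \<le> card L" "card L \<le> 3" "\<forall>n\<in>K. \<exists>x\<in>L. link v n x"
      using cover_four[OF 3(1)] cov by metis
    have "Y4 = {}" "Y5 = {}" using 3(5) by (simp_all add: w_def)
    then show False using exceptional_configuration[OF 3(1,2,3,4) _ _ L(1-3)] L(4) by blast
  next
    case 4
    have "2 * card K < 2 * card Y2 + card Y1 + w + 2" "card Y2 \<ge> 4" "Y1 = {}" using 4 by auto
    then show False using kc[OF R0[OF 4(2)] cover_five[OF 4(1)]] cov by simp
  next
    case 5
    have e0: "Y4 = {}" "Y5 = {}" "Y1 = {}" "R = {}" using 5 by (simp_all add: w_def)
    \<comment> \<open>Here \<open>uncovered\<close> holds with equality and gives no contradiction
      by itself. But both corners of an uncovered \<open>n\<close> lead into \<open>K\<close>, so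
      the four vertices of \<open>K - {n}\<close> would have at least \<open>2 + 8\<close> corners
      instead of 8.\<close>
    have "\<exists>x\<in>Y2. link v n x" if n: "n \<in> K" for n
    proof (rule ccontr)
      assume "\<not> ?thesis"
      then have no: "\<And>x. x \<in> Y2 \<union> Y1 \<Longrightarrow> \<not> link v n x" using e0 by simp
      note unc = uncovered[OF n no]
      have nN: "{n} \<subseteq> N" "K - {n} \<subseteq> N" using n sub_N by blast+
      have nK: "e {n} K = 2" using e_parts[OF nN(1)] unc(2) e0 by simp
      have "e K {n} = e (K - {n}) {n} + e {n} {n}"
        using e_Un[of "K - {n}" "{n}" "{n}"] n by (simp add: insert_absorb)
      then have "e (K - {n}) {n} = 2" using nK e_sym[of K "{n}"] by simp
      then have "e (K - {n}) K \<ge> 2" using e_mono[of "K - {n}" "K - {n}" "{n}" K] n by simp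
      moreover have "e (K - {n}) K + e (K - {n}) Y2 \<le> 2 * card (K - {n})" using e_parts[OF nN(2)] by linarith
      moreover have "card (K - {n}) = 4" using 5(1) n by simp
      ultimately show False using unc(4) 5(4) by linarith
    qed
    then show False using kc[OF e0(4) cover_five[OF 5(1)]] 5(4) by simp
  next
    case 6
    have e0: "Y1 = {}" "R = {}" using 6 by simp_all
    show False
    proof (cases "\<forall>n\<in>K. \<exists>x\<in>Y2. link v n x")
      case True
      then show False using 6(4) by (intro kill_cover[of Y2, OF _ _ _ e0(2)]) auto
    next
      case False
      then obtain n where "n \<in> K" "\<And>x. x \<in> Y2 \<union> Y1 \<Longrightarrow> \<not> link v n x" using e0 by auto
      moreover have "card Y4 + card Y5 = 1" using 6(5) by (simp only: w_def)
      ultimately show False using kill_uncovered[OF 6(1) e0(2,1) 6(4)] by blast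
    qed
  qed
qed

end

theorem theorem1p1:
  fixes V :: "'a set" and E :: "'a set set"
  assumes "finite V" and "V \<noteq> {}"
    and "simple_graph V E"
    and "planar V E"
    and "min_degree V E \<ge> 3"
  shows "independent_bondage_number V E \<le> 8"
proof (rule ccontr)
  assume large: "\<not> ?thesis"
  obtain p \<gamma> where "plane_drawing V E p \<gamma>" using assms(4) unfolding planar_def by blast
  then interpret drawing V E p \<gamma> by unfold_locales (rule assms)+
  have deg: "card (nbrs E v) \<ge> 3" if "v \<in> V" for v
  proof -
    have "min_degree V E \<le> vertex_degree E v" using that assms(1) by (simp add: min_degree_def)
    then show ?thesis using assms(5) by (simp add: degree_eq_card_nbrs)
  qed
  obtain S F z where S: "S \<subseteq> E" "sphere_complex S F"
    "\<And>v x. v \<in> \<Union>S - {z} \<Longrightarrow> {v, x} \<in> E \<Longrightarrow> {v, x} \<in> S"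
    using leaf_block[OF assms(2) deg] by metis
  have "\<Union>S \<subseteq> V" using S(1) simple by (auto simp: simple_graph_def)
  then interpret block V E S F z
    using S deg large by unfold_locales auto
  obtain v where "v \<in> \<Union>S" "v \<noteq> z" "d v \<ge> 6" "loss v > 10 * int (d v) - 60" by (rule excessive_loss)
  then interpret hub V E S F z v by unfold_locales
  show False by (rule no_hub)
qed

end
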